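(* Assume the Generalised Riemann Hypothesis. Then for each $\eta\in\{-1,1\}$, as $x\to\infty$, $$\max_{d\le x}\left|\frac{\#\{pq\le x:\ \chi_d(p)=\chi_d(q)=\eta\}}{\frac14\,\#\{pq\le x:\ (pq,d)=1\}}-1\right|\ \sim\ \frac{\log\log\log x}{\log\log x},$$ where the maximum is over all quadratic Dirichlet characters $\chi_d$ of conductor $d\le x$.
   Context: In the counts, $p$ and $q$ denote primes (possibly equal), and $\#\{pq\le x:\dots\}$ counts the integers at most $x$ that are a product $pq$ of two primes satisfying the stated condition. A quadratic character $\chi_d$ of conductor $d$ is a primitive, real, non-principal Dirichlet character modulo $d$. $(m,n)$ denotes the greatest common divisor. The Generalised Riemann Hypothesis asserts that for every Dirichlet character $\chi$ (including the trivial one, i.e. the Riemann zeta function) all zeros of $L(s,\chi)$ with $0<\operatorname{Re}(s)<1$ satisfy $\operatorname{Re}(s)=1/2$. The notation $f(x)\sim g(x)$ means $f(x)/g(x)\to1$ as $x\to\infty$. *)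

theory Defs
  imports
    "HOL-Complex_Analysis.Complex_Analysis"
    "HOL-Computational_Algebra.Primes"
    "HOL-Library.Landau_Symbols"
begin

text \<open>Characters are represented by their values on the natural numbers, extended by zero
  to the arguments that are not coprime to the modulus.\<close>

definition dirichlet_character :: "nat \<Rightarrow> (nat \<Rightarrow> complex) \<Rightarrow> bool" where
  "dirichlet_character q \<psi> \<longleftrightarrow>
     q > 0 \<and>
     \<psi> 1 = 1 \<and>
     (\<forall>m n. \<psi> (m * n) = \<psi> m * \<psi> n) \<and>
     (\<forall>n. \<psi> (n + q) = \<psi> n) \<and>
     (\<forall>n. \<psi> n = 0 \<longleftrightarrow> \<not> coprime n q)"

definition principal_character :: "nat \<Rightarrow> nat \<Rightarrow> complex" where
  "principal_character q n = (if coprime n q then 1 else 0)"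

definition primitive_character :: "nat \<Rightarrow> (nat \<Rightarrow> complex) \<Rightarrow> bool" where
  "primitive_character q \<psi> \<longleftrightarrow>
     dirichlet_character q \<psi> \<and>
     \<not> (\<exists>q' \<phi>. q' dvd q \<and> q' < q \<and> dirichlet_character q' \<phi> \<and>
            (\<forall>n. coprime n q \<longrightarrow> \<psi> n = \<phi> n))"

definition quadratic_character :: "nat \<Rightarrow> (nat \<Rightarrow> complex) \<Rightarrow> bool" where
  "quadratic_character d \<psi> \<longleftrightarrow>
     primitive_character d \<psi> \<and> (\<forall>n. \<psi> n \<in> \<real>) \<and> \<psi> \<noteq> principal_character d"

text \<open>The meromorphic continuation of the Dirichlet series to the whole plane. It is unique
  because nice meromorphicity fixes the value at a pole to be 0; the only possible pole is
  at \<open>s = 1\<close>, so this convention introduces no zeros in the critical strip. The series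
  starts at \<open>n = 1\<close>.\<close>

definition dirichlet_L :: "(nat \<Rightarrow> complex) \<Rightarrow> complex \<Rightarrow> complex" where
  "dirichlet_L \<psi> = (THE L. L nicely_meromorphic_on UNIV \<and>
     (\<forall>s. Re s > 1 \<longrightarrow> (\<lambda>n. \<psi> (Suc n) / of_nat (Suc n) powr s) sums L s))"

definition generalised_riemann_hypothesis :: bool where
  "generalised_riemann_hypothesis \<longleftrightarrow>
     (\<forall>q \<psi> s. dirichlet_character q \<psi> \<longrightarrow> 0 < Re s \<longrightarrow> Re s < 1 \<longrightarrow>
        dirichlet_L \<psi> s = 0 \<longrightarrow> Re s = 1 / 2)"

definition semiprimes_with_values :: "(nat \<Rightarrow> complex) \<Rightarrow> complex \<Rightarrow> real \<Rightarrow> nat set" where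
  "semiprimes_with_values \<psi> \<eta> x =
     {n. real n \<le> x \<and> (\<exists>p q. prime p \<and> prime q \<and> n = p * q \<and> \<psi> p = \<eta> \<and> \<psi> q = \<eta>)}"

definition semiprimes_coprime_to :: "nat \<Rightarrow> real \<Rightarrow> nat set" where
  "semiprimes_coprime_to d x =
     {n. real n \<le> x \<and> (\<exists>p q. prime p \<and> prime q \<and> n = p * q) \<and> coprime n d}"

definition semiprime_bias :: "nat \<Rightarrow> (nat \<Rightarrow> complex) \<Rightarrow> complex \<Rightarrow> real \<Rightarrow> real" where
  "semiprime_bias d \<psi> \<eta> x =
     \<bar>real (card (semiprimes_with_values \<psi> \<eta> x)) /
        (1 / 4 * real (card (semiprimes_coprime_to d x))) - 1\<bar>"

text \<open>The maximum runs over pairs of a conductor and a character, since a conductor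
  divisible by 8 can carry two quadratic characters.\<close>

definition max_semiprime_bias :: "complex \<Rightarrow> real \<Rightarrow> real" where
  "max_semiprime_bias \<eta> x =
     Max {semiprime_bias d \<psi> \<eta> x | d \<psi>. quadratic_character d \<psi> \<and> real d \<le> x}"

end

theory Submission
  imports Defs "HOL-Number_Theory.Number_Theory" "HOL-Real_Asymp.Real_Asymp"
begin

text \<open>
  Write \<open>\<chi>\<^sub>0\<close> for the principal character modulo \<open>d\<close>, and let \<open>p, q\<close> run over ordered pairs of primes
  with \<open>pq \<le> x\<close>. Expanding the indicator functions \<open>(\<chi>\<^sub>0 + \<eta>\<chi>)/2\<close> shows that, up to \<open>O(\<surd>x)\<close>, four times the count with
  prescribed values minus the full count is \<open>\<eta> \<Sum> \<chi>(p) \<chi>\<^sub>0(q) + \<Sum> \<chi>(p) \<chi>(q) / 2\<close>.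
  GRH gives a power saving in the sums of \<open>\<chi>\<close> over primes, uniformly for \<open>d \<le> x\<close>, so only \<open>p\<close> up to a power of
  \<open>ln x\<close> matter and the bias is about \<open>(x / ln x) \<Sum> \<chi>(p) / p\<close> over these \<open>p\<close>. By Mertens' theorem this is at most
  \<open>(x / ln x) (ln ln ln x + O(1))\<close>, while the full count is asymptotic to \<open>x ln ln x / ln x\<close>. Equality is attained
  when \<open>\<chi>(p) = 1\<close> for all \<open>p \<le> \<surd>(ln x)\<close>; such a \<open>\<chi>\<close> is a product of two Legendre symbols, found by pigeonhole.

  The power saving comes from Newman's contour argument applied to \<open>\<Sum> \<chi>(p) p\<^sup>-\<^sup>s\<close>, which differs from \<open>log L(s, \<chi>)\<close>
  by a bounded function; \<open>log L\<close> is controlled by the Borel-Caratheodory theorem because \<open>L\<close> has no zeros to the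
  right of \<open>1/2\<close>. GRH as stated says nothing about the line \<open>Re s = 1\<close>, where the classical arguments of
  Mertens and Landau exclude zeros. The same argument for \<open>\<zeta>\<close> gives the prime number theorem and Mertens' theorem.
\<close>

subsection \<open>Continuation of periodic Dirichlet series\<close>

text \<open>The obstacle is uniformity in d, since conductors run up to x itself. It is met in log
  L: a bound for L that is linear in d becomes ln d. Newman's argument yields only the exponent
  15/16, but every fixed power saving lets the sum over p be cut at a power of ln x. A conductor
  with many small prime factors lowers the coprime count by O(x ln ln ln x / ln x), which is a
  factor 1 + o(1), so the denominators are asymptotically equal for all d. For the lower bound it is
  enough to prescribe the character up to sqrt(ln x): ln ln sqrt(ln x) = ln ln ln x - ln 2, and by
  Mertens' theorem the primes from there to (ln x)^32 add only O(1) to the sum of 1/p, whatever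
  their signs. With this threshold there are at most 2^sqrt(ln x) sign patterns, far fewer than
  primes up to sqrt x. Two primes with the same pattern give a product of Legendre symbols that is 1
  at all small primes, and its conductor is at most x because both primes are at most sqrt
  x.\<close>

lemma holomorphic_on_suminf:
  fixes f :: "nat \<Rightarrow> complex \<Rightarrow> complex"
  assumes "open S" "\<And>n. f n holomorphic_on S"
    and maj: "\<And>z. z \<in> S \<Longrightarrow> \<exists>d>0. \<exists>M. cball z d \<subseteq> S \<and> summable M \<and> (\<forall>n. \<forall>w\<in>cball z d. norm (f n w) \<le> M n)"
  shows "(\<lambda>z. \<Sum>n. f n z) holomorphic_on S"
proof (rule holomorphic_uniform_sequence[where f = "\<lambda>N z. \<Sum>n<N. f n z"])
  show "open S" by fact
  show "(\<lambda>z. \<Sum>n<N. f n z) holomorphic_on S" for N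
    by (intro holomorphic_intros assms)
next
  fix z assume "z \<in> S"
  from maj[OF this] obtain d M where "d > 0" "cball z d \<subseteq> S" "summable M"
    "\<forall>n. \<forall>w\<in>cball z d. norm (f n w) \<le> M n" by blast
  thus "\<exists>d>0. cball z d \<subseteq> S \<and> uniform_limit (cball z d) (\<lambda>N z. \<Sum>n<N. f n z) (\<lambda>z. \<Sum>n. f n z) sequentially"
    by (intro exI[of _ d] conjI Weierstrass_m_test[where M = M]) auto
qed

section \<open>Iterated differences of complex powers\<close>

text \<open>Up to the sign \<open>(-1) ^ k\<close> this is the k-th forward difference of
  \<open>z powr (-s)\<close>. Each difference gains one power of z in decay, which is what moves the
  half-plane of convergence one unit to the left.\<close>

primrec powr_diff :: "nat \<Rightarrow> complex \<Rightarrow> complex \<Rightarrow> complex" where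
  "powr_diff 0 s z = z powr (-s)"
| "powr_diff (Suc k) s z = powr_diff k s z - powr_diff k s (z + 1)"

lemma holomorphic_powr_diff:
  "Re z > 0 \<Longrightarrow> (\<lambda>s. powr_diff k s z) holomorphic_on A"
proof (induction k arbitrary: z)
  case 0
  hence "z \<noteq> 0" by auto
  thus ?case by (auto intro!: holomorphic_intros)
next
  case (Suc k)
  thus ?case by (auto intro!: holomorphic_intros)
qed

lemma has_field_derivative_powr_diff:
  "Re z > 0 \<Longrightarrow> (powr_diff k s has_field_derivative (-s * powr_diff k (s+1) z)) (at z)"
proof (induction k arbitrary: z)
  case 0
  have "z \<notin> \<real>\<^sub>\<le>\<^sub>0" using 0 by (auto simp: complex_nonpos_Reals_iff)
  hence "((\<lambda>z. z powr (-s)) has_field_derivative (-s * z powr (-s-1))) (at z)"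
    by (rule has_field_derivative_powr)
  moreover have "-s-1 = -(s+1)" by simp
  ultimately show ?case by (simp only: powr_diff.simps(1)[abs_def])
next
  case (Suc k)
  have "((\<lambda>z. powr_diff k s (z + 1)) has_field_derivative (-s * powr_diff k (s+1) (z+1))) (at z)"
    using DERIV_chain2[where f = "powr_diff k s" and g = "\<lambda>z. z + 1" and Db = 1, OF Suc.IH[of "z+1"]] Suc.prems
    by (simp add: DERIV_ident[THEN DERIV_add[OF _ DERIV_const], simplified])
  hence "((\<lambda>z. powr_diff k s z - powr_diff k s (z + 1)) has_field_derivative (-s * powr_diff k (s+1) z - -s * powr_diff k (s+1) (z+1))) (at z)"
    by (intro DERIV_diff Suc.IH Suc.prems)
  thus ?case by (simp add: algebra_simps)
qed

text \<open>Mean value inequality on the segment from x to x + 1: one order of difference is traded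
  for a factor \<open>norm s\<close> and the shift to s + 1.\<close>

lemma powr_diff_bound_step:
  fixes x B :: real
  assumes "x \<ge> 1" and B: "\<And>\<xi>. \<lbrakk>x \<le> \<xi>; \<xi> \<le> x + 1\<rbrakk> \<Longrightarrow> norm (powr_diff k (s+1) (of_real \<xi>)) \<le> B"
  shows "norm (powr_diff (Suc k) s (of_real x)) \<le> norm s * B"
proof -
  let ?S = "closed_segment (of_real x) (of_real (x + 1) :: complex)"
  have seg: "\<exists>\<xi>. z = of_real \<xi> \<and> x \<le> \<xi> \<and> \<xi> \<le> x + 1" if z: "z \<in> ?S" for z
    using z by (auto simp only: closed_segment_of_real closed_segment_eq_real_ivl split: if_splits) auto
  have "norm (powr_diff k s (of_real x) - powr_diff k s (of_real (x+1))) \<le> (norm s * B) * norm (of_real x - of_real (x + 1) :: complex)"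
  proof (rule field_differentiable_bound[where S = ?S and f' = "\<lambda>z. -s * powr_diff k (s+1) z"])
    fix z assume "z \<in> ?S"
    then obtain \<xi> where \<xi>: "z = of_real \<xi>" "x \<le> \<xi>" "\<xi> \<le> x + 1" using seg by blast
    show "(powr_diff k s has_field_derivative -s * powr_diff k (s+1) z) (at z within ?S)"
      by (rule has_field_derivative_at_within[OF has_field_derivative_powr_diff]) (use \<xi> assms(1) in auto)
    show "norm (-s * powr_diff k (s+1) z) \<le> norm s * B"
      using B[OF \<xi>(2,3)] \<xi>(1) by (simp add: norm_mult mult_left_mono)
  qed auto
  also have "norm (of_real x - of_real (x + 1) :: complex) = 1" by simp
  finally show ?thesis by (simp)
qed

lemma norm_of_real_powr: "x > 0 \<Longrightarrow> norm (of_real x powr s :: complex) = x powr Re s"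
  by (subst norm_powr_real_powr) auto

text \<open>The constant depends on k and on a bound R for \<open>norm s\<close>, but not on s
  itself: holomorphy of the series needs uniformity on discs. R varies in the induction because the
  mean value step replaces s by s + 1.\<close>

lemma powr_diff_bound:
  assumes "R \<ge> 0"
  shows "\<exists>C\<ge>0. \<forall>s x. norm s \<le> R \<longrightarrow> x \<ge> 1 \<longrightarrow> norm (powr_diff k s (of_real x)) \<le> C * x powr (-Re s - real k)"
  using assms
proof (induction k arbitrary: R)
  case 0
  show ?case by (intro exI[of _ 1]) (auto simp: norm_of_real_powr)
next
  case (Suc k)
  from Suc.IH[of "R+1"] Suc.prems obtain C where C: "C \<ge> 0"
    "\<And>s x. norm s \<le> R + 1 \<Longrightarrow> x \<ge> 1 \<Longrightarrow> norm (powr_diff k s (of_real x)) \<le> C * x powr (-Re s - real k)"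
    by auto
  show ?case
  proof (intro exI[of _ "R * (C * 2 powr R)"] conjI allI impI)
    show "0 \<le> R * (C * 2 powr R)" using C Suc.prems by simp
    fix s :: complex and x :: real assume s: "norm s \<le> R" and x: "x \<ge> 1"
    let ?a = "-Re s - 1 - real k"
    have a: "?a \<le> R" using s abs_Re_le_cmod[of s] by linarith
    have "norm (powr_diff (Suc k) s (of_real x)) \<le> norm s * (C * 2 powr R * x powr ?a)"
    proof (rule powr_diff_bound_step[OF x])
      fix \<xi> assume \<xi>: "x \<le> \<xi>" "\<xi> \<le> x + 1"
      have "norm (powr_diff k (s+1) (of_real \<xi>)) \<le> C * \<xi> powr ?a"
      proof -
        have "norm (s + 1) \<le> R + 1" using s norm_triangle_ineq[of s 1] by simp
        moreover have "-Re (s + 1) - real k = ?a" by simp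
        ultimately show ?thesis using C(2)[of "s+1" \<xi>] \<xi> x by (simp only:) 
      qed
      \<comment> \<open>The exponent can have either sign, so \<xi> is compared with x through the
        ratio, which lies in [1, 2]. This is the source of \<open>2 powr R\<close>.\<close>
      also have "\<xi> powr ?a = (\<xi>/x) powr ?a * x powr ?a" using x \<xi> by (simp add: powr_divide)
      also have "(\<xi>/x) powr ?a \<le> (\<xi>/x) powr R" using x \<xi> a by (intro powr_mono) auto
      also have "(\<xi>/x) powr R \<le> 2 powr R" using x \<xi> Suc.prems by (intro powr_mono2) (auto simp: field_simps)
      finally show "norm (powr_diff k (s+1) (of_real \<xi>)) \<le> C * 2 powr R * x powr ?a"
        using C by (simp add: mult_left_mono mult_right_mono algebra_simps)
    qed
    also have "\<dots> \<le> R * (C * 2 powr R * x powr ?a)" using s C by (intro mult_right_mono) auto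
    finally show "norm (powr_diff (Suc k) s (of_real x)) \<le> R * (C * 2 powr R) * x powr (- Re s - real (Suc k))"
      by (simp add: algebra_simps)
  qed
qed

text \<open>An explicit constant, for bounds that must hold on a whole half-plane. For Re s at least
  -1 the exponent is nonpositive, so the supremum over [x, x + 1] is attained at x.\<close>

lemma powr_diff_1_bound:
  assumes "Re s \<ge> -1" "x \<ge> 1"
  shows "norm (powr_diff (Suc 0) s (of_real x)) \<le> norm s * x powr (-Re s - 1)"
proof (rule powr_diff_bound_step[OF assms(2)])
  fix \<xi> assume "x \<le> \<xi>" "\<xi> \<le> x + 1"
  thus "norm (powr_diff 0 (s + 1) (of_real \<xi>)) \<le> x powr (- Re s - 1)"
    using assms by (auto simp: norm_of_real_powr intro!: powr_mono2')
qed

lemma summable_Suc_powr: "a < -1 \<Longrightarrow> summable (\<lambda>n. real (Suc n) powr a)"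
  by (subst summable_Suc_iff) (simp add: summable_real_powr_iff)

lemma tendsto_Suc_powr_0: "a < 0 \<Longrightarrow> (\<lambda>n. real (Suc n) powr a) \<longlonglongrightarrow> 0"
  by (rule tendsto_neg_powr[OF _ filterlim_compose[OF filterlim_real_sequentially filterlim_Suc]])

lemma powr_diff_tendsto_0:
  assumes "Re s + real j > 0"
  shows "(\<lambda>n. powr_diff j s (of_nat (Suc n))) \<longlonglongrightarrow> 0"
proof -
  from powr_diff_bound[of "norm s" j] obtain C where C:
    "\<And>x. x \<ge> 1 \<Longrightarrow> norm (powr_diff j s (of_real x)) \<le> C * x powr (-Re s - real j)" by auto
  show ?thesis
  proof (rule Lim_null_comparison)
    show "\<forall>\<^sub>F n in sequentially. norm (powr_diff j s (of_nat (Suc n))) \<le> C * real (Suc n) powr (-Re s - real j)"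
    proof (rule always_eventually, rule allI)
      fix n show "norm (powr_diff j s (of_nat (Suc n))) \<le> C * real (Suc n) powr (-Re s - real j)"
        using C[of "real (Suc n)"] by simp
    qed
    show "(\<lambda>n. C * real (Suc n) powr (-Re s - real j)) \<longlonglongrightarrow> 0"
      using assms by (intro tendsto_mult_right_zero tendsto_Suc_powr_0) auto
  qed
qed

lemma sum_by_parts:
  fixes b u :: "nat \<Rightarrow> 'a :: comm_ring_1"
  shows "(\<Sum>n<N. b n * u n) = (\<Sum>n<N. (\<Sum>m<Suc n. b m) * (u n - u (Suc n))) + (\<Sum>m<N. b m) * u N"
  by (induction N) (auto simp: algebra_simps)

lemma periodic_sum_shift:
  fixes a :: "nat \<Rightarrow> 'a :: ab_group_add"
  assumes "\<And>n. a (n + q) = a n"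
  shows "(\<Sum>m<n + q. a m) = (\<Sum>m<n. a m) + (\<Sum>m<q. a m)"
  by (induction n) (auto simp: assms)

lemma periodic_mod:
  fixes a :: "nat \<Rightarrow> 'a"
  assumes "\<And>n. a (n + q) = a n"
  shows "a (n mod q) = a n"
proof -
  have "a (r + q * k) = a r" for r k
  proof (induction k)
    case (Suc k)
    have "a (r + q * Suc k) = a ((r + q * k) + q)" by (simp add: algebra_simps)
    thus ?case using Suc assms by simp
  qed auto
  from this[of "n mod q" "n div q"] show ?thesis by simp
qed

lemma periodic_bounded:
  fixes a :: "nat \<Rightarrow> complex"
  assumes "q > 0" "\<And>n. a (n + q) = a n"
  obtains B where "B \<ge> 0" "\<And>n. norm (a n) \<le> B"
proof -
  have "norm (a n) \<le> (\<Sum>m<q. norm (a m))" for n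
  proof -
    have "norm (a (n mod q)) \<le> (\<Sum>m<q. norm (a m))"
      using assms by (intro member_le_sum) auto
    thus ?thesis using periodic_mod[of a q, OF assms(2)] by simp
  qed
  thus ?thesis by (intro that[of "\<Sum>m<q. norm (a m)"]) (auto intro: sum_nonneg)
qed

text \<open>Each summation by parts turns one more difference of \<open>n\<^sup>-\<^sup>s\<close> into a factor \<open>1/n\<close>; the
  partial sums of a periodic sequence of mean zero are again periodic, and subtracting their mean
  only costs a telescoping sum.\<close>

lemma powr_diff_series_by_parts:
  fixes a :: "nat \<Rightarrow> complex"
  assumes per: "\<And>n. a (n + q) = a n" and "q > 0" and zero: "(\<Sum>m<q. a m) = 0"
    and s: "Re s + real j > 0"
    and sums: "(\<lambda>n. (\<Sum>m<Suc n. a m) * powr_diff (Suc j) s (of_nat (Suc n))) sums l"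
  shows "(\<lambda>n. a n * powr_diff j s (of_nat (Suc n))) sums l"
proof -
  let ?u = "\<lambda>n. powr_diff j s (of_nat (Suc n))"
  have diff: "?u n - ?u (Suc n) = powr_diff (Suc j) s (of_nat (Suc n))" for n
    by (simp add: algebra_simps)
  obtain B where B: "B \<ge> 0" "\<And>n. norm (\<Sum>m<n. a m) \<le> B"
    using periodic_bounded[of q "\<lambda>n. \<Sum>m<n. a m"] \<open>q > 0\<close> periodic_sum_shift[of a q, OF per] zero by auto
  have "(\<lambda>N. (\<Sum>m<N. a m) * ?u N) \<longlonglongrightarrow> 0"
  proof (rule Lim_null_comparison)
    show "\<forall>\<^sub>F N in sequentially. norm ((\<Sum>m<N. a m) * ?u N) \<le> B * norm (?u N)"
      using B by (intro always_eventually) (auto simp: norm_mult intro!: mult_right_mono)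
    show "(\<lambda>N. B * norm (?u N)) \<longlonglongrightarrow> 0"
      using powr_diff_tendsto_0[OF s] by (intro tendsto_mult_right_zero tendsto_norm_zero)
  qed
  from tendsto_add[OF sums[unfolded sums_def] this]
  show ?thesis unfolding sums_def sum_by_parts[of a] diff by simp
qed

text \<open>Induction on K, the number of units gained to the left of the half-plane of absolute
  convergence. The sequence and j are arbitrary because the step passes to the partial sums of a - c
  and to differences of order j + 1.\<close>

lemma powr_diff_continuation:
  fixes a :: "nat \<Rightarrow> complex"
  assumes "\<And>n. a (n + q) = a n" "q > 0" "j \<ge> 1"
  shows "\<exists>g. g holomorphic_on {s. Re s > 1 - real j - real K} \<and>
           (\<forall>s. Re s > 1 - real j \<longrightarrow> (\<lambda>n. a n * powr_diff j s (of_nat (Suc n))) sums g s)"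
  using assms
proof (induction K arbitrary: a j)
  case 0
  obtain B where B: "B \<ge> 0" "\<And>n. norm (a n) \<le> B" using periodic_bounded[of q a] 0 by metis
  let ?S = "{s. Re s > 1 - real j}"
  let ?f = "\<lambda>n s. a n * powr_diff j s (of_nat (Suc n))"
  have *: "\<exists>d>0. \<exists>M. cball z d \<subseteq> ?S \<and> summable M \<and> (\<forall>n. \<forall>w\<in>cball z d. norm (?f n w) \<le> M n)"
    if z: "z \<in> ?S" for z
  proof -
    define d where "d = (Re z - (1 - real j)) / 2"
    have "d > 0" using z by (simp add: d_def)
    from powr_diff_bound[of "norm z + d" j] \<open>d > 0\<close> obtain C where C: "C \<ge> 0"
      "\<And>s x. norm s \<le> norm z + d \<Longrightarrow> x \<ge> 1 \<Longrightarrow> norm (powr_diff j s (of_real x)) \<le> C * x powr (-Re s - real j)" by auto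
    define M where "M = (\<lambda>n. B * (C * real (Suc n) powr (-(Re z - d) - real j)))"
    have re: "Re w \<ge> Re z - d" if "w \<in> cball z d" for w
      using that abs_Re_le_cmod[of "z - w"] by (auto simp: dist_norm)
    have "cball z d \<subseteq> ?S" using re \<open>d > 0\<close> by (fastforce simp: d_def field_simps)
    moreover have "summable M" unfolding M_def
      using \<open>d > 0\<close> by (intro summable_mult summable_Suc_powr) (auto simp: d_def field_simps)
    moreover have "norm (?f n w) \<le> M n" if w: "w \<in> cball z d" for n w
    proof -
      have "norm w \<le> norm z + d" using w norm_triangle_ineq[of z "w - z"] by (auto simp: dist_norm norm_minus_commute)
      from C(2)[OF this, of "real (Suc n)"]
      have "norm (powr_diff j w (of_nat (Suc n))) \<le> C * real (Suc n) powr (-Re w - real j)" by simp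
      also have "\<dots> \<le> C * real (Suc n) powr (-(Re z - d) - real j)"
        using re[OF w] C by (intro mult_left_mono powr_mono) auto
      finally show ?thesis unfolding M_def norm_mult using B C by (intro mult_mono) auto
    qed
    ultimately show ?thesis using \<open>d > 0\<close> by blast
  qed
  have hol: "(\<lambda>s. \<Sum>n. ?f n s) holomorphic_on ?S"
    by (rule holomorphic_on_suminf[OF _ _ *])
       (auto intro!: open_halfspace_Re_gt holomorphic_intros holomorphic_powr_diff)
  have "(\<lambda>n. ?f n s) sums (\<Sum>n. ?f n s)" if "Re s > 1 - real j" for s
  proof -
    from that have "s \<in> ?S" by simp
    from *[OF this] obtain d M where dM: "d > 0" "summable M"
      "\<forall>n. \<forall>w\<in>cball s d. norm (?f n w) \<le> M n" by blast
    have "s \<in> cball s d" using dM(1) by simp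
    hence "norm (?f n s) \<le> M n" for n using dM(3) by blast
    thus ?thesis by (intro summable_sums[OF summable_comparison_test'[OF dM(2), of 0]])
  qed
  with hol show ?case by (intro exI[of _ "\<lambda>s. \<Sum>n. ?f n s"] conjI) simp_all
next
  case (Suc K)
  define c where "c = (\<Sum>m<q. a m) / of_nat q"
  define b where "b = (\<lambda>n. a n - c)"
  have bper: "b (n + q) = b n" for n using Suc.prems by (simp add: b_def)
  have bzero: "(\<Sum>m<q. b m) = 0" using Suc.prems by (simp add: b_def c_def sum_subtractf)
  define A where "A = (\<lambda>n. \<Sum>m<Suc n. b m)"
  have Aper: "A (n + q) = A n" for n
    using periodic_sum_shift[of b q "Suc n", OF bper] bzero by (simp add: A_def)
  from Suc.IH[of A "Suc j", OF Aper] Suc.prems obtain g where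
    g: "g holomorphic_on {s. Re s > 1 - real (Suc j) - real K}"
    "\<And>s. Re s > 1 - real (Suc j) \<Longrightarrow> (\<lambda>n. A n * powr_diff (Suc j) s (of_nat (Suc n))) sums g s" by auto
  \<comment> \<open>As j is at least 1, the mean c multiplies a telescoping series of differences of
    order j - 1; its sum is the first of these, which is entire in s.\<close>
  obtain j' where j': "j = Suc j'" using Suc.prems by (cases j) auto
  show ?case
  proof (intro exI[of _ "\<lambda>s. c * powr_diff j' s 1 + g s"] conjI allI impI)
    show "(\<lambda>s. c * powr_diff j' s 1 + g s) holomorphic_on {s. 1 - real j - real (Suc K) < Re s}"
      using g(1) by (intro holomorphic_intros holomorphic_powr_diff) (auto simp: algebra_simps)
    fix s assume s: "1 - real j < Re s"
    have 1: "(\<lambda>n. b n * powr_diff j s (of_nat (Suc n))) sums g s"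
    proof (rule powr_diff_series_by_parts[where q = q])
      show "(\<lambda>n. (\<Sum>m<Suc n. b m) * powr_diff (Suc j) s (of_nat (Suc n))) sums g s"
        using g(2)[of s] s unfolding A_def by simp
    qed (use s Suc.prems bper bzero in auto)
    have "(\<lambda>N. powr_diff j' s (of_nat (Suc N))) \<longlonglongrightarrow> 0"
      using s j' by (intro powr_diff_tendsto_0) auto
    from telescope_sums'[OF this]
    have "(\<lambda>n. powr_diff j s (of_nat (Suc n))) sums powr_diff j' s 1"
      by (simp add: j' algebra_simps)
    from sums_add[OF sums_mult[OF this, of c] 1]
    show "(\<lambda>n. a n * powr_diff j s (of_nat (Suc n))) sums (c * powr_diff j' s 1 + g s)"
      by (simp add: b_def algebra_simps)
  qed
qed

text \<open>The zero mean permits the first summation by parts already at j = 0, where no lower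
  difference is available for telescoping. After it there is a continuation to Re s > -K for every
  K, and these are glued by the identity theorem.\<close>

lemma zero_mean_series_entire:
  fixes a :: "nat \<Rightarrow> complex"
  assumes per: "\<And>n. a (n + q) = a n" and q: "q > 0" and zero: "(\<Sum>m<q. a m) = 0"
  shows "\<exists>g. g holomorphic_on UNIV \<and> (\<forall>s. Re s > 0 \<longrightarrow> (\<lambda>n. a n * of_nat (Suc n) powr (-s)) sums g s)"
proof -
  have Aper: "(\<Sum>m<Suc (n+q). a m) = (\<Sum>m<Suc n. a m)" for n
    using periodic_sum_shift[of a q "Suc n", OF per] zero by simp
  have "\<exists>g. g holomorphic_on {s. Re s > - real K} \<and>
           (\<forall>s. Re s > 0 \<longrightarrow> (\<lambda>n. a n * of_nat (Suc n) powr (-s)) sums g s)" for K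
    using powr_diff_continuation[of "\<lambda>n. \<Sum>m<Suc n. a m" q 1 K, OF Aper q]
      powr_diff_series_by_parts[of a q _ 0, OF per q zero] by fastforce
  hence "\<exists>G. \<forall>K. G K holomorphic_on {s. Re s > - real K} \<and>
           (\<forall>s. Re s > 0 \<longrightarrow> (\<lambda>n. a n * of_nat (Suc n) powr (-s)) sums G K s)" by (intro choice allI)
  then obtain G where G: "\<And>K. G K holomorphic_on {s. Re s > - real K}"
     "\<And>K s. Re s > 0 \<Longrightarrow> (\<lambda>n. a n * of_nat (Suc n) powr (-s)) sums G K s" by blast
  have eq: "G K s = G K' s" if "K \<le> K'" "Re s > - real K" for K K' s
  proof (rule analytic_continuation_open[of "{s. Re s > 0}" "{s. Re s > - real K}" "G K" "G K'"])
    show "{s. Re s > 0} \<noteq> {}" by (auto intro!: exI[of _ 1])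
    show "connected {s. Re s > - real K}" by (intro convex_connected convex_halfspace_Re_gt)
    show "G K' holomorphic_on {s. - real K < Re s}"
      by (rule holomorphic_on_subset[OF G(1)]) (use that in auto)
    show "G K z = G K' z" if "z \<in> {s. 0 < Re s}" for z
      using G(2)[of z K] G(2)[of z K'] that sums_unique2 by blast
  qed (use that G in \<open>auto intro: open_halfspace_Re_gt\<close>)
  \<comment> \<open>An index whose half-plane certainly contains s; \<open>gG\<close> shows that the
    value does not depend on the choice.\<close>
  define g where "g = (\<lambda>s. G (nat \<lceil>\<bar>Re s\<bar>\<rceil> + 1) s)"
  have gG: "g s = G K s" if "Re s > - real K" for s K
  proof -
    have *: "- real (nat \<lceil>\<bar>Re s\<bar>\<rceil> + 1) < Re s" by linarith
    show ?thesis
    proof (cases "K \<le> nat \<lceil>\<bar>Re s\<bar>\<rceil> + 1")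
      case True thus ?thesis unfolding g_def by (intro eq[OF True that, symmetric])
    next
      case False thus ?thesis unfolding g_def by (intro eq[OF _ *]) auto
    qed
  qed
  have "g holomorphic_on UNIV"
  proof (rule holomorphic_on_UN_open[where I = UNIV and A = "\<lambda>K::nat. {s. Re s > - real K}", THEN holomorphic_on_subset])
    show "g holomorphic_on {s. Re s > - real K}" for K
      using G(1)[of K] by (rule holomorphic_transform) (use gG in auto)
    show "open {s. Re s > - real K}" for K by (rule open_halfspace_Re_gt)
    show "UNIV \<subseteq> (\<Union>K::nat. {s. Re s > - real K})"
    proof
      fix s :: complex
      have "- real (nat \<lceil>\<bar>Re s\<bar>\<rceil> + 1) < Re s" by linarith
      thus "s \<in> (\<Union>K::nat. {s. Re s > - real K})" by blast
    qed
  qed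
  moreover have "(\<lambda>n. a n * of_nat (Suc n) powr (-s)) sums g s" if "Re s > 0" for s
    using G(2)[OF that, of 0] gG[of 0 s] that by simp
  ultimately show ?thesis by blast
qed

text \<open>This is \<zeta>(3/2). After one summation by parts the terms for Re s \<ge> 1/2 are
  dominated by \<open>n powr (-3/2)\<close>, so it serves as the absolute constant of the later
  bounds.\<close>

definition zeta32 :: real where "zeta32 = (\<Sum>n. real (Suc n) powr (-3/2))"

text \<open>The partial sums of the coefficients have period q and norm at most q, and the first
  difference of \<open>n powr (-s)\<close> costs a factor \<open>norm s\<close>. Linear growth in q
  and s is harmless because it enters later through its logarithm.\<close>

lemma zero_mean_series_bound:
  fixes a :: "nat \<Rightarrow> complex"
  assumes per: "\<And>n. a (n + q) = a n" and q: "q > 0" and zero: "(\<Sum>m<q. a m) = 0"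
    and bd: "\<And>n. norm (a n) \<le> 1" and s: "Re s \<ge> 1/2"
    and sums: "(\<lambda>n. a n * of_nat (Suc n) powr (-s)) sums l"
  shows "norm l \<le> zeta32 * real q * norm s"
proof -
  have P: "norm (\<Sum>m<n. a m) \<le> real q" for n
  proof -
    have "(\<Sum>m<n. a m) = (\<Sum>m<n mod q. a m)"
      using periodic_mod[of "\<lambda>n. \<Sum>m<n. a m" q n] periodic_sum_shift[of a q, OF per] zero by simp
    also have "norm \<dots> \<le> real (card {..<n mod q}) * 1"
      using bd by (intro sum_norm_bound[THEN order_trans, of _ _ 1]) auto
    also have "\<dots> \<le> real q" using q by (simp add: less_imp_le)
    finally show ?thesis .
  qed
  let ?f = "\<lambda>n. (\<Sum>m<Suc n. a m) * powr_diff (Suc 0) s (of_nat (Suc n))"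
  have bound: "norm (?f n) \<le> real q * norm s * real (Suc n) powr (-3/2)" for n
  proof -
    have "norm (powr_diff (Suc 0) s (of_nat (Suc n))) \<le> norm s * real (Suc n) powr (-Re s - 1)"
      using powr_diff_1_bound[of s "real (Suc n)"] s by simp
    also have "\<dots> \<le> norm s * real (Suc n) powr (-3/2)"
      using s by (intro mult_left_mono powr_mono) auto
    finally have *: "norm (powr_diff (Suc 0) s (of_nat (Suc n))) \<le> norm s * real (Suc n) powr (-3/2)" .
    have "norm (?f n) \<le> real q * (norm s * real (Suc n) powr (-3/2))"
      unfolding norm_mult by (rule mult_mono[OF P *]) auto
    thus ?thesis by (simp add: mult_ac)
  qed
  have summ: "summable (\<lambda>n. real q * norm s * real (Suc n) powr (-3/2))"
    by (intro summable_mult summable_Suc_powr) auto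
  have "summable ?f" by (rule summable_comparison_test'[OF summ, of 0]) (use bound in auto)
  then obtain l' where l': "?f sums l'" by (auto simp: summable_def)
  hence "(\<lambda>n. a n * powr_diff 0 s (of_nat (Suc n))) sums l'"
    using s by (intro powr_diff_series_by_parts[OF per q zero]) auto
  hence "l' = l" using sums by (simp add: sums_unique2)
  have "norm l \<le> (\<Sum>n. real q * norm s * real (Suc n) powr (-3/2))"
    using norm_suminf_le[of ?f, OF bound summ] l' \<open>l' = l\<close> by (simp add: sums_iff)
  also have "\<dots> = real q * norm s * zeta32"
    unfolding zeta32_def by (intro suminf_mult summable_Suc_powr) auto
  finally show ?thesis by (simp add: mult_ac)
qed

subsection \<open>Dirichlet characters and their L-functions\<close>

lemma dirichlet_character_mod:
  assumes "dirichlet_character q \<psi>" shows "\<psi> (n mod q) = \<psi> n"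
  using periodic_mod[of \<psi> q n] assms by (auto simp: dirichlet_character_def)

lemma dirichlet_character_power:
  assumes "dirichlet_character q \<psi>" shows "\<psi> (n ^ k) = \<psi> n ^ k"
  using assms by (induction k) (auto simp: dirichlet_character_def)

lemma dirichlet_character_root_of_unity:
  assumes "dirichlet_character q \<psi>" "coprime n q"
  shows "\<psi> n ^ totient q = 1"
proof -
  have "[n ^ totient q = 1] (mod q)" by (rule euler_theorem) (use assms in auto)
  hence "\<psi> (n ^ totient q) = \<psi> 1"
    using dirichlet_character_mod[OF assms(1)] by (metis cong_def)
  thus ?thesis using dirichlet_character_power[OF assms(1)] assms(1) by (simp add: dirichlet_character_def)
qed

lemma dirichlet_character_norm:
  assumes "dirichlet_character q \<psi>" "coprime n q" shows "norm (\<psi> n) = 1"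
proof -
  have "q > 0" using assms by (simp add: dirichlet_character_def)
  have "norm (\<psi> n) ^ totient q = 1"
    using arg_cong[OF dirichlet_character_root_of_unity[OF assms], of norm] by (simp add: norm_power)
  moreover have "totient q > 0" using \<open>q > 0\<close> by simp
  ultimately show ?thesis using power_eq_imp_eq_base[of "norm (\<psi> n)" "totient q" 1] by simp
qed

lemma dirichlet_character_norm_le:
  assumes "dirichlet_character q \<psi>" shows "norm (\<psi> n) \<le> 1"
proof (cases "coprime n q")
  case True thus ?thesis using dirichlet_character_norm[OF assms] by simp
next
  case False
  hence "\<psi> n = 0" using assms unfolding dirichlet_character_def by blast
  thus ?thesis by simp
qed

lemma quadratic_character_values:
  assumes "quadratic_character d \<psi>"
  shows "\<psi> n = (if coprime n d then if \<psi> n = 1 then 1 else -1 else 0)"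
proof -
  have dc: "dirichlet_character d \<psi>" and "\<psi> n \<in> \<real>"
    using assms by (auto simp: quadratic_character_def primitive_character_def)
  then obtain r where r: "\<psi> n = of_real r" by (auto elim: Reals_cases)
  show ?thesis
  proof (cases "coprime n d")
    case True
    hence "\<bar>r\<bar> = 1" using dirichlet_character_norm[OF dc True] r by simp
    hence "r = 1 \<or> r = -1" by linarith
    thus ?thesis using r True by auto
  qed (use dc in \<open>auto simp: dirichlet_character_def\<close>)
qed

text \<open>Multiplication by a unit a with \<open>\<psi> a \<noteq> 1\<close> permutes the residues
  and multiplies the sum by \<open>\<psi> a\<close>. The sum runs over 1 to q to match series that
  start at n = 1.\<close>

lemma nonprincipal_sum_zero:
  assumes dc: "dirichlet_character q \<psi>" and np: "\<psi> \<noteq> principal_character q"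
  shows "(\<Sum>m<q. \<psi> (Suc m)) = 0"
proof -
  have q: "q > 0" using dc by (simp add: dirichlet_character_def)
  from np obtain a where "\<psi> a \<noteq> principal_character q a" by auto
  hence a: "coprime a q" "\<psi> a \<noteq> 1" using dc
    by (auto simp: principal_character_def dirichlet_character_def split: if_splits)
  define T where "T = (\<Sum>m<q. \<psi> m)"
  have inj: "inj_on (\<lambda>m. (a * m) mod q) {..<q}"
  proof (rule inj_onI)
    fix x y assume xy: "x \<in> {..<q}" "y \<in> {..<q}" "a * x mod q = a * y mod q"
    hence "[a * x = a * y] (mod q)" by (simp add: cong_def)
    hence "[x = y] (mod q)" using a(1) by (simp add: cong_mult_lcancel_nat)
    thus "x = y" using xy by (simp add: cong_def)
  qed
  have "bij_betw (\<lambda>m. (a * m) mod q) {..<q} {..<q}"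
    using inj q by (intro bij_betw_imageI endo_inj_surj) auto
  hence "T = (\<Sum>m<q. \<psi> ((a * m) mod q))" unfolding T_def
    by (rule sum.reindex_bij_betw[symmetric])
  also have "\<dots> = \<psi> a * T" unfolding T_def sum_distrib_left
    using dc by (intro sum.cong) (auto simp: dirichlet_character_mod[OF dc] dirichlet_character_def)
  finally have "(1 - \<psi> a) * T = 0" by (simp add: algebra_simps)
  hence "T = 0" using a(2) by simp
  moreover have "(\<Sum>m<q. \<psi> (Suc m)) + \<psi> 0 = T + \<psi> q"
    unfolding T_def by (metis sum.lessThan_Suc sum.lessThan_Suc_shift add.commute)
  moreover have "\<psi> q = \<psi> 0" using dc by (metis dirichlet_character_def add_0)
  ultimately show ?thesis by simp
qed

text \<open>Evaluates the definite description behind \<open>dirichlet_L\<close>. Any meromorphic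
  continuation g may be used, whatever its values at singularities, because
  \<open>remove_sings\<close> produces the normalised representative. Uniqueness is the identity
  theorem for the difference of two candidates.\<close>

lemma dirichlet_L_eqI:
  assumes mero: "g meromorphic_on UNIV" and hol: "g holomorphic_on {s. Re s > 1}"
    and sums: "\<And>s. Re s > 1 \<Longrightarrow> (\<lambda>n. \<psi> (Suc n) * of_nat (Suc n) powr (-s)) sums g s"
  shows "dirichlet_L \<psi> = remove_sings g"
  unfolding dirichlet_L_def
proof (rule the_equality)
  have an: "g analytic_on {s}" if "Re s > 1" for s
    by (rule analytic_on_subset[of _ "{s. Re s > 1}"]) (use hol that in \<open>auto simp: analytic_on_open open_halfspace_Re_gt\<close>)
  have term_eq: "\<psi> (Suc n) / of_nat (Suc n) powr s = \<psi> (Suc n) * of_nat (Suc n) powr (-s)" for n s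
    by (simp add: powr_minus field_simps)
  have rs: "remove_sings g s = g s" if "Re s > 1" for s
    by (rule remove_sings_at_analytic[OF an[OF that]])
  show P: "remove_sings g nicely_meromorphic_on UNIV \<and>
    (\<forall>s. Re s > 1 \<longrightarrow> (\<lambda>n. \<psi> (Suc n) / of_nat (Suc n) powr s) sums remove_sings g s)"
    using remove_sings_nicely_meromorphic[OF mero] sums rs unfolding term_eq by simp
  fix L assume L: "L nicely_meromorphic_on UNIV \<and>
    (\<forall>s. Re s > 1 \<longrightarrow> (\<lambda>n. \<psi> (Suc n) / of_nat (Suc n) powr s) sums L s)"
  define D where "D = (\<lambda>s. L s - remove_sings g s)"
  have eq: "L s = remove_sings g s" if "Re s > 1" for s
    using L P that sums_unique2 by blast
  have D: "remove_sings D nicely_meromorphic_on UNIV" unfolding D_def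
    using L P mero by (intro remove_sings_nicely_meromorphic meromorphic_intros) (auto simp: nicely_meromorphic_on_def)
  have D0: "remove_sings D s = 0" if "Re s > 1" for s
  proof -
    have "eventually (\<lambda>w. w \<in> {w. Re w > 1}) (at s)"
      using that by (intro eventually_at_in_open' open_halfspace_Re_gt) auto
    hence "eventually (\<lambda>w. D w = 0) (at s)" by eventually_elim (auto simp: D_def eq)
    thus ?thesis by (intro remove_sings_eqI tendsto_eventually)
  qed
  have "eventually (\<lambda>w. w \<in> {w. Re w > 1}) (at 2)"
    by (intro eventually_at_in_open' open_halfspace_Re_gt) auto
  hence "eventually (\<lambda>w. remove_sings D w = 0) (at 2)" by eventually_elim (use D0 in auto)
  hence fr: "frequently (\<lambda>w. remove_sings D w = 0) (at 2)"
    by (intro eventually_frequently) auto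
  have D0': "remove_sings D s = 0" for s
    by (rule frequently_eq_meromorphic_imp_constant[OF fr D]) auto
  have ev: "eventually (\<lambda>w. L w = remove_sings g w) (at s)" for s
  proof -
    have "D meromorphic_on UNIV" unfolding D_def using L P mero
      by (intro meromorphic_intros) (auto simp: nicely_meromorphic_on_def)
    hence "D meromorphic_on {s}" by (rule meromorphic_on_subset) auto
    hence "eventually (\<lambda>w. D analytic_on {w}) (at s)"
      by (auto dest!: meromorphic_on_isolated_singularity simp: isolated_singularity_at_altdef eventually_at_filter intro: eventually_mono) 
    thus ?thesis
    proof eventually_elim
      case (elim w)
      thus ?case using D0'[of w] remove_sings_at_analytic[OF elim] by (simp add: D_def)
    qed
  qed
  \<comment> \<open>Agreement on punctured neighbourhoods determines whether s is a pole and
    otherwise the limit; nice meromorphy then fixes the value as 0 or as this limit.\<close>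
  show "L = remove_sings g"
  proof
    fix s
    have "(is_pole L s \<and> L s = 0) \<or> L \<midarrow>s\<rightarrow> L s"
      "(is_pole (remove_sings g) s \<and> remove_sings g s = 0) \<or> remove_sings g \<midarrow>s\<rightarrow> remove_sings g s"
      using L P unfolding nicely_meromorphic_on_def by auto
    moreover have "is_pole L s \<longleftrightarrow> is_pole (remove_sings g) s" by (intro is_pole_cong ev refl)
    moreover have "L \<midarrow>s\<rightarrow> c \<longleftrightarrow> remove_sings g \<midarrow>s\<rightarrow> c" for c by (intro tendsto_cong ev)
    ultimately show "L s = remove_sings g s"
      by (metis LIM_unique is_pole_def not_tendsto_and_filterlim_at_infinity at_neq_bot)
  qed
qed

lemma nonprincipal_L:
  assumes dc: "dirichlet_character q \<psi>" and np: "\<psi> \<noteq> principal_character q"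
  shows "dirichlet_L \<psi> holomorphic_on UNIV"
    and "\<And>s. Re s > 0 \<Longrightarrow> (\<lambda>n. \<psi> (Suc n) * of_nat (Suc n) powr (-s)) sums dirichlet_L \<psi> s"
    and "\<And>s. Re s \<ge> 1/2 \<Longrightarrow> norm (dirichlet_L \<psi> s) \<le> zeta32 * real q * norm s"
proof -
  have q: "q > 0" and per: "\<And>n. \<psi> (Suc (n + q)) = \<psi> (Suc n)"
    using dc by (auto simp: dirichlet_character_def simp del: add_Suc simp flip: add_Suc)
  have zero: "(\<Sum>m<q. \<psi> (Suc m)) = 0" by (rule nonprincipal_sum_zero[OF assms])
  from zero_mean_series_entire[of "\<lambda>n. \<psi> (Suc n)", OF per q zero] obtain g where
    g: "g holomorphic_on UNIV" "\<And>s. Re s > 0 \<Longrightarrow> (\<lambda>n. \<psi> (Suc n) * of_nat (Suc n) powr (-s)) sums g s" by blast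
  have an: "g analytic_on UNIV" using g(1) by (simp add: analytic_on_open)
  have "dirichlet_L \<psi> = remove_sings g"
    using g by (intro dirichlet_L_eqI analytic_on_imp_meromorphic_on an) (auto intro: holomorphic_on_subset)
  also have "\<dots> = g"
    using an by (intro ext remove_sings_at_analytic) (auto intro: analytic_on_subset)
  finally have eq: "dirichlet_L \<psi> = g" .
  show "dirichlet_L \<psi> holomorphic_on UNIV"
    and sums: "\<And>s. Re s > 0 \<Longrightarrow> (\<lambda>n. \<psi> (Suc n) * of_nat (Suc n) powr (-s)) sums dirichlet_L \<psi> s"
    using g unfolding eq by auto
  show "norm (dirichlet_L \<psi> s) \<le> zeta32 * real q * norm s" if "Re s \<ge> 1/2" for s
    using zero_mean_series_bound[of "\<lambda>n. \<psi> (Suc n)", OF per q zero dirichlet_character_norm_le[OF dc] that sums] that by simp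
qed

definition zeta_term :: "nat \<Rightarrow> complex \<Rightarrow> complex" where
  "zeta_term n s = (s - 1) * powr_diff 0 s (of_nat (Suc n)) - powr_diff (Suc 0) (s - 1) (of_nat (Suc n))"

text \<open>This is \<open>(s - 1) \<zeta>(s)\<close>: the \<open>n\<close>-th term is \<open>s - 1\<close> times the difference between
  \<open>(n + 1)\<^sup>-\<^sup>s\<close> and the integral of \<open>u\<^sup>-\<^sup>s\<close> over \<open>[n + 1, n + 2]\<close>.\<close>

definition zeta_reg :: "complex \<Rightarrow> complex" where
  "zeta_reg s = 1 + (\<Sum>n. zeta_term n s)"

lemma zeta_term_bound:
  assumes "Re s > -1"
  shows "norm (zeta_term n s) \<le> norm (s - 1) * norm s * real (Suc n) powr (-Re s - 1)"
proof -
  define x where "x = real (Suc n)"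
  have x: "x \<ge> 1" by (simp add: x_def)
  define P where "P = x powr (-Re s - 1)"
  have seg: "\<exists>\<xi>. z = of_real \<xi> \<and> x \<le> \<xi> \<and> \<xi> \<le> y" if z: "z \<in> closed_segment (of_real x) (of_real y)" "x \<le> y" for z :: complex and y
    using that by (auto simp only: closed_segment_of_real closed_segment_eq_real_ivl split: if_splits) auto
  have der: "norm (of_real \<xi> powr (-s) - of_real x powr (-s)) \<le> norm s * P" if \<xi>: "x \<le> \<xi>" "\<xi> \<le> x + 1" for \<xi>
  proof -
    have "norm (of_real \<xi> powr (-s) - of_real x powr (-s)) \<le> (norm s * P) * norm (of_real \<xi> - of_real x :: complex)"
    proof (rule field_differentiable_bound[where S = "closed_segment (of_real x) (of_real \<xi>)" and f' = "\<lambda>z. -s * z powr (-s-1)"])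
      fix z :: complex assume "z \<in> closed_segment (of_real x) (of_real \<xi>)"
      then obtain t where t: "z = of_real t" "x \<le> t" "t \<le> \<xi>" using seg \<xi> by blast
      show "((\<lambda>z. z powr (-s)) has_field_derivative -s * z powr (-s-1)) (at z within closed_segment (of_real x) (of_real \<xi>))"
        by (rule has_field_derivative_at_within[OF has_field_derivative_powr]) (use t x in \<open>auto simp: complex_nonpos_Reals_iff\<close>)
      have "norm (z powr (-s-1)) = t powr (-Re s - 1)" using t x by (simp add: norm_of_real_powr)
      also have "\<dots> \<le> P" unfolding P_def using t x assms by (intro powr_mono2') auto
      finally show "norm (-s * z powr (-s-1)) \<le> norm s * P" by (simp add: norm_mult mult_left_mono)
    qed auto
    also have "norm (of_real \<xi> - of_real x :: complex) = \<xi> - x"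
      using \<xi> by (metis abs_of_nonneg diff_ge_0_iff_ge norm_of_real of_real_diff)
    also have "(norm s * P) * (\<xi> - x) \<le> (norm s * P) * 1"
      using \<xi> by (intro mult_left_mono) (auto simp: P_def)
    finally show ?thesis by simp
  qed
  \<comment> \<open>Its increment over [x, x + 1] is the term itself, and its derivative is
    \<open>(s-1) * (of_real x powr (-s) - z powr (-s))\<close>, already small by \<open>der\<close>.
    So the mean value inequality is applied twice.\<close>
  let ?\<phi> = "\<lambda>z. (s - 1) * of_real x powr (-s) * z + z powr (1 - s)"
  have "norm (?\<phi> (of_real (x+1)) - ?\<phi> (of_real x)) \<le> (norm (s-1) * (norm s * P)) * norm (of_real (x+1) - of_real x :: complex)"
  proof (rule field_differentiable_bound[where S = "closed_segment (of_real x) (of_real (x+1))" and f' = "\<lambda>z. (s-1) * (of_real x powr (-s) - z powr (-s))"])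
    fix z :: complex assume "z \<in> closed_segment (of_real x) (of_real (x+1))"
    then obtain t where t: "z = of_real t" "x \<le> t" "t \<le> x + 1" using seg[of z "x+1"] by auto
    have "((\<lambda>z. z powr (1-s)) has_field_derivative (1-s) * z powr ((1-s)-1)) (at z)"
    proof (rule has_field_derivative_powr)
      show "z \<notin> \<real>\<^sub>\<le>\<^sub>0" using t x by (auto simp: complex_nonpos_Reals_iff)
    qed
    hence "(?\<phi> has_field_derivative (s - 1) * of_real x powr (-s) + (1-s) * z powr ((1-s)-1)) (at z)"
      by (intro DERIV_add DERIV_cmult_Id)
    also have "(s - 1) * of_real x powr (-s) + (1-s) * z powr ((1-s)-1) = (s-1) * (of_real x powr (-s) - z powr (-s))"
      by (simp add: algebra_simps)
    finally show "(?\<phi> has_field_derivative (s-1) * (of_real x powr (-s) - z powr (-s))) (at z within closed_segment (of_real x) (of_real (x+1)))"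
      by (rule has_field_derivative_at_within)
    show "norm ((s-1) * (of_real x powr (-s) - z powr (-s))) \<le> norm (s-1) * (norm s * P)"
      using der[OF t(2,3)] t(1) by (simp add: norm_mult mult_left_mono norm_minus_commute)
  qed auto
  also have "norm (of_real (x+1) - of_real x :: complex) = 1" by simp
  also have "?\<phi> (of_real (x+1)) - ?\<phi> (of_real x) = zeta_term n s"
    by (simp add: zeta_term_def x_def algebra_simps)
  finally show ?thesis by (simp add: P_def x_def)
qed

lemma holomorphic_zeta_reg: "zeta_reg holomorphic_on {s. Re s > 0}"
  unfolding zeta_reg_def
proof (intro holomorphic_intros holomorphic_on_suminf)
  show "open {s. Re s > 0}" by (rule open_halfspace_Re_gt)
  show "zeta_term n holomorphic_on {s. Re s > 0}" for n
  proof -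
    have "(\<lambda>s. powr_diff (Suc 0) (s-1) (of_nat (Suc n))) holomorphic_on {s. Re s > 0}"
      using holomorphic_on_compose[of "\<lambda>s. s - 1" "{s. Re s > 0}" "\<lambda>s. powr_diff (Suc 0) s (of_nat (Suc n))"]
        holomorphic_powr_diff[of "of_nat (Suc n)" "Suc 0"]
        holomorphic_on_diff[OF holomorphic_on_ident holomorphic_on_const[of 1]]
      by (simp del: powr_diff.simps add: o_def)
    thus ?thesis unfolding zeta_term_def[abs_def]
      by (intro holomorphic_intros holomorphic_powr_diff) auto
  qed
  fix z :: complex assume "z \<in> {s. Re s > 0}"
  hence z: "Re z > 0" by simp
  define d where "d = Re z / 2"
  define M where "M = (\<lambda>n. (norm z + d + 1) * (norm z + d) * real (Suc n) powr (-d - 1))"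
  have "d > 0" using z by (simp add: d_def)
  have re: "Re w \<ge> d" if "w \<in> cball z d" for w
    using that abs_Re_le_cmod[of "z - w"] by (auto simp: dist_norm d_def field_simps abs_if split: if_splits)
  have "cball z d \<subseteq> {s. Re s > 0}" using re \<open>d > 0\<close> by fastforce
  moreover have "summable M" unfolding M_def using \<open>d > 0\<close> by (intro summable_mult summable_Suc_powr) auto
  moreover have "norm (zeta_term n w) \<le> M n" if w: "w \<in> cball z d" for n w
  proof -
    have nw: "norm w \<le> norm z + d" using w norm_triangle_ineq[of z "w - z"] by (auto simp: dist_norm norm_minus_commute)
    have "norm (zeta_term n w) \<le> norm (w - 1) * norm w * real (Suc n) powr (-Re w - 1)"
      using re[OF w] \<open>d > 0\<close> by (intro zeta_term_bound) auto
    also have "\<dots> \<le> M n" unfolding M_def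
      using re[OF w] \<open>d > 0\<close> nw norm_triangle_ineq4[of w 1] by (intro mult_mono powr_mono) auto
    finally show ?thesis .
  qed
  ultimately show "\<exists>d>0. \<exists>M. cball z d \<subseteq> {s. Re s > 0} \<and> summable M \<and> (\<forall>n. \<forall>w\<in>cball z d. norm (zeta_term n w) \<le> M n)"
    using \<open>d > 0\<close> by blast
qed

lemma zeta_reg_1: "zeta_reg 1 = 1"
proof -
  have "zeta_term n 1 = 0" for n
  proof -
    have "of_nat (Suc n) \<noteq> (0::complex)" "of_nat (Suc n) + 1 \<noteq> (0::complex)"
      using of_nat_neq_0[of n, where 'a = complex] of_nat_neq_0[of "Suc n", where 'a = complex]
      by (simp_all add: algebra_simps)
    thus ?thesis by (simp add: zeta_term_def del: of_nat_Suc)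
  qed
  thus ?thesis by (simp add: zeta_reg_def)
qed

lemma zeta_reg_bound:
  assumes "Re s \<ge> 1/2"
  shows "norm (zeta_reg s - 1) \<le> zeta32 * norm (s - 1) * norm s"
proof -
  have bd: "norm (zeta_term n s) \<le> norm (s - 1) * norm s * real (Suc n) powr (-3/2)" for n
  proof -
    have "norm (zeta_term n s) \<le> norm (s - 1) * norm s * real (Suc n) powr (-Re s - 1)"
      using assms by (intro zeta_term_bound) auto
    also have "\<dots> \<le> norm (s - 1) * norm s * real (Suc n) powr (-3/2)"
      using assms by (intro mult_left_mono powr_mono) auto
    finally show ?thesis .
  qed
  have "norm (zeta_reg s - 1) \<le> (\<Sum>n. norm (s - 1) * norm s * real (Suc n) powr (-3/2))"
    unfolding zeta_reg_def add_diff_cancel_left'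
    by (rule norm_suminf_le[OF bd]) (intro summable_mult summable_Suc_powr, simp)
  also have "\<dots> = norm (s - 1) * norm s * zeta32"
    unfolding zeta32_def by (intro suminf_mult summable_Suc_powr) auto
  finally show ?thesis by (simp add: mult_ac)
qed

lemma zeta_series:
  assumes "Re s > 1"
  shows "(\<lambda>n. of_nat (Suc n) powr (-s)) sums (zeta_reg s / (s - 1))"
proof -
  have s1: "s \<noteq> 1" using assms by auto
  have "summable (\<lambda>n. norm (s - 1) * norm s * real (Suc n) powr (-Re s - 1))"
    using assms by (intro summable_mult summable_Suc_powr) auto
  hence "summable (\<lambda>n. zeta_term n s)"
    by (rule summable_comparison_test'[of _ 0]) (use assms zeta_term_bound[of s] in \<open>simp del: of_nat_Suc\<close>)
  hence 1: "(\<lambda>n. zeta_term n s) sums (zeta_reg s - 1)" by (simp add: zeta_reg_def summable_sums)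
  have "(\<lambda>N. powr_diff 0 (s-1) (of_nat (Suc N))) \<longlonglongrightarrow> 0"
    using assms by (intro powr_diff_tendsto_0) auto
  from telescope_sums'[OF this]
  have 2: "(\<lambda>n. powr_diff (Suc 0) (s-1) (of_nat (Suc n))) sums 1" by (simp add: algebra_simps)
  have "(\<lambda>n. (s - 1) * of_nat (Suc n) powr (-s)) sums zeta_reg s"
    using sums_add[OF 1 2] by (simp add: zeta_term_def)
  from sums_divide[OF this, of "s - 1"] show ?thesis using s1 by simp
qed

text \<open>Subtracting twice the terms of even integers from the zeta series leaves the alternating
  series. Its coefficients are periodic with mean zero, so it is entire.\<close>

lemma eta_series:
  assumes "Re s > 1"
  shows "(\<lambda>n. (-1) ^ n * of_nat (Suc n) powr (-s)) sums ((1 - 2 powr (1 - s)) * (zeta_reg s / (s - 1)))"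
proof -
  let ?z = "zeta_reg s / (s - 1)"
  have "(\<lambda>k. 2 * 2 powr (-s) * of_nat (Suc k) powr (-s)) sums (2 * 2 powr (-s) * ?z)"
    by (intro sums_mult zeta_series assms)
  also have "(\<lambda>k. 2 * 2 powr (-s) * of_nat (Suc k) powr (-s)) =
      (\<lambda>k. (\<lambda>n. (1 - (-1) ^ n) * of_nat (Suc n) powr (-s)) (2 * k + 1))"
  proof
    fix k
    have "(of_nat (Suc (2 * k + 1)) :: complex) = of_real 2 * of_real (real (Suc k))" by simp
    also have "\<dots> powr (-s) = of_real 2 powr (-s) * of_real (real (Suc k)) powr (-s)"
      by (rule powr_times_real_left) auto
    finally have *: "of_nat (Suc (2 * k + 1)) powr (-s) = 2 powr (-s) * of_nat (Suc k) powr (-s)" by simp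
    show "2 * 2 powr (-s) * of_nat (Suc k) powr (-s) = (1 - (-1) ^ (2 * k + 1)) * of_nat (Suc (2 * k + 1)) powr (-s)"
      unfolding * by simp
  qed
  finally have "(\<lambda>n. (1 - (-1) ^ n) * of_nat (Suc n) powr (-s)) sums (2 * 2 powr (-s) * ?z)"
  proof (subst (asm) sums_mono_reindex)
    show "strict_mono (\<lambda>k::nat. 2 * k + 1)" by (auto simp: strict_mono_def)
    fix n assume "n \<notin> range (\<lambda>k::nat. 2 * k + 1)"
    hence "even n" by (metis oddE rangeI)
    thus "(1 - (-1) ^ n) * of_nat (Suc n) powr (-s) = (0::complex)" by simp
  qed
  from sums_diff[OF zeta_series[OF assms] this]
  have "(\<lambda>n. (-1) ^ n * of_nat (Suc n) powr (-s)) sums (?z - 2 * 2 powr (-s) * ?z)" by (simp add: algebra_simps)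
  moreover have "2 powr (1 - s) = (2::complex) * 2 powr (-s)"
    using powr_add[of "2::complex" 1 "-s"] by simp
  ultimately show ?thesis by (simp add: algebra_simps)
qed

text \<open>\<open>zeta_reg\<close> is controlled only for Re s > 0, while
  \<open>dirichlet_L\<close> asks for a function on the whole plane. The entire alternating series
  divided by \<open>1 - 2 powr (1 - s)\<close> provides one; the zeros of this denominator lie on Re
  s = 1, outside the strip.\<close>

lemma dirichlet_L_trivial:
  assumes "0 < Re s" "Re s < 1"
  shows "dirichlet_L (\<lambda>_. 1) s = zeta_reg s / (s - 1)"
proof -
  have "\<exists>g. g holomorphic_on UNIV \<and> (\<forall>s. Re s > 0 \<longrightarrow> (\<lambda>n. (-1) ^ n * of_nat (Suc n) powr (-s)) sums g s)"
    by (rule zero_mean_series_entire[of _ 2]) (auto simp: numeral_2_eq_2)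
  then obtain E where E: "E holomorphic_on UNIV"
    "\<And>s. Re s > 0 \<Longrightarrow> (\<lambda>n. (-1) ^ n * of_nat (Suc n) powr (-s)) sums E s" by blast
  define g where "g = (\<lambda>s. E s / (1 - 2 powr (1 - s)))"
  have nz: "1 - 2 powr (1 - s) \<noteq> (0::complex)" if "Re s \<noteq> 1" for s
  proof
    assume "1 - 2 powr (1 - s) = (0::complex)"
    hence "norm (2 powr (1 - s) :: complex) = 1" by (metis eq_iff_diff_eq_0 norm_one)
    hence "2 powr (1 - Re s) = 1" using norm_of_real_powr[of 2 "1 - s"] by simp
    thus False using that by (simp add: powr_def)
  qed
  have E': "E analytic_on A" for A using E(1) by (auto simp: analytic_on_open intro: analytic_on_subset[of _ UNIV])
  have E_eq: "E s = (1 - 2 powr (1 - s)) * (zeta_reg s / (s - 1))" if "Re s > 1" for s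
    using sums_unique2[OF E(2) eta_series] that by simp
  have "dirichlet_L (\<lambda>_. 1) = remove_sings g"
  proof (rule dirichlet_L_eqI)
    show "g meromorphic_on UNIV" unfolding g_def
      by (intro meromorphic_intros analytic_on_imp_meromorphic_on E' analytic_intros) auto
    show "g holomorphic_on {s. Re s > 1}" unfolding g_def
      using nz by (intro holomorphic_intros holomorphic_on_subset[OF E(1)]) auto
    fix s :: complex assume s: "Re s > 1"
    show "(\<lambda>n. 1 * of_nat (Suc n) powr (-s)) sums g s"
      using zeta_series[OF s] E_eq[OF s] nz[of s] s by (simp add: g_def)
  qed
  moreover have "remove_sings g s = g s"
  proof (rule remove_sings_at_analytic)
    show "g analytic_on {s}" unfolding g_def using nz assms by (intro analytic_intros E') auto
  qed
  \<comment> \<open>Cross-multiplied, so that both sides are holomorphic across the line Re s = 1,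
    where the quotients could be singular.\<close>
  moreover have "E s * (s - 1) = zeta_reg s * (1 - 2 powr (1 - s))"
  proof (rule analytic_continuation_open[of "{s. Re s > 1}" "{s. Re s > 0}" "\<lambda>s. E s * (s - 1)" "\<lambda>s. zeta_reg s * (1 - 2 powr (1 - s))"])
    show "{s. Re s > 1} \<noteq> {}" by (auto intro!: exI[of _ 2])
    show "connected {s. Re s > 0}" by (intro convex_connected convex_halfspace_Re_gt)
    show "(\<lambda>s. E s * (s - 1)) holomorphic_on {s. 0 < Re s}"
      by (intro holomorphic_intros holomorphic_on_subset[OF E(1)]) auto
    show "(\<lambda>s. zeta_reg s * (1 - 2 powr (1 - s))) holomorphic_on {s. 0 < Re s}"
      by (intro holomorphic_intros holomorphic_zeta_reg) auto
    show "E s * (s - 1) = zeta_reg s * (1 - 2 powr (1 - s))" if "s \<in> {s. 1 < Re s}" for s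
    proof -
      have "s \<noteq> 1" using that by auto
      thus ?thesis using E_eq[of s] that by simp
    qed
  qed (use assms in \<open>auto intro: open_halfspace_Re_gt\<close>)
  moreover have "s - 1 \<noteq> 0" "1 - 2 powr (1 - s) \<noteq> (0::complex)" using nz[of s] assms by auto
  ultimately show ?thesis
    by (simp only: g_def) (simp add: frac_eq_eq)
qed

lemma grh_zeta_nonzero:
  assumes "generalised_riemann_hypothesis" "1/2 < Re s" "Re s < 1"
  shows "zeta_reg s \<noteq> 0"
proof
  assume "zeta_reg s = 0"
  hence "dirichlet_L (\<lambda>_. 1) s = 0" using dirichlet_L_trivial[of s] assms by simp
  moreover have "dirichlet_character 1 (\<lambda>_. 1)" by (simp add: dirichlet_character_def)
  ultimately show False using assms unfolding generalised_riemann_hypothesis_def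
    by (metis less_irrefl less_trans half_gt_zero_iff zero_less_one)
qed

lemma grh_L_nonzero:
  assumes "generalised_riemann_hypothesis" "dirichlet_character q \<psi>" "1/2 < Re s" "Re s < 1"
  shows "dirichlet_L \<psi> s \<noteq> 0"
proof -
  have "0 < Re s" using assms by simp
  thus ?thesis using assms unfolding generalised_riemann_hypothesis_def by fastforce
qed

subsection \<open>Euler products and the line Re s = 1\<close>

lemma of_nat_mult_powr:
  "of_nat (m * n) powr s = (of_nat m powr s * of_nat n powr s :: complex)"
proof -
  have "of_nat (m * n) powr s = (of_real (real m) * of_real (real n)) powr s" by simp
  also have "\<dots> = of_real (real m) powr s * of_real (real n) powr s"
    by (rule powr_times_real_left) auto
  finally show ?thesis by simp
qed

lemma norm_of_nat_powr: "n > 0 \<Longrightarrow> norm (of_nat n powr s :: complex) = real n powr Re s"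
  using norm_of_real_powr[of "real n" s] by simp

text \<open>The threshold 3/4 lies above 1 / sqrt 2, the largest possible norm of
  \<open>p powr (-s)\<close> for Re s \<ge> 1/2, and keeps z away from the singularity at 1.\<close>

lemma norm_minus_Ln_minus_le:
  assumes "norm (z::complex) \<le> 3/4"
  shows "norm (-Ln (1 - z) - z) \<le> 4 * norm z ^ 2"
proof -
  have "norm (Ln (1 + (-z)) - (-z)) \<le> norm (-z) ^ 2 / (1 - norm (-z))"
    by (rule Ln_approx_linear) (use assms in auto)
  also have "\<dots> \<le> norm z ^ 2 / (1/4)" using assms by (intro frac_le) auto
  finally have "norm (Ln (1 - z) + z) \<le> 4 * norm z ^ 2" by simp
  moreover have "-Ln (1 - z) - z = -(Ln (1 - z) + z)" by simp
  ultimately show ?thesis by (simp only: norm_minus_cancel)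
qed

lemma norm_Ln_minus_le:
  assumes "norm (z::complex) \<le> 3/4"
  shows "norm (-Ln (1 - z)) \<le> 4 * norm z"
proof -
  have "norm (-Ln (1 - z)) \<le> norm (-Ln (1 - z) - z) + norm z" by (metis norm_triangle_sub add.commute)
  also have "\<dots> \<le> 4 * norm z * norm z + norm z" using norm_minus_Ln_minus_le[OF assms] by (simp add: power2_eq_square)
  also have "\<dots> \<le> 4 * (3/4) * norm z + norm z" using assms by (intro add_mono mult_right_mono mult_left_mono) auto
  finally show ?thesis by simp
qed

text \<open>Treats the constant function 1, which gives zeta, together with the quadratic
  characters. The value 0 is allowed, so primes dividing the conductor are included.\<close>

locale completely_multiplicative =
  fixes f :: "nat \<Rightarrow> complex"
  assumes mult: "f (m * n) = f m * f n" and one: "f 1 = 1" and le1: "norm (f n) \<le> 1"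
begin

definition h :: "complex \<Rightarrow> nat \<Rightarrow> complex" where "h s n = f n * of_nat n powr (-s)"

definition prime_log :: "complex \<Rightarrow> complex" where
  "prime_log s = (\<Sum>n. if prime n then -Ln (1 - h s n) else 0)"

lemma h_mult: "h s (m * n) = h s m * h s n"
  by (simp only: h_def mult of_nat_mult_powr mult_ac)

text \<open>Powers of the base 0 are 0 by convention, so the index 0 drops out even when
  \<open>f 0 = 1\<close>, as for the constant function.\<close>

lemma h_0 [simp]: "h s 0 = 0" and h_1 [simp]: "h s (Suc 0) = 1"
  using one by (auto simp: h_def)

lemma norm_h_le: "norm (h s n) \<le> real n powr (-Re s)"
proof (cases "n = 0")
  case False
  thus ?thesis using le1[of n] by (simp add: h_def norm_mult norm_of_nat_powr mult_left_le_one_le)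
qed auto

lemma norm_h_prime_le:
  assumes "prime n" "Re s \<ge> 1/2" shows "norm (h s n) \<le> 3/4"
proof -
  have n: "real n \<ge> 2" using assms prime_ge_2_nat[of n] by simp
  have "norm (h s n) \<le> real n powr (-Re s)" by (rule norm_h_le)
  also have "\<dots> \<le> real n powr (-1/2)" using n assms by (intro powr_mono) auto
  also have "\<dots> \<le> 2 powr (-1/2)" using n by (intro powr_mono2') auto
  also have "\<dots> = 1 / sqrt 2" by (simp add: powr_minus powr_half_sqrt field_simps)
  also have "\<dots> \<le> 3/4"
  proof -
    have "4/3 \<le> sqrt 2" by (rule real_le_rsqrt) (simp add: power2_eq_square)
    thus ?thesis by (simp add: field_simps)
  qed
  finally show ?thesis .
qed

lemma holomorphic_h: "(\<lambda>s. h s n) holomorphic_on A"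
proof (cases "n = 0")
  case False thus ?thesis unfolding h_def by (intro holomorphic_intros) auto
qed simp

lemma summable_norm_h: "Re s > 1 \<Longrightarrow> summable (\<lambda>n. norm (h s n))"
  by (rule summable_comparison_test'[of "\<lambda>n. real n powr (-Re s)" 0])
     (use norm_h_le in \<open>auto simp: summable_real_powr_iff\<close>)

lemma prime_log_sums:
  assumes "Re s > 1"
  shows "(\<lambda>n. if prime n then -Ln (1 - h s n) else 0) sums prime_log s"
    and "norm (prime_log s) \<le> 4 * (\<Sum>n. if prime n then real n powr (-Re s) else 0)"
proof -
  have s0: "summable (\<lambda>n. if prime n then real n powr (-Re s) else 0)"
    by (rule summable_comparison_test'[of "\<lambda>n. real n powr (-Re s)" 0])
       (use assms in \<open>auto simp: summable_real_powr_iff\<close>)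
  have bd: "norm (if prime n then -Ln (1 - h s n) else 0) \<le> 4 * (if prime n then real n powr (-Re s) else 0)" for n
  proof (cases "prime n")
    case True
    have "norm (-Ln (1 - h s n)) \<le> 4 * norm (h s n)"
      using True assms by (intro norm_Ln_minus_le norm_h_prime_le) auto
    also have "\<dots> \<le> 4 * real n powr (-Re s)" using norm_h_le by simp
    finally show ?thesis using True by simp
  qed auto
  show "(\<lambda>n. if prime n then -Ln (1 - h s n) else 0) sums prime_log s"
    unfolding prime_log_def
    by (intro summable_sums summable_comparison_test'[OF summable_mult[OF s0, of 4], of 0] bd)
  show "norm (prime_log s) \<le> 4 * (\<Sum>n. if prime n then real n powr (-Re s) else 0)"
    unfolding prime_log_def
    using norm_suminf_le[OF bd summable_mult[OF s0]] suminf_mult[OF s0, of 4] by simp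
qed

text \<open>Sieving out the multiples of one prime after the other multiplies the sum by \<open>1 - h s p\<close>.\<close>

lemma sieved_sum:
  assumes s: "Re s > 1" and L: "h s sums L"
  shows "(h s has_sum L * (\<Prod>p | prime p \<and> p < N. 1 - h s p)) {n. n > 0 \<and> (\<forall>p<N. prime p \<longrightarrow> \<not> p dvd n)}"
proof (induction N)
  case 0
  have "(h s has_sum L) UNIV" by (rule norm_summable_imp_has_sum[OF summable_norm_h[OF s] L])
  hence "(h s has_sum L) {n. n > 0}"
    by (rule has_sum_cong_neutral[THEN iffD1, rotated 3]) auto
  thus ?case by simp
next
  case (Suc N)
  let ?A = "\<lambda>N. {n. n > 0 \<and> (\<forall>p<N. prime p \<longrightarrow> \<not> p dvd n)}"
  let ?T = "L * (\<Prod>p | prime p \<and> p < N. 1 - h s p)"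
  show ?case
  proof (cases "prime N")
    case False
    have "?A (Suc N) = ?A N" "{p. prime p \<and> p < Suc N} = {p. prime p \<and> p < N}"
      using False by (auto simp: less_Suc_eq)
    thus ?thesis using Suc.IH by simp
  next
    case True
    have N: "N > 0" using True by (simp add: prime_gt_0_nat)
    have img: "?A (Suc N) = ?A N - (*) N ` ?A N"
    proof (intro equalityI subsetI)
      fix n assume "n \<in> ?A (Suc N)"
      thus "n \<in> ?A N - (*) N ` ?A N" using True by (auto simp: less_Suc_eq)
    next
      fix n assume n: "n \<in> ?A N - (*) N ` ?A N"
      have "\<not> N dvd n"
      proof
        assume "N dvd n"
        then obtain m where m: "n = N * m" by auto
        hence "m \<in> ?A N" using n by auto
        thus False using n m by auto
      qed
      thus "n \<in> ?A (Suc N)" using n by (auto simp: less_Suc_eq)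
    qed
    have sub: "(*) N ` ?A N \<subseteq> ?A N"
    proof (clarsimp simp: N)
      fix m p assume m: "m > 0" "\<forall>p<N. prime p \<longrightarrow> \<not> p dvd m" and p: "p < N" "prime p" "p dvd N * m"
      hence "p dvd N \<or> p dvd m" by (simp add: prime_dvd_mult_iff)
      thus False using m p True by (metis less_irrefl primes_dvd_imp_eq)
    qed
    have "inj_on ((*) N) (?A N)" using N by (auto simp: inj_on_def)
    hence "(h s has_sum (h s N * ?T)) ((*) N ` ?A N)"
      by (subst has_sum_reindex) (auto simp: o_def h_mult intro!: has_sum_cmult_right Suc.IH)
    from has_sum_Diff[OF Suc.IH this sub]
    have "(h s has_sum (?T - h s N * ?T)) (?A (Suc N))" unfolding img .
    moreover have "{p. prime p \<and> p < Suc N} = insert N {p. prime p \<and> p < N}" using True by (auto simp: less_Suc_eq)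
    ultimately show ?thesis by (simp add: algebra_simps)
  qed
qed

text \<open>After sieving by the primes below N only 1 and integers of size at least N survive, so
  the sieved sum differs from 1 by at most the tail of an absolutely convergent series. Hence L
  times the finite products of \<open>1 - h s p\<close> tends to 1.\<close>

lemma exp_prime_log:
  assumes s: "Re s > 1" and L: "h s sums L"
  shows "exp (prime_log s) = L"
proof -
  let ?A = "\<lambda>N. {n. n > 0 \<and> (\<forall>p<N. prime p \<longrightarrow> \<not> p dvd n)}"
  let ?T = "\<lambda>N. L * (\<Prod>p | prime p \<and> p < N. 1 - h s p)"
  have "norm (?T N - 1) \<le> (\<Sum>n. norm (h s (n + N)))" if N: "N \<ge> 2" for N
  proof -
    have 1: "1 \<in> ?A N" by auto
    have "(h s has_sum (?T N - h s 1)) (?A N - {1})"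
      using 1 by (intro has_sum_Diff[OF sieved_sum[OF s L]] has_sum_finiteI) auto
    hence *: "(h s has_sum (?T N - 1)) (?A N - {1})" by simp
    have sub: "?A N - {1} \<subseteq> {N..}"
    proof
      fix n assume n: "n \<in> ?A N - {1}"
      hence "n \<noteq> 1" by simp
      from prime_factor_nat[OF this] obtain p where p: "prime p" "p dvd n" by blast
      moreover have "\<not> p < N" using n p by blast
      ultimately show "n \<in> {N..}" using n dvd_imp_le[of p n] by auto
    qed
    have sn: "summable (\<lambda>n. norm (h s (n + N)))" using summable_norm_h[OF s] by (rule summable_ignore_initial_segment)
    have "((\<lambda>n. norm (h s (n + N))) has_sum (\<Sum>n. norm (h s (n + N)))) UNIV"
      using sn by (intro sums_nonneg_imp_has_sum summable_sums) auto
    hence tail: "((\<lambda>n. norm (h s n)) has_sum (\<Sum>n. norm (h s (n + N)))) ((\<lambda>n. n + N) ` UNIV)"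
      by (subst has_sum_reindex) (auto simp: o_def)
    have "(\<lambda>n. n + N) ` UNIV = {N..}" by (auto simp: image_def) (metis add.commute le_Suc_ex)
    with tail have tail: "((\<lambda>n. norm (h s n)) has_sum (\<Sum>n. norm (h s (n + N)))) {N..}" by simp
    have "(\<lambda>n. norm (h s n)) summable_on (?A N - {1})"
      using tail sub by (meson summable_on_def summable_on_subset_banach)
    then obtain S where S: "((\<lambda>n. norm (h s n)) has_sum S) (?A N - {1})" by (auto simp: summable_on_def)
    have "norm (?T N - 1) \<le> S" by (rule norm_has_sum_bound[OF S *])
    also have "S \<le> (\<Sum>n. norm (h s (n + N)))"
      by (rule has_sum_mono_neutral[OF S tail]) (use sub in auto)
    finally show ?thesis .
  qed
  moreover have "(\<lambda>N. \<Sum>n. norm (h s (n + N))) \<longlonglongrightarrow> 0"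
    by (rule suminf_exist_split2) (rule summable_norm_h[OF s])
  ultimately have "(\<lambda>N. ?T N - 1) \<longlonglongrightarrow> 0"
    by (intro Lim_null_comparison[of "\<lambda>N. ?T N - 1"]) (auto simp: eventually_at_top_linorder intro!: exI[of _ 2])
  hence T1: "?T \<longlonglongrightarrow> 1" by (simp add: LIM_zero_iff)
  have ex: "exp (\<Sum>n<N. if prime n then -Ln (1 - h s n) else 0) = inverse (\<Prod>p | prime p \<and> p < N. 1 - h s p)" for N
  proof (induction N)
    case (Suc N)
    show ?case
    proof (cases "prime N")
      case True
      have "norm (h s N) \<le> 3/4" using True s by (intro norm_h_prime_le) auto
      hence "1 - h s N \<noteq> 0" by auto
      moreover have "{p. prime p \<and> p < Suc N} = insert N {p. prime p \<and> p < N}" using True by (auto simp: less_Suc_eq)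
      ultimately show ?thesis using Suc True by (simp add: exp_diff field_simps)
    next
      case False
      hence "{p. prime p \<and> p < Suc N} = {p. prime p \<and> p < N}" by (auto simp: less_Suc_eq)
      thus ?thesis using Suc False by simp
    qed
  qed auto
  have E: "(\<lambda>N. exp (\<Sum>n<N. if prime n then -Ln (1 - h s n) else 0)) \<longlonglongrightarrow> exp (prime_log s)"
    using prime_log_sums(1)[OF s] unfolding sums_def by (intro tendsto_exp)
  from tendsto_mult[OF T1 E]
  have "(\<lambda>N. ?T N * inverse (\<Prod>p | prime p \<and> p < N. 1 - h s p)) \<longlonglongrightarrow> exp (prime_log s)" by (simp add: ex)
  moreover have "?T N * inverse (\<Prod>p | prime p \<and> p < N. 1 - h s p) = L" for N
  proof -
    have "(\<Prod>p | prime p \<and> p < N. 1 - h s p) \<noteq> 0" using ex[of N] by (metis exp_not_eq_zero inverse_zero)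
    thus ?thesis by simp
  qed
  ultimately show ?thesis by (simp add: LIMSEQ_const_iff)
qed

end

interpretation trivial: completely_multiplicative "\<lambda>_. 1" by unfold_locales auto

lemma trivial_h_sums: "Re s > 1 \<Longrightarrow> trivial.h s sums (zeta_reg s / (s - 1))"
  using zeta_series[of s] sums_Suc_iff[of "trivial.h s" "zeta_reg s / (s - 1)"]
  by (simp add: trivial.h_def)

lemma continuous_zeta_reg: "Re s > 0 \<Longrightarrow> isCont zeta_reg s"
  using holomorphic_zeta_reg holomorphic_on_imp_continuous_on continuous_on_eq_continuous_at open_halfspace_Re_gt[of 0]
  by blast

text \<open>Euler's argument: bounded sums of 1/p would keep \<open>prime_log\<close> bounded as a
  real argument \<sigma> decreases to 1, whereas its exponential is
  \<open>zeta_reg \<sigma> / (\<sigma> - 1)\<close> and \<open>zeta_reg 1 = 1\<close>. The statement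
  is about finite sets because Landau's argument singles out finitely many primes.\<close>

lemma sum_prime_reciprocals_unbounded:
  "\<exists>S. finite S \<and> (\<forall>p\<in>S. prime p) \<and> (\<Sum>p\<in>S. 1 / real p) > K"
proof (rule ccontr)
  assume "\<not> ?thesis"
  hence K: "(\<Sum>p\<in>S. 1 / real p) \<le> K" if "finite S" "\<And>p. p \<in> S \<Longrightarrow> prime p" for S
    using that by (meson not_le)
  have bound: "norm (zeta_reg (of_real \<sigma>)) \<le> exp (4 * K) * (\<sigma> - 1)" if \<sigma>: "\<sigma> > 1" for \<sigma> :: real
  proof -
    have "(\<Sum>n. if prime n then real n powr (-\<sigma>) else 0) \<le> K"
    proof (rule suminf_le_const)
      show "summable (\<lambda>n. if prime n then real n powr (-\<sigma>) else 0)"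
        by (rule summable_comparison_test'[of "\<lambda>n. real n powr (-\<sigma>)" 0])
           (use \<sigma> in \<open>auto simp: summable_real_powr_iff\<close>)
      fix N
      have "(\<Sum>n<N. if prime n then real n powr (-\<sigma>) else 0) = (\<Sum>n | n < N \<and> prime n. real n powr (-\<sigma>))"
        by (auto simp: sum.If_cases intro!: sum.cong)
      also have "\<dots> \<le> (\<Sum>n | n < N \<and> prime n. 1 / real n)"
      proof (rule sum_mono)
        fix n assume "n \<in> {n. n < N \<and> prime n}"
        hence "real n \<ge> 1" using prime_ge_1_nat by auto
        hence "real n powr (-\<sigma>) \<le> real n powr (-1)" using \<sigma> by (intro powr_mono) auto
        thus "real n powr (-\<sigma>) \<le> 1 / real n" by (simp add: powr_minus divide_inverse)
      qed
      also have "\<dots> \<le> K" by (rule K) auto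
      finally show "(\<Sum>n<N. if prime n then real n powr (-\<sigma>) else 0) \<le> K" .
    qed
    hence "norm (trivial.prime_log (of_real \<sigma>)) \<le> 4 * K"
      using trivial.prime_log_sums(2)[of "of_real \<sigma>"] \<sigma> unfolding Re_complex_of_real by simp
    hence "norm (exp (trivial.prime_log (of_real \<sigma>))) \<le> exp (4 * K)"
      by (meson norm_exp exp_le_cancel_iff order_trans)
    also have "exp (trivial.prime_log (of_real \<sigma>)) = zeta_reg (of_real \<sigma>) / (of_real \<sigma> - 1)"
      by (rule trivial.exp_prime_log) (use \<sigma> trivial_h_sums in auto)
    also have "norm \<dots> = norm (zeta_reg (of_real \<sigma>)) / (\<sigma> - 1)"
      using \<sigma> by (metis abs_of_pos diff_gt_0_iff_gt norm_divide norm_of_real of_real_1 of_real_diff)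
    finally show ?thesis using \<sigma> by (simp add: field_simps)
  qed
  have "((\<lambda>\<sigma>. norm (zeta_reg (of_real \<sigma>))) \<longlongrightarrow> norm (zeta_reg (of_real 1))) (at_right 1)"
    by (intro tendsto_norm isCont_tendsto_compose[OF continuous_zeta_reg] tendsto_of_real tendsto_ident_at) auto
  moreover have "((\<lambda>\<sigma>. exp (4 * K) * (\<sigma> - 1)) \<longlongrightarrow> exp (4 * K) * (1 - 1)) (at_right 1)"
    by (intro tendsto_intros)
  moreover have "eventually (\<lambda>\<sigma>::real. \<sigma> > 1) (at_right 1)" by (rule eventually_at_right_less)
  hence "eventually (\<lambda>\<sigma>. norm (zeta_reg (of_real \<sigma>)) \<le> exp (4 * K) * (\<sigma> - 1)) (at_right 1)"
    by eventually_elim (rule bound)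
  ultimately have "norm (zeta_reg (of_real 1)) \<le> exp (4 * K) * (1 - 1)"
    by (intro tendsto_le[of "at_right (1::real)"]) auto
  thus False by (simp add: zeta_reg_1)
qed

text \<open>The term k = 0 is 1 / 0 = 0 by convention, so the series effectively starts at k =
  1.\<close>

lemma Ln_one_minus_sums: "norm (z::complex) < 1 \<Longrightarrow> (\<lambda>k. z ^ k / of_nat k) sums (-Ln (1 - z))"
  using sums_minus[OF Ln_series'[of "-z"]] by simp

text \<open>The classical inequality \<open>3 + 4 cos \<theta> + cos 2\<theta> \<ge> 0\<close>, applied to each term of the Euler product.\<close>

lemma mertens_inequality:
  fixes z :: real and u w :: complex
  assumes z: "0 \<le> z" "z < 1" and u: "norm u = 1" and w: "w = 0 \<or> w = u \<or> w = -u"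
  shows "Re (3 * (-Ln (1 - of_real z)) + 4 * (-Ln (1 - of_real z * w)) + (-Ln (1 - of_real z * u ^ 2))) \<ge> 0"
proof -
  have nw: "norm w \<le> 1" using u w by auto
  have "norm (of_real z * w) < 1" using nw z by (simp add: norm_mult) (metis le_less_trans mult_left_le)
  moreover have "norm (of_real z * u ^ 2) < 1" using z u by (simp add: norm_mult norm_power)
  moreover have "norm (of_real z :: complex) < 1" using z by simp
  ultimately have "(\<lambda>k. 3 * (of_real z ^ k / of_nat k) + 4 * ((of_real z * w) ^ k / of_nat k) + (of_real z * u ^ 2) ^ k / of_nat k)
     sums (3 * (-Ln (1 - of_real z)) + 4 * (-Ln (1 - of_real z * w)) + (-Ln (1 - of_real z * u ^ 2)))"
    by (intro sums_add sums_mult Ln_one_minus_sums)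
  hence S: "(\<lambda>k. Re (3 * (of_real z ^ k / of_nat k) + 4 * ((of_real z * w) ^ k / of_nat k) + (of_real z * u ^ 2) ^ k / of_nat k))
     sums Re (3 * (-Ln (1 - of_real z)) + 4 * (-Ln (1 - of_real z * w)) + (-Ln (1 - of_real z * u ^ 2)))"
    by (rule sums_Re)
  have "Re (3 * (of_real z ^ k / of_nat k) + 4 * ((of_real z * w) ^ k / of_nat k) + (of_real z * u ^ 2) ^ k / of_nat k) \<ge> 0" for k
  proof (cases "k = 0")
    case False
    define v where "v = u ^ k"
    have v: "norm v = 1" using u by (simp add: v_def norm_power)
    hence cs: "(Re v)\<^sup>2 + (Im v)\<^sup>2 = 1" by (simp add: cmod_power2[symmetric])
    have re2: "Re (v ^ 2) = 2 * (Re v)\<^sup>2 - 1" using cs by (simp add: power2_eq_square)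
    have wk: "w ^ k = 0 \<or> w ^ k = v \<or> w ^ k = -v" using w False by (cases "even k") (auto simp: v_def)
    have "3 * (of_real z ^ k / of_nat k) + 4 * ((of_real z * w) ^ k / of_nat k) + (of_real z * u ^ 2) ^ k / of_nat k
       = of_real (z ^ k / real k) * (3 + 4 * w ^ k + v ^ 2)"
      by (simp add: power_mult_distrib v_def power_mult[symmetric] mult.commute algebra_simps add_divide_distrib)
    hence "Re (3 * (of_real z ^ k / of_nat k) + 4 * ((of_real z * w) ^ k / of_nat k) + (of_real z * u ^ 2) ^ k / of_nat k)
       = z ^ k / real k * Re (3 + 4 * w ^ k + v ^ 2)" by (simp only: times_complex.simps Re_complex_of_real Im_complex_of_real)
    \<comment> \<open>The cases \<open>w ^ k = v\<close>, \<open>-v\<close> and 0 give 2 (Re v +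
      1)^2, 2 (Re v - 1)^2 and 2 + 2 (Re v)^2.\<close>
    moreover have "Re (3 + 4 * w ^ k + v ^ 2) \<ge> 0"
    proof -
      have "2 * (Re v + 1)\<^sup>2 \<ge> 0" "2 * (Re v - 1)\<^sup>2 \<ge> 0" "(Re v)\<^sup>2 \<ge> 0" by auto
      thus ?thesis using wk re2 False by (elim disjE) (auto simp: power2_eq_square algebra_simps zero_power)
    qed
    ultimately show ?thesis using z by simp
  qed auto
  from suminf_nonneg[OF sums_summable[OF S] this] S show ?thesis by (simp only: sums_iff)
qed

context completely_multiplicative
begin

text \<open>At a prime p this is \<open>mertens_inequality\<close> with u = p^(-it) and w = f(p) u.
  The last factor is \<zeta> at \<sigma> + 2it, with full Euler factors also where f vanishes; there
  w = 0.\<close>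

lemma three_four_one:
  assumes real: "\<And>n. f n = 0 \<or> f n = 1 \<or> f n = -1" and \<sigma>: "\<sigma> > 1"
    and L: "h (Complex \<sigma> t) sums L"
  shows "norm ((zeta_reg (of_real \<sigma>) / (of_real \<sigma> - 1)) ^ 3 * L ^ 4 *
            (zeta_reg (Complex \<sigma> (2 * t)) / (Complex \<sigma> (2 * t) - 1))) \<ge> 1"
proof -
  let ?g = "\<lambda>n. if prime n then -Ln (1 - trivial.h (of_real \<sigma>) n) else 0"
  let ?f = "\<lambda>n. if prime n then -Ln (1 - h (Complex \<sigma> t) n) else 0"
  let ?k = "\<lambda>n. if prime n then -Ln (1 - trivial.h (Complex \<sigma> (2*t)) n) else 0"
  let ?S = "3 * trivial.prime_log (of_real \<sigma>) + 4 * prime_log (Complex \<sigma> t) + trivial.prime_log (Complex \<sigma> (2*t))"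
  have "(\<lambda>n. 3 * ?g n + 4 * ?f n + ?k n) sums ?S"
    by (intro sums_add sums_mult trivial.prime_log_sums prime_log_sums) (use \<sigma> in auto)
  hence S: "(\<lambda>n. Re (3 * ?g n + 4 * ?f n + ?k n)) sums Re ?S" by (rule sums_Re)
  have "Re (3 * ?g n + 4 * ?f n + ?k n) \<ge> 0" for n
  proof (cases "prime n")
    case True
    hence n: "n > 1" by (rule prime_gt_1_nat)
    define z where "z = real n powr (-\<sigma>)"
    define u where "u = (of_nat n :: complex) powr (Complex 0 (-t))"
    have z: "0 \<le> z" "z < 1" using n \<sigma> by (auto simp: z_def powr_less_one)
    have u: "norm u = 1" using n by (simp add: u_def norm_of_nat_powr)
    have z1: "of_nat n powr (-of_real \<sigma>) = (of_real z :: complex)"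
      using n powr_of_real[of "real n" "-\<sigma>"] by (simp add: z_def)
    have z2: "of_nat n powr (-(Complex \<sigma> t)) = of_real z * u"
    proof -
      have "-(Complex \<sigma> t) = -of_real \<sigma> + Complex 0 (-t)" by (simp add: complex_eq_iff)
      thus ?thesis by (simp only: powr_add z1 u_def)
    qed
    have z3: "of_nat n powr (-(Complex \<sigma> (2*t))) = of_real z * u ^ 2"
    proof -
      have "-(Complex \<sigma> (2*t)) = -of_real \<sigma> + (Complex 0 (-t) + Complex 0 (-t))" by (simp add: complex_eq_iff)
      thus ?thesis by (simp only: powr_add z1 u_def power2_eq_square)
    qed
    have "Re (3 * (-Ln (1 - of_real z)) + 4 * (-Ln (1 - of_real z * (f n * u))) + (-Ln (1 - of_real z * u ^ 2))) \<ge> 0"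
      by (rule mertens_inequality[OF z u]) (use real[of n] in auto)
    thus ?thesis using True by (simp add: trivial.h_def h_def z1 z2 z3 mult.left_commute)
  qed auto
  from suminf_nonneg[OF sums_summable[OF S] this] S have "Re ?S \<ge> 0" by (simp only: sums_iff)
  hence "norm (exp ?S) \<ge> 1" by simp
  also have "exp ?S = exp (trivial.prime_log (of_real \<sigma>)) ^ 3 * exp (prime_log (Complex \<sigma> t)) ^ 4 * exp (trivial.prime_log (Complex \<sigma> (2*t)))"
    by (simp add: exp_add exp_of_nat_mult[of 3, simplified] exp_of_nat_mult[of 4, simplified])
  also have "exp (trivial.prime_log (of_real \<sigma>)) = zeta_reg (of_real \<sigma>) / (of_real \<sigma> - 1)"
    by (rule trivial.exp_prime_log) (use \<sigma> trivial_h_sums in auto)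
  also have "exp (prime_log (Complex \<sigma> t)) = L"
    by (rule exp_prime_log) (use \<sigma> L in auto)
  also have "exp (trivial.prime_log (Complex \<sigma> (2*t))) = zeta_reg (Complex \<sigma> (2*t)) / (Complex \<sigma> (2*t) - 1)"
    by (rule trivial.exp_prime_log) (use \<sigma> trivial_h_sums in auto)
  finally show ?thesis .
qed

text \<open>A zero at 1 + it would count four times against the triple pole of zeta at 1, while zeta
  is finite at 1 + 2it because t is not 0. The product would tend to 0 and contradict
  \<open>three_four_one\<close>.\<close>

lemma nonzero_on_line_1:
  assumes real: "\<And>n. f n = 0 \<or> f n = 1 \<or> f n = -1" and t: "t \<noteq> 0"
    and Lf: "\<And>s. Re s > 1 \<Longrightarrow> h s sums Lf s" and diff: "Lf field_differentiable at (Complex 1 t)"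
  shows "Lf (Complex 1 t) \<noteq> 0"
proof
  assume zero: "Lf (Complex 1 t) = 0"
  from diff obtain D where D: "(Lf has_field_derivative D) (at (Complex 1 t))" by (auto simp: field_differentiable_def)
  have lim: "((\<lambda>\<sigma>. Complex \<sigma> y) \<longlongrightarrow> Complex 1 y) (at_right 1)" for y
    by (intro tendsto_intros)
  have "filterlim (\<lambda>\<sigma>. Complex \<sigma> t) (at (Complex 1 t)) (at_right 1)"
    unfolding filterlim_at
    using lim by (auto intro: eventually_mono[OF eventually_at_right_less])
  from filterlim_compose[OF D[unfolded has_field_derivative_iff] this]
  have 1: "((\<lambda>\<sigma>. Lf (Complex \<sigma> t) / of_real (\<sigma> - 1)) \<longlongrightarrow> D) (at_right 1)"
  proof (rule Lim_transform_eventually, intro eventually_mono[OF eventually_at_right_less])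
    fix \<sigma> :: real assume "1 < \<sigma>"
    have "Complex \<sigma> t - Complex 1 t = of_real (\<sigma> - 1)" by (simp add: complex_eq_iff)
    thus "(Lf (Complex \<sigma> t) - Lf (Complex 1 t)) / (Complex \<sigma> t - Complex 1 t) = Lf (Complex \<sigma> t) / of_real (\<sigma> - 1)"
      by (simp only: zero) simp
  qed
  have 2: "((\<lambda>\<sigma>. zeta_reg (of_real \<sigma>)) \<longlongrightarrow> zeta_reg (of_real 1)) (at_right 1)"
    by (intro isCont_tendsto_compose[OF continuous_zeta_reg] tendsto_of_real tendsto_ident_at) auto
  have 3: "((\<lambda>\<sigma>. zeta_reg (Complex \<sigma> (2*t)) / (Complex \<sigma> (2*t) - 1)) \<longlongrightarrow> zeta_reg (Complex 1 (2*t)) / (Complex 1 (2*t) - 1)) (at_right 1)"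
    by (intro tendsto_divide tendsto_diff isCont_tendsto_compose[OF continuous_zeta_reg] lim tendsto_const)
       (use t in \<open>auto simp: complex_eq_iff\<close>)
  have 4: "((\<lambda>\<sigma>. of_real (\<sigma> - 1) :: complex) \<longlongrightarrow> of_real (1 - 1)) (at_right 1)"
    by (intro tendsto_intros)
  have "((\<lambda>\<sigma>. norm (zeta_reg (of_real \<sigma>) ^ 3 * (Lf (Complex \<sigma> t) / of_real (\<sigma> - 1)) ^ 4 *
           (zeta_reg (Complex \<sigma> (2*t)) / (Complex \<sigma> (2*t) - 1)) * of_real (\<sigma> - 1))) \<longlongrightarrow>
        norm (zeta_reg (of_real 1) ^ 3 * D ^ 4 * (zeta_reg (Complex 1 (2*t)) / (Complex 1 (2*t) - 1)) * of_real (1 - 1))) (at_right 1)"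
    by (intro tendsto_norm tendsto_mult tendsto_power 1 2 3 4)
  moreover have "eventually (\<lambda>\<sigma>. norm (zeta_reg (of_real \<sigma>) ^ 3 * (Lf (Complex \<sigma> t) / of_real (\<sigma> - 1)) ^ 4 *
           (zeta_reg (Complex \<sigma> (2*t)) / (Complex \<sigma> (2*t) - 1)) * of_real (\<sigma> - 1)) \<ge> 1) (at_right 1)"
  proof (intro eventually_mono[OF eventually_at_right_less])
    fix \<sigma> :: real assume \<sigma>: "1 < \<sigma>"
    have nz: "(of_real \<sigma> - 1 :: complex) \<noteq> 0" using \<sigma> by (metis less_irrefl of_real_1 of_real_eq_iff right_minus_eq)
    have "norm ((zeta_reg (of_real \<sigma>) / (of_real \<sigma> - 1)) ^ 3 * Lf (Complex \<sigma> t) ^ 4 *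
            (zeta_reg (Complex \<sigma> (2 * t)) / (Complex \<sigma> (2 * t) - 1))) \<ge> 1"
      by (rule three_four_one[OF real \<sigma>]) (use Lf \<sigma> in auto)
    also have "(zeta_reg (of_real \<sigma>) / (of_real \<sigma> - 1)) ^ 3 * Lf (Complex \<sigma> t) ^ 4 = 
       zeta_reg (of_real \<sigma>) ^ 3 * (Lf (Complex \<sigma> t) / of_real (\<sigma> - 1)) ^ 4 * of_real (\<sigma> - 1)"
    proof -
      have "(a / c) ^ 3 * b ^ 4 = a ^ 3 * (b / c) ^ 4 * c" if "c \<noteq> 0" for a b c :: complex
        using that by (simp add: field_simps eval_nat_numeral)
      from this[OF nz] show ?thesis by (simp only: of_real_diff of_real_1)
    qed
    finally show "norm (zeta_reg (of_real \<sigma>) ^ 3 * (Lf (Complex \<sigma> t) / of_real (\<sigma> - 1)) ^ 4 *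
           (zeta_reg (Complex \<sigma> (2*t)) / (Complex \<sigma> (2*t) - 1)) * of_real (\<sigma> - 1)) \<ge> 1" by (simp only: mult_ac)
  qed
  ultimately have "1 \<le> norm (zeta_reg (of_real 1) ^ 3 * D ^ 4 * (zeta_reg (Complex 1 (2*t)) / (Complex 1 (2*t) - 1)) * of_real (1 - 1))"
    by (intro tendsto_lowerbound) auto
  thus False by simp
qed

end

subsection \<open>Logarithms of L-functions\<close>

text \<open>Says that the Taylor coefficients in powers of 2 - s are real and nonnegative. Dirichlet
  series with nonnegative coefficients have this property, and it survives sums and uniform limits
  near 2, so it can be checked one Euler factor at a time.\<close>

definition alternating_at_2 :: "(complex \<Rightarrow> complex) \<Rightarrow> bool" where
  "alternating_at_2 g \<longleftrightarrow> g holomorphic_on ball 2 1 \<and> (\<forall>j. (-1) ^ j * (deriv ^^ j) g 2 \<in> \<real>\<^sub>\<ge>\<^sub>0)"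

lemma alternating_at_2_0: "alternating_at_2 (\<lambda>_. 0)"
  by (auto simp: alternating_at_2_def)

lemma alternating_at_2_add:
  assumes "alternating_at_2 f" "alternating_at_2 g"
  shows "alternating_at_2 (\<lambda>s. f s + g s)"
  unfolding alternating_at_2_def
proof (intro conjI allI)
  show "(\<lambda>s. f s + g s) holomorphic_on ball 2 1"
    using assms by (intro holomorphic_intros) (auto simp: alternating_at_2_def)
  fix j
  have "(deriv ^^ j) (\<lambda>s. f s + g s) 2 = (deriv ^^ j) f 2 + (deriv ^^ j) g 2"
    using assms by (intro higher_deriv_add[of _ "ball 2 1"]) (auto simp: alternating_at_2_def)
  thus "(-1) ^ j * (deriv ^^ j) (\<lambda>s. f s + g s) 2 \<in> \<real>\<^sub>\<ge>\<^sub>0"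
    using assms by (simp add: alternating_at_2_def distrib_left)
qed

lemma alternating_at_2_sum:
  assumes "\<And>n::nat. alternating_at_2 (f n)"
  shows "alternating_at_2 (\<lambda>s. \<Sum>n<N. f n s)"
  by (induction N) (auto intro: alternating_at_2_0 alternating_at_2_add assms)

lemma alternating_at_2_limit:
  assumes "uniform_limit (ball 2 (1/2)) f g sequentially" "\<And>n::nat. alternating_at_2 (f n)"
    and "g holomorphic_on ball 2 1"
  shows "alternating_at_2 g"
  unfolding alternating_at_2_def
proof (intro conjI allI)
  fix j
  have "(\<lambda>n. (deriv ^^ j) (f n) 2) \<longlonglongrightarrow> (deriv ^^ j) g 2"
  proof (rule higher_deriv_complex_uniform_limit[OF assms(1)])
    have "ball (2::complex) (1/2) \<subseteq> ball 2 1" by auto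
    thus "\<forall>\<^sub>F n in sequentially. f n holomorphic_on ball 2 (1/2)"
      using assms(2) unfolding alternating_at_2_def by (meson always_eventually holomorphic_on_subset)
  qed auto
  hence "(\<lambda>n. (-1) ^ j * (deriv ^^ j) (f n) 2) \<longlonglongrightarrow> (-1) ^ j * (deriv ^^ j) g 2"
    by (intro tendsto_mult tendsto_const)
  thus "(-1) ^ j * (deriv ^^ j) g 2 \<in> \<real>\<^sub>\<ge>\<^sub>0"
    by (rule Lim_in_closed_set[OF closed_nonneg_Reals_complex, rotated 2])
       (use assms(2) in \<open>auto simp: alternating_at_2_def\<close>)
qed fact

lemma alternating_at_2_powr:
  assumes "c \<ge> 0" "n \<ge> 1"
  shows "alternating_at_2 (\<lambda>s. of_real c * of_nat n powr (-s))"
  unfolding alternating_at_2_def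
proof (intro conjI allI)
  have n: "of_nat n \<noteq> (0::complex)" using assms by simp
  show "(\<lambda>s. of_real c * of_nat n powr (-s)) holomorphic_on ball 2 1"
    using n by (intro holomorphic_intros) auto
  have ln: "Ln (of_nat n) = of_real (ln (real n))"
    using Ln_of_real[of "real n"] assms by simp
  have d: "(deriv ^^ j) (\<lambda>s::complex. of_real c * of_nat n powr (-s)) = (\<lambda>s. of_real ((-ln (real n)) ^ j * c) * of_nat n powr (-s))" for j
  proof (induction j)
    case (Suc j)
    have "deriv (\<lambda>s. of_real ((-ln (real n)) ^ j * c) * of_nat n powr (-s)) s = of_real ((-ln (real n)) ^ Suc j * c) * of_nat n powr (-s)" for s :: complex
    proof (rule DERIV_imp_deriv)
      have "((\<lambda>s. of_nat n powr (-s)) has_field_derivative (Ln (of_nat n) * of_nat n powr (-s)) * (-1 :: complex)) (at (s :: complex))"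
        by (rule DERIV_chain2[OF has_field_derivative_powr_right[OF n]]) (auto intro!: derivative_eq_intros)
      from DERIV_cmult[OF this, of "of_real ((-ln (real n)) ^ j * c)"]
      show "((\<lambda>s. of_real ((-ln (real n)) ^ j * c) * of_nat n powr (-s)) has_field_derivative
        of_real ((-ln (real n)) ^ Suc j * c) * of_nat n powr (-s)) (at s)"
        unfolding ln by (simp add: algebra_simps)
    qed
    thus ?case by (simp add: Suc del: of_real_mult power_Suc)
  qed auto
  fix j
  have "(-1) ^ j * (deriv ^^ j) (\<lambda>s. of_real c * of_nat n powr (-s)) (2::complex)
      = of_real ((-1) ^ j * (-ln (real n)) ^ j * c * real n powr (-2))"
    unfolding d using powr_of_real[of "real n" "-2"] by simp
  also have "(-1) ^ j * (-ln (real n)) ^ j = ln (real n) ^ j"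
    by (simp add: power_mult_distrib[symmetric])
  finally show "(-1) ^ j * (deriv ^^ j) (\<lambda>s. of_real c * of_nat n powr (-s)) (2::complex) \<in> \<real>\<^sub>\<ge>\<^sub>0"
    using assms by (simp del: of_real_mult of_real_power)
qed

lemma of_nat_power_powr: "of_nat (n ^ m) powr s = (of_nat n powr s) ^ m" for s :: complex
proof (induction m)
  case (Suc m)
  thus ?case unfolding power_Suc of_nat_mult_powr by simp
qed simp

lemma in_ball_2_Re: "s \<in> ball 2 r \<Longrightarrow> Re s > 2 - r"
  using abs_Re_le_cmod[of "2 - s"] by (auto simp: dist_norm)

context completely_multiplicative
begin

lemma holomorphic_Ln_h:
  assumes "prime n" shows "(\<lambda>s. Ln (1 - h s n)) holomorphic_on {s. Re s \<ge> 1/2}"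
proof (intro holomorphic_intros holomorphic_h)
  fix s assume "s \<in> {s. Re s \<ge> 1/2}"
  hence "norm (h s n) \<le> 3/4" using assms by (intro norm_h_prime_le) auto
  hence "Re (1 - h s n) > 0" using complex_Re_le_cmod[of "h s n"] by simp
  thus "1 - h s n \<notin> \<real>\<^sub>\<le>\<^sub>0" by (auto simp: complex_nonpos_Reals_iff)
qed

lemma holomorphic_prime_log: "prime_log holomorphic_on {s. Re s > 1}"
  unfolding prime_log_def
proof (rule holomorphic_on_suminf)
  show "open {s. Re s > 1}" by (rule open_halfspace_Re_gt)
  show "(\<lambda>s. if prime n then -Ln (1 - h s n) else 0) holomorphic_on {s. Re s > 1}" for n
  proof (cases "prime n")
    case True
    have "(\<lambda>s. Ln (1 - h s n)) holomorphic_on {s. Re s > 1}"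
      by (rule holomorphic_on_subset[OF holomorphic_Ln_h[OF True]]) auto
    thus ?thesis using True by (simp add: holomorphic_on_minus)
  qed simp
  fix z :: complex assume z: "z \<in> {s. Re s > 1}"
  define d where "d = (Re z - 1) / 2"
  have d: "d > 0" using z by (simp add: d_def)
  have re: "Re w \<ge> 1 + d" if "w \<in> cball z d" for w
    using that abs_Re_le_cmod[of "z - w"] by (auto simp: dist_norm d_def field_simps abs_if split: if_splits)
  have "summable (\<lambda>n. 4 * real n powr (-(1+d)))"
    using d by (intro summable_mult) (simp add: summable_real_powr_iff)
  moreover have "norm (if prime n then -Ln (1 - h w n) else 0) \<le> 4 * real n powr (-(1+d))" if w: "w \<in> cball z d" for w n
  proof (cases "prime n")
    case True
    have "norm (-Ln (1 - h w n)) \<le> 4 * norm (h w n)"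
      using True re[OF w] d by (intro norm_Ln_minus_le norm_h_prime_le) auto
    also have "\<dots> \<le> 4 * real n powr (-Re w)" using norm_h_le by simp
    also have "\<dots> \<le> 4 * real n powr (-(1+d))"
      using re[OF w] prime_ge_1_nat[OF True] by (intro mult_left_mono powr_mono) auto
    finally show ?thesis using True by simp
  qed auto
  moreover have "cball z d \<subseteq> {s. Re s > 1}" using re d by fastforce
  ultimately show "\<exists>d>0. \<exists>M. cball z d \<subseteq> {s. Re s > 1} \<and> summable M \<and>
      (\<forall>n. \<forall>w\<in>cball z d. norm (if prime n then -Ln (1 - h w n) else 0) \<le> M n)"
    using d by blast
qed

text \<open>The contribution of squares and higher powers of primes to log L. Its terms are O(p^(-2
  Re s)), so it is holomorphic right of 1/2, and the sum over the primes alone inherits the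
  continuation of log L.\<close>

definition prime_square_part :: "complex \<Rightarrow> complex" where
  "prime_square_part s = (\<Sum>n. if prime n then -Ln (1 - h s n) - h s n else 0)"

lemma prime_square_part_term:
  assumes "Re s \<ge> 1/2" "prime n"
  shows "norm (-Ln (1 - h s n) - h s n) \<le> 4 * real n powr (-2 * Re s)"
proof -
  have "norm (-Ln (1 - h s n) - h s n) \<le> 4 * norm (h s n) ^ 2"
    using assms by (intro norm_minus_Ln_minus_le norm_h_prime_le)
  also have "\<dots> \<le> 4 * (real n powr (-Re s)) ^ 2" using norm_h_le by (intro mult_left_mono power_mono) auto
  also have "(real n powr (-Re s)) ^ 2 = real n powr (-2 * Re s)"
    by (simp add: power2_eq_square powr_add[symmetric])
  finally show ?thesis .
qed

lemma holomorphic_prime_square_part: "prime_square_part holomorphic_on {s. Re s > 1/2}"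
  unfolding prime_square_part_def
proof (rule holomorphic_on_suminf)
  show "open {s. Re s > 1/2}" by (rule open_halfspace_Re_gt)
  show "(\<lambda>s. if prime n then -Ln (1 - h s n) - h s n else 0) holomorphic_on {s. Re s > 1/2}" for n
  proof (cases "prime n")
    case True
    have "(\<lambda>s. Ln (1 - h s n)) holomorphic_on {s. Re s > 1/2}"
      by (rule holomorphic_on_subset[OF holomorphic_Ln_h[OF True]]) auto
    from holomorphic_on_diff[OF holomorphic_on_minus[OF this] holomorphic_h[of n]] show ?thesis using True by simp
  qed simp
  fix z :: complex assume z: "z \<in> {s. Re s > 1/2}"
  define d where "d = (Re z - 1/2) / 2"
  have d: "d > 0" using z by (simp add: d_def)
  have re: "Re w \<ge> 1/2 + d" if "w \<in> cball z d" for w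
    using that abs_Re_le_cmod[of "z - w"] by (auto simp: dist_norm d_def field_simps abs_if split: if_splits)
  have "summable (\<lambda>n. 4 * real n powr (-2 * (1/2+d)))"
    using d by (intro summable_mult) (simp add: summable_real_powr_iff)
  moreover have "norm (if prime n then -Ln (1 - h w n) - h w n else 0) \<le> 4 * real n powr (-2 * (1/2+d))" if w: "w \<in> cball z d" for w n
  proof (cases "prime n")
    case True
    have "norm (-Ln (1 - h w n) - h w n) \<le> 4 * real n powr (-2 * Re w)"
      using True re[OF w] d by (intro prime_square_part_term) auto
    also have "\<dots> \<le> 4 * real n powr (-2 * (1/2+d))"
    proof (rule mult_left_mono)
      show "real n powr (-2 * Re w) \<le> real n powr (-2 * (1/2+d))"
        by (rule powr_mono) (use re[OF w] prime_ge_1_nat[OF True] in auto)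
    qed auto
    finally show ?thesis using True by simp
  qed auto
  moreover have "cball z d \<subseteq> {s. Re s > 1/2}" using re d by fastforce
  ultimately show "\<exists>d>0. \<exists>M. cball z d \<subseteq> {s. Re s > 1/2} \<and> summable M \<and>
      (\<forall>n. \<forall>w\<in>cball z d. norm (if prime n then -Ln (1 - h w n) - h w n else 0) \<le> M n)"
    using d by blast
qed

lemma norm_prime_square_part:
  assumes "Re s \<ge> 3/4" shows "norm (prime_square_part s) \<le> 4 * zeta32"
proof -
  have bd: "norm (if prime n then -Ln (1 - h s n) - h s n else 0) \<le> 4 * real n powr (-3/2)" for n
  proof (cases "prime n")
    case True
    have "norm (-Ln (1 - h s n) - h s n) \<le> 4 * real n powr (-2 * Re s)"
      using True assms by (intro prime_square_part_term) auto
    also have "\<dots> \<le> 4 * real n powr (-3/2)"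
      using assms prime_ge_1_nat[OF True] by (intro mult_left_mono powr_mono) auto
    finally show ?thesis using True by simp
  qed auto
  have sm: "summable (\<lambda>n. real n powr (-3/2))" by (simp add: summable_real_powr_iff)
  have "norm (prime_square_part s) \<le> (\<Sum>n. 4 * real n powr (-3/2))"
    unfolding prime_square_part_def by (rule norm_suminf_le[OF bd summable_mult[OF sm]])
  also have "\<dots> = 4 * zeta32"
    unfolding zeta32_def using suminf_mult[OF sm, of 4] suminf_split_head[OF sm] by simp
  finally show ?thesis .
qed

lemma prime_series:
  assumes "Re s > 1"
  shows "(\<lambda>n. if prime n then h s n else 0) sums (prime_log s - prime_square_part s)"
proof -
  have "summable (\<lambda>n. norm (if prime n then h s n else 0))"
    by (rule summable_comparison_test'[OF summable_norm_h[OF assms], of 0]) auto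
  hence "summable (\<lambda>n. if prime n then h s n else 0)" by (rule summable_norm_cancel)
  from summable_diff[OF sums_summable[OF prime_log_sums(1)[OF assms]] this]
  have "summable (\<lambda>n. if prime n then -Ln (1 - h s n) - h s n else 0)"
    by (rule summable_cong[THEN iffD1, rotated]) (auto intro!: always_eventually)
  hence "(\<lambda>n. if prime n then -Ln (1 - h s n) - h s n else 0) sums prime_square_part s"
    unfolding prime_square_part_def by (rule summable_sums)
  from sums_diff[OF prime_log_sums(1)[OF assms] this]
  show ?thesis by (rule sums_cong[THEN iffD1, rotated]) auto
qed

lemma norm_prime_log_le:
  assumes "Re s \<ge> 3/2" shows "norm (prime_log s) \<le> 4 * zeta32"
proof -
  have sm: "summable (\<lambda>n. real n powr (-3/2))" by (simp add: summable_real_powr_iff)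
  have bd: "norm (if prime n then real n powr (-Re s) else 0) \<le> real n powr (-3/2)" for n
    using assms prime_ge_1_nat[of n] by (cases "prime n") (auto intro!: powr_mono)
  have "norm (prime_log s) \<le> 4 * (\<Sum>n. if prime n then real n powr (-Re s) else 0)"
    using assms by (intro prime_log_sums) auto
  also have "(\<Sum>n. if prime n then real n powr (-Re s) else 0) \<le> (\<Sum>n. real n powr (-3/2))"
    using norm_suminf_le[OF bd sm] by simp
  also have "\<dots> = zeta32"
    unfolding zeta32_def using suminf_split_head[OF sm] by simp
  finally show ?thesis by simp
qed

text \<open>Landau's argument: \<open>log (\<zeta> L)\<close> has a Dirichlet series with nonnegative coefficients, so its
  Taylor series at 2, if it converges up to \<open>1/2\<close>, dominates the sum of \<open>1 / (2 p\<^sup>2\<^sup>s)\<close> there, and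
  this sum is unbounded as \<open>s\<close> tends to \<open>1/2\<close>.\<close>

lemma landau:
  assumes real: "\<And>n. f n = 0 \<or> f n = 1 \<or> f n = -1"
    and hol: "H holomorphic_on {s. Re s > 1/2}"
    and H: "\<And>s. Re s > 1 \<Longrightarrow> H s = trivial.prime_log s + prime_log s"
    and bd: "\<And>x. 1/2 < x \<Longrightarrow> x < 1 \<Longrightarrow> Re (H (of_real x)) \<le> K"
  shows False
proof -
  from sum_prime_reciprocals_unbounded[of "2 * K"] obtain S where
    S: "finite S" "\<And>p. p \<in> S \<Longrightarrow> prime p" "(\<Sum>p\<in>S. 1 / real p) > 2 * K" by blast
  \<comment> \<open>The square terms p^(-2s) / 2 of the finitely many primes in S; they are taken
    out of the Euler factors and collected in \<open>E\<close>.\<close>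
  define e where "e = (\<lambda>n s. if n \<in> S then (of_nat (n ^ 2) powr (-s) / 2 :: complex) else 0)"
  define E where "E = (\<lambda>s. \<Sum>n\<in>S. of_nat (n ^ 2) powr (-s) / 2 :: complex)"
  define t where "t = (\<lambda>n s. if prime n then -Ln (1 - trivial.h s n) - Ln (1 - h s n) - e n s else 0)"
  have S0: "n \<noteq> 0" if "n \<in> S" for n using S(2)[OF that] by auto
  have alt_t: "alternating_at_2 (t n)" for n
  proof (cases "prime n")
    case True
    \<comment> \<open>Coefficient of n^(-ms) in the sum of the two logarithms. At m = 2 it is (1 +
      f(n)^2) / 2, at least 1/2 even where f vanishes, so it stays nonnegative after the removal of
      1/2.\<close>
    define c where "c = (\<lambda>m. (1 + Re (f n) ^ m) / real m - (if n \<in> S \<and> m = 2 then 1/2 else 0))"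
    have fn: "of_real (Re (f n)) = f n" "\<bar>Re (f n)\<bar> \<le> 1" using real[of n] by auto
    have c0: "c m \<ge> 0" for m
    proof (cases "m = 2")
      case False
      have "\<bar>Re (f n) ^ m\<bar> \<le> 1" using fn by (simp add: power_abs power_le_one)
      hence "1 + Re (f n) ^ m \<ge> 0" by linarith
      thus ?thesis using False by (simp add: c_def)
    qed (auto simp: c_def)
    have c3: "\<bar>c m\<bar> \<le> 3" for m
    proof (cases "m = 0")
      case False
      have "\<bar>Re (f n) ^ m\<bar> \<le> 1" using fn by (simp add: power_abs power_le_one)
      hence "(1 + Re (f n) ^ m) / real m \<le> 2 / 1" using False by (intro frac_le) auto
      moreover have "c m \<le> (1 + Re (f n) ^ m) / real m" by (simp add: c_def)
      ultimately show ?thesis using c0[of m] by linarith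
    qed (auto simp: c_def)
    let ?g = "\<lambda>m s. of_real (c m) * of_nat (n ^ m) powr (-s) :: complex"
    have n2: "real n \<ge> 2" using prime_ge_2_nat[OF True] by simp
    have small: "norm (of_nat n powr (-s) :: complex) \<le> 1/2" if "Re s \<ge> 1" for s
    proof -
      have "norm (of_nat n powr (-s) :: complex) = real n powr (-Re s)" using n2 by (subst norm_of_nat_powr) auto
      also have "\<dots> \<le> real n powr (-1)" using n2 that by (intro powr_mono) auto
      also have "\<dots> \<le> 1/2" using n2 by (simp add: powr_minus field_simps)
      finally show ?thesis .
    qed
    have sums: "(\<lambda>m. ?g m s) sums t n s" if s: "Re s \<ge> 1" for s
    proof -
      have 1: "norm (trivial.h s n) < 1" using small[OF s] by (simp add: trivial.h_def)
      have 2: "norm (h s n) < 1" using mult_mono[OF le1[of n] small[OF s]] unfolding h_def norm_mult by simp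
      have 3: "(\<lambda>m. if m = 2 then e n s else 0) sums e n s" by (rule sums_single)
      from sums_diff[OF sums_add[OF Ln_one_minus_sums[OF 1] Ln_one_minus_sums[OF 2]] 3]
      have "(\<lambda>m. trivial.h s n ^ m / of_nat m + h s n ^ m / of_nat m - (if m = 2 then e n s else 0)) sums t n s"
        using True by (simp add: t_def)
      moreover have "trivial.h s n ^ m / of_nat m + h s n ^ m / of_nat m - (if m = 2 then e n s else 0) = ?g m s" for m
      proof -
        have cm: "(of_real (c m) :: complex) = (1 + f n ^ m) / of_nat m - (if n \<in> S \<and> m = 2 then 1/2 else 0)"
          unfolding c_def by (simp add: fn(1))
        define X where "X = (of_nat n powr (-s) :: complex)"
        have X: "trivial.h s n = X" "h s n = f n * X" "e n s = (if n \<in> S then X ^ 2 / 2 else 0)"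
          "of_nat (n ^ m) powr (-s) = X ^ m"
          unfolding X_def e_def of_nat_power_powr trivial.h_def h_def by auto
        show ?thesis unfolding cm X
          by (cases "m = 2"; cases "n \<in> S"; simp add: power_mult_distrib algebra_simps add_divide_distrib)
      qed
      ultimately show ?thesis by simp
    qed
    show ?thesis
    proof (rule alternating_at_2_limit[where f = "\<lambda>M s. \<Sum>m<M. ?g m s"])
      have "uniform_limit (ball 2 (1/2)) (\<lambda>M s. \<Sum>m<M. ?g m s) (\<lambda>s. \<Sum>m. ?g m s) sequentially"
      proof (rule Weierstrass_m_test)
        fix m s assume "s \<in> ball (2::complex) (1/2)"
        hence "Re s \<ge> 1" using in_ball_2_Re[of s "1/2"] by simp
        hence "norm (of_nat n powr (-s) :: complex) ^ m \<le> (1/2) ^ m" by (intro power_mono small) auto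
        thus "norm (?g m s) \<le> 3 * (1/2) ^ m" using c3[of m]
          unfolding norm_mult of_nat_power_powr norm_power norm_of_real by (intro mult_mono) auto
      next
        show "summable (\<lambda>m. 3 * (1/2::real) ^ m)" by (intro summable_mult summable_geometric) auto
      qed
      also have "?this \<longleftrightarrow> uniform_limit (ball 2 (1/2)) (\<lambda>M s. \<Sum>m<M. ?g m s) (t n) sequentially"
      proof (rule uniform_limit_cong')
        fix s assume "s \<in> ball (2::complex) (1/2)"
        hence "Re s \<ge> 1" using in_ball_2_Re[of s "1/2"] by simp
        from sums[OF this] show "(\<Sum>m. ?g m s) = t n s" by (simp add: sums_iff)
      qed auto
      finally show "uniform_limit (ball 2 (1/2)) (\<lambda>M s. \<Sum>m<M. ?g m s) (t n) sequentially" .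
      show "alternating_at_2 (\<lambda>s. \<Sum>m<M. ?g m s)" for M
        using n2 c0 by (intro alternating_at_2_sum alternating_at_2_powr) auto
      have sub: "ball 2 1 \<subseteq> {s. Re s \<ge> 1/2}" using in_ball_2_Re[of _ 1] by fastforce
      have "e n holomorphic_on A" for A unfolding e_def
        by (cases "n \<in> S") (use S0 in \<open>auto intro!: holomorphic_intros\<close>)
      thus "t n holomorphic_on ball 2 1"
        using True holomorphic_on_subset[OF holomorphic_Ln_h[OF True] sub] holomorphic_on_subset[OF trivial.holomorphic_Ln_h[OF True] sub]
        unfolding t_def by (auto intro!: holomorphic_intros)
    qed
  qed (auto simp: t_def alternating_at_2_0)
  have E_sums: "(\<lambda>n. e n s) sums E s" for s
    unfolding e_def E_def by (rule sums_If_finite_set[OF S(1)])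
  have eP: "e n s = (if prime n then e n s else 0)" for n s using S(2)[of n] by (auto simp: e_def)
  have t_sums: "(\<lambda>n. t n s) sums (H s - E s)" if s: "Re s > 1" for s
  proof -
    from sums_diff[OF sums_add[OF trivial.prime_log_sums(1)[OF s] prime_log_sums(1)[OF s]] E_sums[of s]]
    have "(\<lambda>n. (if prime n then -Ln (1 - trivial.h s n) else 0) + (if prime n then -Ln (1 - h s n) else 0) - e n s) sums (H s - E s)"
      using H[OF s] by simp
    thus ?thesis by (rule sums_cong[THEN iffD1, rotated]) (subst eP, simp add: t_def)
  qed
  have E_hol: "E holomorphic_on A" for A
    unfolding E_def using S0 by (auto intro!: holomorphic_intros)
  have alt: "alternating_at_2 (\<lambda>s. H s - E s)"
  proof (rule alternating_at_2_limit[where f = "\<lambda>N s. \<Sum>n<N. t n s"])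
    show "alternating_at_2 (\<lambda>s. \<Sum>n<N. t n s)" for N by (intro alternating_at_2_sum alt_t)
    show "(\<lambda>s. H s - E s) holomorphic_on ball 2 1"
      by (intro holomorphic_intros E_hol holomorphic_on_subset[OF hol]) (use in_ball_2_Re[of _ 1] in fastforce)
    have "uniform_limit (ball 2 (1/2)) (\<lambda>N s. \<Sum>n<N. t n s) (\<lambda>s. \<Sum>n. t n s) sequentially"
    proof (rule Weierstrass_m_test)
      fix n s assume "s \<in> ball (2::complex) (1/2)"
      hence s: "Re s \<ge> 3/2" using in_ball_2_Re[of s "1/2"] by simp
      show "norm (t n s) \<le> 9 * real n powr (-3/2)"
      proof (cases "prime n")
        case True
        have n1: "real n \<ge> 1" using prime_ge_1_nat[OF True] by simp
        have P: "real n powr (-Re s) \<le> real n powr (-3/2)" using n1 s by (intro powr_mono) auto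
        have "norm (-Ln (1 - trivial.h s n)) \<le> 4 * norm (trivial.h s n)"
          using True s by (intro norm_Ln_minus_le trivial.norm_h_prime_le) auto
        also have "\<dots> \<le> 4 * real n powr (-Re s)" using trivial.norm_h_le by simp
        finally have 1: "norm (-Ln (1 - trivial.h s n)) \<le> 4 * real n powr (-3/2)" using P by linarith
        have "norm (-Ln (1 - h s n)) \<le> 4 * norm (h s n)"
          using True s by (intro norm_Ln_minus_le norm_h_prime_le) auto
        also have "\<dots> \<le> 4 * real n powr (-Re s)" using norm_h_le by simp
        finally have 2: "norm (-Ln (1 - h s n)) \<le> 4 * real n powr (-3/2)" using P by linarith
        have "norm (of_nat (n ^ 2) powr (-s) :: complex) = (real n powr (-Re s)) ^ 2"
          unfolding of_nat_power_powr norm_power using n1 norm_of_nat_powr[of n "-s"] by simp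
        also have "\<dots> \<le> (real n powr (-Re s)) ^ 1"
          using n1 s powr_mono[of "-Re s" 0 "real n"] by (intro power_decreasing) auto
        finally have "norm (of_nat (n ^ 2) powr (-s) / 2 :: complex) \<le> real n powr (-3/2)"
          using P norm_ge_zero[of "of_nat (n ^ 2) powr (-s) :: complex"] unfolding norm_divide norm_numeral power_one_right by linarith
        hence 3: "norm (e n s) \<le> real n powr (-3/2)" by (simp add: e_def del: of_nat_power)
        have "norm (t n s) \<le> norm (-Ln (1 - trivial.h s n)) + norm (-Ln (1 - h s n)) + norm (e n s)"
          using True unfolding t_def by (smt (verit) norm_minus_cancel norm_triangle_ineq4)
        thus ?thesis using 1 2 3 by linarith
      qed (auto simp: t_def)
    next
      show "summable (\<lambda>n. 9 * real n powr (-3/2))" by (intro summable_mult) (simp add: summable_real_powr_iff)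
    qed
    also have "?this \<longleftrightarrow> uniform_limit (ball 2 (1/2)) (\<lambda>N s. \<Sum>n<N. t n s) (\<lambda>s. H s - E s) sequentially"
    proof (rule uniform_limit_cong')
      fix s assume "s \<in> ball (2::complex) (1/2)"
      hence "Re s > 1" using in_ball_2_Re[of s "1/2"] by simp
      from t_sums[OF this] show "(\<Sum>n. t n s) = H s - E s" by (simp add: sums_iff)
    qed auto
    finally show "uniform_limit (ball 2 (1/2)) (\<lambda>N s. \<Sum>n<N. t n s) (\<lambda>s. H s - E s) sequentially" .
  qed
  have lower: "(\<Sum>p\<in>S. real p powr (-2 * x) / 2) \<le> K" if x: "1/2 < x" "x < 1" for x
  proof -
    \<comment> \<open>The disc of radius 3/2 about 2 fits into the half-plane where H is
      holomorphic. At a real x below 2 all terms of the Taylor series are nonnegative, hence Re E(x)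
      \<le> Re H(x).\<close>
    have "(\<lambda>n. (deriv ^^ n) (\<lambda>s. H s - E s) 2 / fact n * (of_real x - 2) ^ n) sums (H (of_real x) - E (of_real x))"
    proof (rule holomorphic_power_series[where r = "3/2"])
      show "(\<lambda>s. H s - E s) holomorphic_on ball 2 (3/2)"
        by (intro holomorphic_intros E_hol holomorphic_on_subset[OF hol]) (use in_ball_2_Re[of _ "3/2"] in fastforce)
      have "dist 2 (of_real x :: complex) = \<bar>2 - x\<bar>"
        by (metis dist_norm norm_of_real of_real_diff of_real_numeral)
      thus "of_real x \<in> ball (2::complex) (3/2)" using x by simp
    qed
    from sums_Re[OF this] have S': "(\<lambda>n. Re ((deriv ^^ n) (\<lambda>s. H s - E s) 2 / fact n * (of_real x - 2) ^ n)) sums Re (H (of_real x) - E (of_real x))" .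
    have "Re ((deriv ^^ n) (\<lambda>s. H s - E s) 2 / fact n * (of_real x - 2) ^ n) \<ge> 0" for n
    proof -
      have "(-1) ^ n * (deriv ^^ n) (\<lambda>s. H s - E s) 2 \<in> \<real>\<^sub>\<ge>\<^sub>0" using alt by (simp add: alternating_at_2_def)
      then obtain r where r: "(-1) ^ n * (deriv ^^ n) (\<lambda>s. H s - E s) 2 = of_real r" "r \<ge> 0"
        by (auto elim: nonneg_Reals_cases)
      have "(of_real x - 2 :: complex) ^ n = (-1) ^ n * of_real ((2 - x) ^ n)"
        by (simp flip: power_mult_distrib)
      hence "(deriv ^^ n) (\<lambda>s. H s - E s) 2 / fact n * (of_real x - 2) ^ n = of_real (r / fact n * (2 - x) ^ n)"
        using r(1) by (simp add: field_simps)
      thus ?thesis using r(2) x by (simp only: Re_complex_of_real) simp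
    qed
    from suminf_nonneg[OF sums_summable[OF S'] this] S' have "Re (E (of_real x)) \<le> Re (H (of_real x))" by (simp add: sums_iff)
    also have "\<dots> \<le> K" by (rule bd[OF x])
    also have "E (of_real x) = of_real (\<Sum>p\<in>S. real p powr (-2 * x) / 2)"
      unfolding E_def of_real_sum
    proof (rule sum.cong[OF refl])
      fix p assume "p \<in> S"
      hence p: "real (p ^ 2) > 0" using S0[of p] by simp
      have "of_nat (p ^ 2) powr (-of_real x) = (of_real (real (p ^ 2) powr (-x)) :: complex)"
        using powr_of_real[of "real (p ^ 2)" "-x"] p by simp
      also have "real (p ^ 2) powr (-x) = real p powr (-2 * x)"
        using p by (simp add: powr_powr powr_numeral[symmetric] del: powr_numeral)
      finally show "of_nat (p ^ 2) powr (-of_real x) / 2 = (of_real (real p powr (-2 * x) / 2) :: complex)" by simp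
    qed
    finally show ?thesis by simp
  qed
  \<comment> \<open>In the limit x = 1/2 the terms become 1 / (2p), and S was chosen so that their
    sum exceeds K.\<close>
  have "((\<lambda>x. \<Sum>p\<in>S. real p powr (-2 * x) / 2) \<longlongrightarrow> (\<Sum>p\<in>S. real p powr (-2 * (1/2)) / 2)) (at_right (1/2))"
    using S0 by (intro tendsto_intros) auto
  moreover have "eventually (\<lambda>x. (\<Sum>p\<in>S. real p powr (-2 * x) / 2) \<le> K) (at_right (1/2::real))"
    using lower by (intro eventually_mono[OF eventually_at_right_real[of "1/2" 1]]) auto
  ultimately have "(\<Sum>p\<in>S. real p powr (-2 * (1/2)) / 2) \<le> K"
    by (intro tendsto_upperbound) auto
  also have "(\<Sum>p\<in>S. real p powr (-2 * (1/2)) / 2) = (\<Sum>p\<in>S. 1 / real p) / 2"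
    unfolding sum_divide_distrib using S0 by (intro sum.cong) (auto simp: powr_minus field_simps)
  finally show False using S(3) by simp
qed

end

section \<open>Branches of the logarithm and their growth\<close>

text \<open>A nowhere vanishing holomorphic function on a convex set has a logarithm. On Re s > 1
  its difference from l has exponential 1, hence derivative 0, so subtracting one constant selects
  the branch given by the Euler product.\<close>

lemma normalized_log:
  assumes P: "P holomorphic_on {s. Re s > 1/2}" "\<And>s. Re s > 1/2 \<Longrightarrow> P s \<noteq> 0"
    and l: "l holomorphic_on {s. Re s > 1}" "\<And>s. Re s > 1 \<Longrightarrow> exp (l s) = P s"
  obtains H where "H holomorphic_on {s. Re s > 1/2}" "\<And>s. Re s > 1/2 \<Longrightarrow> exp (H s) = P s"
    "\<And>s. Re s > 1 \<Longrightarrow> H s = l s"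
proof -
  obtain g where g: "g holomorphic_on {s. Re s > 1/2}" "\<And>s. s \<in> {s. Re s > 1/2} \<Longrightarrow> exp (g s) = P s"
    by (rule holomorphic_logarithm_exists[of "{s. Re s > 1/2}" P 1])
       (use P open_halfspace_Re_gt[of "1/2"] convex_halfspace_Re_gt[of "1/2"] in auto)
  have dh: "(\<lambda>s. g s - l s) holomorphic_on {s. Re s > 1}"
    by (intro holomorphic_intros l holomorphic_on_subset[OF g(1)]) auto
  have e1: "exp (g s - l s) = 1" if "Re s > 1" for s
    using g(2)[of s] l(2)[of s] P(2)[of s] that by (simp add: exp_diff)
  have const: "g s - l s = g 2 - l 2" if "Re s > 1" for s
  proof (rule has_field_derivative_zero_constant[of "{s. Re s > 1}" "\<lambda>s. g s - l s", THEN exE])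
    show "convex {s. Re s > 1}" by (rule convex_halfspace_Re_gt)
    fix z assume z: "z \<in> {s. Re s > 1}"
    have op: "open {s. Re s > 1}" by (rule open_halfspace_Re_gt)
    have d: "((\<lambda>s. g s - l s) has_field_derivative deriv (\<lambda>s. g s - l s) z) (at z)"
      by (rule holomorphic_derivI[OF dh op z])
    hence "((\<lambda>s. exp (g s - l s)) has_field_derivative exp (g z - l z) * deriv (\<lambda>s. g s - l s) z) (at z)"
      by (rule DERIV_fun_exp)
    moreover have "((\<lambda>s. exp (g s - l s)) has_field_derivative 0) (at z)"
      by (rule has_field_derivative_transform_within_open[OF DERIV_const op z]) (use e1 in auto)
    ultimately have "exp (g z - l z) * deriv (\<lambda>s. g s - l s) z = 0" by (rule DERIV_unique)
    with d show "((\<lambda>s. g s - l s) has_field_derivative 0) (at z within {s. Re s > 1})"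
      by (auto intro: has_field_derivative_at_within)
  next
    fix c assume "\<forall>z\<in>{s. Re s > 1}. g z - l z = c"
    thus "g s - l s = g 2 - l 2" using that by simp
  qed
  show thesis
  proof (rule that[of "\<lambda>s. g s - (g 2 - l 2)"])
    show "(\<lambda>s. g s - (g 2 - l 2)) holomorphic_on {s. Re s > 1/2}" by (intro holomorphic_intros g)
    show "exp (g s - (g 2 - l 2)) = P s" if "Re s > 1/2" for s
      using g(2)[of s] e1[of 2] that by (simp add: exp_diff)
    show "g s - (g 2 - l 2) = l s" if "Re s > 1" for s using const[OF that] by (simp add: algebra_simps)
  qed
qed

text \<open>The map w / (2M - w) sends the half-plane Re w < M into the unit disc and fixes 0.
  Schwarz's lemma bounds the image, and solving back for w gives the estimate.\<close>

lemma borel_caratheodory: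
  assumes hol: "H holomorphic_on ball c R" and R: "R > 0"
    and M: "\<And>z. z \<in> ball c R \<Longrightarrow> Re (H z) < Re (H c) + M"
    and z: "norm (z - c) \<le> r * R" and r: "0 \<le> r" "r < 1"
  shows "norm (H z - H c) \<le> 2 * M * r / (1 - r)"
proof -
  have M0: "M > 0" using M[of c] R by simp
  define g where "g = (\<lambda>w. H (c + of_real R * w) - H c)"
  define \<phi> where "\<phi> = (\<lambda>w. g w / (of_real (2 * M) - g w))"
  have inb: "c + of_real R * w \<in> ball c R" if "norm w < 1" for w
    using that R by (simp add: dist_norm norm_mult)
  have gRe: "Re (g w) < M" if "norm w < 1" for w using M[OF inb[OF that]] by (simp add: g_def)
  have nz: "of_real (2 * M) - g w \<noteq> 0" if "norm w < 1" for w
  proof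
    assume "of_real (2 * M) - g w = 0"
    hence "Re (g w) = 2 * M" by (metis Re_complex_of_real eq_iff_diff_eq_0)
    thus False using gRe[OF that] M0 by simp
  qed
  have ghol: "g holomorphic_on ball 0 1"
    unfolding g_def
    by (intro holomorphic_intros holomorphic_on_compose_gen[OF _ hol, unfolded o_def]) (use inb in auto)
  have "norm (\<phi> \<xi>) \<le> norm \<xi>" if \<xi>: "norm \<xi> < 1" for \<xi>
  proof (rule Schwarz_Lemma(1))
    show "\<phi> holomorphic_on ball 0 1" unfolding \<phi>_def using nz by (intro holomorphic_intros ghol) auto
    show "\<phi> 0 = 0" by (simp add: \<phi>_def g_def)
    fix w :: complex assume w: "norm w < 1"
    have "norm (g w) ^ 2 < norm (of_real (2 * M) - g w) ^ 2"
    proof -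
      have "(2 * M - Re (g w))\<^sup>2 = (Re (g w))\<^sup>2 + 4 * M * (M - Re (g w))" by (simp add: power2_eq_square algebra_simps)
      moreover have "4 * M * (M - Re (g w)) > 0" using M0 gRe[OF w] by simp
      ultimately show ?thesis by (simp add: cmod_power2)
    qed
    hence "norm (g w) < norm (of_real (2 * M) - g w)" by (rule power_less_imp_less_base) simp
    thus "norm (\<phi> w) < 1" using nz[OF w] by (simp add: \<phi>_def norm_divide)
  qed (use \<xi> in auto)
  moreover define w where "w = (z - c) / of_real R"
  have w: "norm w \<le> r" using z R by (simp add: w_def norm_divide field_simps)
  ultimately have "norm (\<phi> w) \<le> r" using r by (meson le_less_trans order_trans)
  have w1: "norm w < 1" using w r by simp
  have "norm (g w) = norm (\<phi> w) * norm (of_real (2 * M) - g w)"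
    using nz[OF w1] by (simp add: \<phi>_def norm_divide)
  also have "\<dots> \<le> r * (2 * M + norm (g w))"
    using \<open>norm (\<phi> w) \<le> r\<close> r M0 norm_triangle_ineq4[of "of_real (2 * M)" "g w"] by (intro mult_mono) auto
  finally have "norm (g w) * (1 - r) \<le> 2 * M * r" by (simp add: algebra_simps)
  hence "norm (g w) \<le> 2 * M * r / (1 - r)" using r by (simp add: field_simps)
  moreover have "g w = H z - H c" using R by (simp add: g_def w_def)
  ultimately show ?thesis by simp
qed

text \<open>A polynomial bound for exp H bounds Re H from above, and Borel-Caratheodory turns this
  into a bound for H. The point is that B, which will carry the conductor, enters only as ln
  B.\<close>

lemma log_growth:
  assumes hol: "H holomorphic_on {s. Re s > 1/2}"
    and P: "\<And>s. Re s > 1/2 \<Longrightarrow> norm (exp (H s)) \<le> B * (1 + norm s) ^ 2" and B: "B \<ge> 1"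
    and D: "\<And>s. Re s = 2 \<Longrightarrow> norm (H s) \<le> D * (1 + norm s)"
    and s: "3/4 \<le> Re s" "Re s \<le> 1"
  shows "norm (H s) \<le> (100 + 44 * D + 10 * ln B) * (1 + norm s)"
proof -
  define c where "c = Complex 2 (Im s)"
  have D0: "D \<ge> 0"
  proof -
    have "0 \<le> D * (1 + norm c)" using D[of c] norm_ge_zero[of "H c"] by (simp add: c_def del: norm_ge_zero)
    thus ?thesis by (smt (verit) mult_neg_pos norm_ge_zero)
  qed
  have sc: "norm (s - c) \<le> 5/4"
  proof -
    have "s - c = of_real (Re s - 2)" by (simp add: c_def complex_eq_iff)
    hence "norm (s - c) = \<bar>Re s - 2\<bar>" by (simp only: norm_of_real)
    thus ?thesis using s by simp
  qed
  have nc: "norm c \<le> norm s + 5/4" using sc norm_triangle_ineq[of s "c - s"] by (simp add: norm_minus_commute)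
  have Hc: "norm (H c) \<le> D * (3 + norm s)"
  proof -
    have "norm (H c) \<le> D * (1 + norm c)" by (rule D) (simp add: c_def)
    also have "\<dots> \<le> D * (3 + norm s)" using nc D0 by (intro mult_left_mono) auto
    finally show ?thesis .
  qed
  define M where "M = ln B + 2 * (3 + norm s) + D * (3 + norm s) + 1"
  have "norm (H s - H c) \<le> 2 * M * (5/6) / (1 - 5/6)"
  \<comment> \<open>The disc of radius 3/2 about c = 2 + i Im s reaches the line Re z = 1/2. The
    point s, with Re s \<ge> 3/4, is within 5/4 = 5/6 * 3/2 of c.\<close>
  proof (rule borel_caratheodory[where R = "3/2" and H = H and c = c and z = s and r = "5/6" and M = M])
    show "H holomorphic_on ball c (3/2)"
    proof (rule holomorphic_on_subset[OF hol], rule subsetI)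
      fix z assume "z \<in> ball c (3/2)"
      thus "z \<in> {s. Re s > 1/2}" using abs_Re_le_cmod[of "c - z"] by (auto simp: dist_norm c_def)
    qed
    show "norm (s - c) \<le> 5/6 * (3/2)" using sc by simp
    fix z assume z: "z \<in> ball c (3/2)"
    hence rez: "Re z > 1/2" using abs_Re_le_cmod[of "c - z"] by (auto simp: dist_norm c_def)
    have nz: "norm z \<le> norm s + 3" using z nc norm_triangle_ineq[of c "z - c"] by (auto simp: dist_norm norm_minus_commute)
    have pos: "B * (1 + norm z) ^ 2 > 0" by (rule mult_pos_pos[OF _ zero_less_power[OF add_pos_nonneg[OF zero_less_one norm_ge_zero]]]) (use B in simp)
    have "exp (Re (H z)) = norm (exp (H z))" by simp
    also have "\<dots> \<le> B * (1 + norm z) ^ 2" by (rule P[OF rez])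
    also have "\<dots> = exp (ln (B * (1 + norm z) ^ 2))" using pos by (subst exp_ln) auto
    finally have "Re (H z) \<le> ln (B * (1 + norm z) ^ 2)" by simp
    also have "\<dots> = ln B + ln ((1 + norm z) ^ 2)"
      by (rule ln_mult_pos[OF _ zero_less_power[OF add_pos_nonneg[OF zero_less_one norm_ge_zero]]]) (use B in simp)
    also have "ln ((1 + norm z) ^ 2) = 2 * ln (1 + norm z)"
      by (simp add: ln_realpow)
    also have "ln (1 + norm z) \<le> norm z" by (rule ln_add_one_self_le_self) simp
    finally have "Re (H z) \<le> ln B + 2 * (3 + norm s)" using nz by simp
    moreover have "Re (H c) \<ge> - (D * (3 + norm s))" using Hc abs_Re_le_cmod[of "H c"] by linarith
    ultimately show "Re (H z) < Re (H c) + M" by (simp add: M_def)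
  qed auto
  hence "norm (H s) \<le> norm (H c) + 10 * M" using norm_triangle_ineq[of "H c" "H s - H c"] by simp
  also have "\<dots> \<le> D * (3 + norm s) + 10 * M" using Hc by simp
  also have "\<dots> = 10 * ln B + 20 * (3 + norm s) + 11 * (D * (3 + norm s)) + 10" by (simp add: M_def algebra_simps)
  also have "\<dots> \<le> 10 * ln B * (1 + norm s) + 100 * (1 + norm s) + 44 * D * (1 + norm s)"
  proof -
    have "10 * ln B * 1 \<le> 10 * ln B * (1 + norm s)" using B by (intro mult_left_mono) auto
    moreover have "11 * (D * (3 + norm s)) \<le> 44 * D * (1 + norm s)"
      using D0 mult_nonneg_nonneg[OF D0 norm_ge_zero[of s]] by (simp add: algebra_simps)
    moreover have "20 * (3 + norm s) + 10 \<le> 100 * (1 + norm s)" by simp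
    ultimately show ?thesis by linarith
  qed
  finally show ?thesis by (simp add: algebra_simps)
qed

subsection \<open>Newman's contour argument\<close>

lemma powr_mean_value:
  fixes x y r :: real
  assumes "0 < x" "x < y"
  obtains \<xi> where "x < \<xi>" "\<xi> < y" "y powr r - x powr r = (y - x) * (r * \<xi> powr (r - 1))"
proof -
  have "\<exists>\<xi>. x < \<xi> \<and> \<xi> < y \<and> y powr r - x powr r = (y - x) * (r * \<xi> powr (r - 1))"
    by (rule MVT2[OF assms(2)]) (use assms in \<open>auto intro!: has_real_derivative_powr\<close>)
  thus ?thesis using that by blast
qed

lemma tail_powr_bound:
  assumes x: "x > 0" and N: "N \<ge> 1"
  shows "summable (\<lambda>n. real (Suc (n + N)) powr (-1 - x))"
    and "(\<Sum>n. real (Suc (n + N)) powr (-1 - x)) \<le> real N powr (-x) / x"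
proof -
  let ?u = "\<lambda>n. real (n + N) powr (-x) / x"
  have le: "real (Suc (n + N)) powr (-1 - x) \<le> ?u n - ?u (Suc n)" for n
  proof -
    have pos: "0 < real (n + N)" "real (n + N) < real (Suc (n + N))" using N by auto
    obtain \<xi> where \<xi>: "real (n + N) < \<xi>" "\<xi> < real (Suc (n + N))"
      "real (Suc (n + N)) powr (-x) - real (n + N) powr (-x) = (real (Suc (n + N)) - real (n + N)) * (-x * \<xi> powr (-x - 1))"
      by (rule powr_mean_value[OF pos])
    have "?u n - ?u (Suc n) = \<xi> powr (-x - 1)"
      using \<xi>(3) x by (simp add: field_simps)
    also have "\<dots> \<ge> real (Suc (n + N)) powr (-x - 1)"
      using \<xi> pos x by (intro powr_mono2') auto
    also have "-x - 1 = -1 - x" by simp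
    finally show ?thesis .
  qed
  have "(\<lambda>n. real (n + N) powr (-x)) \<longlonglongrightarrow> 0"
    using x filterlim_real_sequentially
    by (intro tendsto_neg_powr filterlim_compose[OF filterlim_real_sequentially filterlim_add_const_nat_at_top]) auto
  hence "?u \<longlonglongrightarrow> 0 / x" by (intro tendsto_divide tendsto_const) (use x in auto)
  hence "?u \<longlonglongrightarrow> 0" by simp
  from telescope_sums'[OF this] have T: "(\<lambda>n. ?u n - ?u (Suc n)) sums (real N powr (-x) / x)" by simp
  show S: "summable (\<lambda>n. real (Suc (n + N)) powr (-1 - x))"
    by (rule summable_comparison_test'[OF sums_summable[OF T], of 0]) (use le in auto)
  show "(\<Sum>n. real (Suc (n + N)) powr (-1 - x)) \<le> real N powr (-x) / x"
    using suminf_le[OF le S sums_summable[OF T]] T by (simp add: sums_iff)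
qed

text \<open>For x \<le> 1 the summand decreases and each term is compared with the increment of n^x
  / x before it. For x > 1 it increases, the comparison is with the increment after it, and the last
  term is split off; this term is the origin of 1/N.\<close>

lemma partial_powr_bound:
  assumes x: "x > 0" and N: "N \<ge> 1"
  shows "(\<Sum>n<N. real (Suc n) powr (x - 1)) \<le> real N powr x * (1 / x + 1 / real N)"
proof (cases "x \<le> 1")
  case True
  have "(\<Sum>n<N. real (Suc n) powr (x - 1)) \<le> real N powr x / x"
  proof (induction N)
    case (Suc N)
    have "real (Suc N) powr (x - 1) \<le> (real (Suc N) powr x - real N powr x) / x"
    proof (cases "N = 0")
      case True thus ?thesis using x \<open>x \<le> 1\<close> by (simp add: field_simps)
    next
      case False
      hence pos: "0 < real N" "real N < real (Suc N)" by auto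
      obtain \<xi> where \<xi>: "real N < \<xi>" "\<xi> < real (Suc N)"
        "real (Suc N) powr x - real N powr x = (real (Suc N) - real N) * (x * \<xi> powr (x - 1))"
        by (rule powr_mean_value[OF pos])
      have "real (Suc N) powr (x - 1) \<le> \<xi> powr (x - 1)"
        using \<xi> pos True by (intro powr_mono2') auto
      thus ?thesis using \<xi>(3) x by simp
    qed
    thus ?case using Suc by (simp add: diff_divide_distrib)
  qed simp
  also have "\<dots> \<le> real N powr x * (1 / x + 1 / real N)" by (simp add: distrib_left)
  finally show ?thesis .
next
  case False
  obtain M where M: "N = Suc M" using N by (cases N) auto
  have "(\<Sum>n<M. real (Suc n) powr (x - 1)) \<le> real (Suc M) powr x / x"
  proof (induction M)
    case (Suc M)
    have pos: "0 < real (Suc M)" "real (Suc M) < real (Suc (Suc M))" by auto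
    obtain \<xi> where \<xi>: "real (Suc M) < \<xi>" "\<xi> < real (Suc (Suc M))"
      "real (Suc (Suc M)) powr x - real (Suc M) powr x = (real (Suc (Suc M)) - real (Suc M)) * (x * \<xi> powr (x - 1))"
      by (rule powr_mean_value[OF pos])
    have "real (Suc M) powr (x - 1) \<le> \<xi> powr (x - 1)"
      using \<xi> pos False by (intro powr_mono2) auto
    hence "real (Suc M) powr (x - 1) \<le> (real (Suc (Suc M)) powr x - real (Suc M) powr x) / x" using \<xi>(3) x by simp
    thus ?case using Suc by (simp add: diff_divide_distrib)
  qed (use x in simp)
  moreover have "real N powr (x - 1) = real N powr x * (1 / real N)" using N by (simp add: powr_diff)
  ultimately show ?thesis unfolding M by (simp add: distrib_left)
qed

text \<open>Cauchy's formula for the rectangle with abscissas -l and R. Its horizontal sides are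
  split at the imaginary axis: on the right the difference of two integrands will be estimated, on
  the left each one separately and with its own l.\<close>

lemma rect_integral:
  fixes g :: "complex \<Rightarrow> complex"
  assumes l: "0 < l" and R: "0 < R" and U: "convex U" "open U" and g: "g holomorphic_on U"
    and sub: "\<And>z. -l \<le> Re z \<Longrightarrow> Re z \<le> R \<Longrightarrow> \<bar>Im z\<bar> \<le> R \<Longrightarrow> z \<in> U"
  defines "k \<equiv> (\<lambda>z. g z / z)"
  defines "I \<equiv> (\<lambda>a b. contour_integral (linepath a b) k)"
  shows "I (Complex 0 (-R)) (Complex R (-R)) + I (Complex R (-R)) (Complex R R) + I (Complex R R) (Complex 0 R)
       + (I (Complex 0 R) (Complex (-l) R) + I (Complex (-l) R) (Complex (-l) (-R)) + I (Complex (-l) (-R)) (Complex 0 (-R)))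
       = 2 * pi * \<i> * g 0"
proof -
  let ?a = "Complex (-l) (-R)" and ?b = "Complex R (-R)" and ?c = "Complex R R" and ?d = "Complex (-l) R"
  have cont: "continuous_on (closed_segment x y) k" if "closed_segment x y \<subseteq> U - {0}" for x y
    unfolding k_def using that
    by (intro continuous_intros holomorphic_on_imp_continuous_on holomorphic_on_subset[OF g]) auto
  have segs: "closed_segment ?a ?b \<subseteq> U - {0}" "closed_segment ?b ?c \<subseteq> U - {0}"
    "closed_segment ?c ?d \<subseteq> U - {0}" "closed_segment ?d ?a \<subseteq> U - {0}"
    using l R by (auto simp: closed_segment_same_Im closed_segment_same_Re closed_segment_eq_real_ivl
        intro!: sub split: if_splits)
  have h: "(k has_contour_integral I x y) (linepath x y)" if "closed_segment x y \<subseteq> U - {0}" for x y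
    unfolding I_def by (intro has_contour_integral_integral contour_integrable_continuous_linepath cont that)
  have "(k has_contour_integral (I ?a ?b + (I ?b ?c + (I ?c ?d + I ?d ?a)))) (rectpath ?a ?c)"
    unfolding rectpath_def Let_def complex.sel
    by (intro has_contour_integral_join h segs valid_path_join) auto
  moreover have "(k has_contour_integral (2 * pi * \<i> * winding_number (rectpath ?a ?c) 0 * g 0)) (rectpath ?a ?c)"
  proof -
    have "((\<lambda>w. g w / (w - 0)) has_contour_integral (2 * pi * \<i> * winding_number (rectpath ?a ?c) 0 * g 0)) (rectpath ?a ?c)"
    proof (rule Cauchy_integral_formula_convex_simple[OF U(1) g])
      show "0 \<in> interior U" using U(2) sub[of 0] l R by (simp add: interior_open)
      show "path_image (rectpath ?a ?c) \<subseteq> U - {0}"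
        using segs unfolding rectpath_def Let_def complex.sel by (simp add: path_image_join)
    qed auto
    thus ?thesis by (simp add: k_def)
  qed
  moreover have "winding_number (rectpath ?a ?c) 0 = 1"
    using l R by (intro winding_number_rectpath) (auto simp: in_box_complex_iff)
  ultimately have "I ?a ?b + (I ?b ?c + (I ?c ?d + I ?d ?a)) = 2 * pi * \<i> * g 0"
    using has_contour_integral_unique by fastforce
  moreover have "I ?a ?b = I ?a (Complex 0 (-R)) + I (Complex 0 (-R)) ?b" unfolding I_def
    using l R by (intro contour_integral_split_linepath cont segs)
      (auto simp: closed_segment_same_Im closed_segment_eq_real_ivl)
  moreover have "I ?c ?d = I ?c (Complex 0 R) + I (Complex 0 R) ?d" unfolding I_def
    using l R by (intro contour_integral_split_linepath cont segs)
      (auto simp: closed_segment_same_Im closed_segment_eq_real_ivl)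
  ultimately show ?thesis by (simp add: algebra_simps)
qed

lemma linepath_integral_bound:
  assumes "continuous_on (closed_segment a b) k" "B \<ge> 0" "norm (b - a) \<le> L"
    and "\<And>z. z \<in> closed_segment a b \<Longrightarrow> norm (k z) \<le> B"
  shows "norm (contour_integral (linepath a b) k) \<le> B * L"
proof -
  have "norm (contour_integral (linepath a b) k) \<le> B * norm (b - a)"
    using assms by (intro contour_integral_bound_linepath contour_integrable_continuous_linepath) auto
  also have "\<dots> \<le> B * L" using assms by (intro mult_left_mono)
  finally show ?thesis .
qed

text \<open>If (Im z)^2 = R^2, then R^2 + z^2 = Re z (Re z + 2i Im z). The resulting factor (Re z)^2
  outweighs the 1 / |Re z| in the truncation errors.\<close>

lemma norm_kernel_edge:
  assumes "\<bar>Im z\<bar> = R" "\<bar>Re z\<bar> \<le> R" "R > 0"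
  shows "norm ((1 + z ^ 2 / of_real R ^ 2) ^ 2) \<le> (3 * \<bar>Re z\<bar> / R) ^ 2"
proof -
  have im: "(Im z)\<^sup>2 = R\<^sup>2" using assms(1) by (metis power2_abs)
  have "1 + z ^ 2 / of_real R ^ 2 = of_real (Re z / R ^ 2) * (of_real (Re z) + 2 * \<i> * of_real (Im z))"
  proof -
    have "z ^ 2 = of_real ((Re z)\<^sup>2 - (Im z)\<^sup>2) + 2 * \<i> * of_real (Re z * Im z)"
      by (simp add: complex_eq_iff power2_eq_square)
    hence "of_real R ^ 2 + z ^ 2 = of_real (Re z) * (of_real (Re z) + 2 * \<i> * of_real (Im z))"
      unfolding im by (simp add: power2_eq_square algebra_simps)
    moreover have "1 + z ^ 2 / of_real R ^ 2 = (of_real R ^ 2 + z ^ 2) / of_real R ^ 2"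
      using assms by (simp add: add_divide_distrib)
    ultimately show ?thesis by simp
  qed
  hence "norm (1 + z ^ 2 / of_real R ^ 2) = \<bar>Re z\<bar> / R ^ 2 * norm (of_real (Re z) + 2 * \<i> * of_real (Im z))"
    by (simp add: norm_mult norm_divide norm_power)
  also have "\<dots> \<le> \<bar>Re z\<bar> / R ^ 2 * (3 * R)"
  proof (rule mult_left_mono)
    have "norm (of_real (Re z) + 2 * \<i> * of_real (Im z)) \<le> norm (of_real (Re z) :: complex) + norm (2 * \<i> * of_real (Im z))"
      by (rule norm_triangle_ineq)
    also have "\<dots> = \<bar>Re z\<bar> + 2 * \<bar>Im z\<bar>" by (simp add: norm_mult)
    finally show "norm (of_real (Re z) + 2 * \<i> * of_real (Im z)) \<le> 3 * R" using assms by simp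
  qed auto
  also have "\<dots> = 3 * \<bar>Re z\<bar> / R" using assms by (simp add: power2_eq_square field_simps)
  finally show ?thesis unfolding norm_power by (intro power_mono) auto
qed

lemma norm_kernel_le:
  assumes "\<bar>Re z\<bar> \<le> R" "\<bar>Im z\<bar> \<le> R" "R > 0"
  shows "norm ((1 + z ^ 2 / of_real R ^ 2) ^ 2) \<le> 9"
proof -
  have "norm z ^ 2 \<le> R\<^sup>2 + R\<^sup>2" unfolding cmod_power2
    using assms by (intro add_mono abs_le_square_iff[THEN iffD1]) auto
  hence "norm z ^ 2 / R ^ 2 \<le> 2" using assms by (simp add: field_simps)
  hence "norm (z ^ 2 / of_real R ^ 2) \<le> 2" using assms by (simp add: norm_divide norm_power)
  hence "norm (1 + z ^ 2 / of_real R ^ 2) \<le> 3" using norm_triangle_ineq[of 1 "z ^ 2 / of_real R ^ 2"] by simp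
  hence "norm (1 + z ^ 2 / of_real R ^ 2) ^ 2 \<le> 3 ^ 2" by (intro power_mono) auto
  thus ?thesis by (simp add: norm_power)
qed

text \<open>Newman's contour argument in quantitative form: the truncated series is compared with its
  analytic continuation on rectangles of size \<open>R = N\<^sup>1\<^sup>/\<^sup>1\<^sup>6\<close>. The double zero of the
  factor \<open>(1 + z\<^sup>2/R\<^sup>2)\<^sup>2\<close> at \<open>\<plusminus>\<i>R\<close> absorbs the growth of the
  truncation errors near the line \<open>Re z = 0\<close>.\<close>

theorem newman_quantitative:
  fixes a :: "nat \<Rightarrow> complex"
  assumes a: "\<And>n. norm (a n) \<le> 1"
    and F: "\<And>s. Re s > 1 \<Longrightarrow> (\<lambda>n. a n * of_nat (Suc n) powr (-s)) sums F s"
    and hol: "F holomorphic_on {s. Re s > 1/2}"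
    and bd: "\<And>s. 3/4 \<le> Re s \<Longrightarrow> Re s \<le> 1 \<Longrightarrow> norm (F s) \<le> M * (1 + norm s) ^ 2" and M: "M \<ge> 1"
    and N: "N \<ge> 1"
  shows "norm ((\<Sum>n<N. a n / of_nat (Suc n)) - F 1) \<le> 1300 * M * real N powr (-1/16)"
proof -
  define R where "R = real N powr (1/16)"
  have R: "R \<ge> 1" unfolding R_def using N by (intro ge_one_powr_ge_zero) auto
  have RN: "R \<le> real N"
  proof -
    have "real N powr (1/16) \<le> real N powr 1" using N by (intro powr_mono) auto
    thus ?thesis using N by (simp add: R_def)
  qed
  have R1: "real N powr (-1/16) = 1 / R" by (simp add: R_def powr_minus field_simps)
  \<comment> \<open>Origin of the exponent 1/16: on the left edge Re z = -1/4 the weight N^z has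
    size R^(-4), which against the growth R^2 of f and the length 2R of the edge still leaves
    1/R.\<close>
  have R3: "real N powr (-1/4) = 1 / R ^ 4"
  proof -
    have "R ^ 4 = real N powr (1/4)" unfolding R_def using N by (simp add: powr_power)
    thus ?thesis by (simp add: powr_minus field_simps)
  qed
  define f where "f = (\<lambda>z. F (1 + z))"
  define S where "S = (\<lambda>z. \<Sum>n<N. a n * of_nat (Suc n) powr (-(1 + z)))"
  define K where "K = (\<lambda>z. (1 + z ^ 2 / of_real R ^ 2) ^ 2 :: complex)"
  define E where "E = (\<lambda>z. of_nat N powr z :: complex)"
  have nE: "norm (E z) = real N powr Re z" for z using N by (simp add: E_def norm_of_nat_powr)
  have fhol: "f holomorphic_on {z. Re z > -1/2}"
    unfolding f_def
    by (intro holomorphic_on_compose_gen[OF _ hol, unfolded o_def] holomorphic_intros) auto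
  have Shol: "S holomorphic_on A" for A
    unfolding S_def by (intro holomorphic_intros) (auto simp del: of_nat_Suc)
  have EKhol: "(\<lambda>z. E z * K z) holomorphic_on A" for A
    unfolding E_def K_def using N R by (intro holomorphic_intros) auto
  define g1 where "g1 = (\<lambda>z. f z * (E z * K z) / z)"
  define g2 where "g2 = (\<lambda>z. S z * (E z * K z) / z)"
  define I where "I = (\<lambda>g a b. contour_integral (linepath a b) (g :: complex \<Rightarrow> complex))"
  \<comment> \<open>f is holomorphic only for Re z > -1/2 and bounded only from -1/4 on, so its
    contour stops there. The partial sum S is entire, and its left edge is moved to -R, where S(z)
    N^z is O(1/R).\<close>
  note I1 = rect_integral[where l = "1/4" and R = R and U = "{z. Re z > -1/2}" and g = "\<lambda>z. f z * (E z * K z)"]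
  note I2 = rect_integral[where l = R and R = R and U = UNIV and g = "\<lambda>z. S z * (E z * K z)"]
  have E0: "E 0 * K 0 = 1" using N by (simp add: E_def K_def)
  let ?A = "Complex 0 (-R)" and ?B = "Complex R (-R)" and ?C = "Complex R R" and ?D = "Complex 0 R"
  let ?P = "Complex (-1/4) R" and ?Q = "Complex (-1/4) (-R)" and ?P' = "Complex (-R) R" and ?Q' = "Complex (-R) (-R)"
  have 1: "I g1 ?A ?B + I g1 ?B ?C + I g1 ?C ?D + (I g1 ?D ?P + I g1 ?P ?Q + I g1 ?Q ?A) = 2 * pi * \<i> * f 0"
  proof -
    have "(\<lambda>z. f z * (E z * K z)) holomorphic_on {z. Re z > -1/2}"
      by (intro holomorphic_intros fhol EKhol)
    from I1[OF _ _ convex_halfspace_Re_gt open_halfspace_Re_gt this] show ?thesis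
      using R E0 by (simp add: g1_def I_def)
  qed
  have 2: "I g2 ?A ?B + I g2 ?B ?C + I g2 ?C ?D + (I g2 ?D ?P' + I g2 ?P' ?Q' + I g2 ?Q' ?A) = 2 * pi * \<i> * S 0"
  proof -
    have "(\<lambda>z. S z * (E z * K z)) holomorphic_on UNIV" by (intro holomorphic_intros Shol EKhol)
    from I2[OF _ _ convex_UNIV open_UNIV this] show ?thesis
      using R E0 by (simp add: g2_def I_def)
  qed
  have cont1: "continuous_on X g1" if "X \<subseteq> {z. Re z > -1/2} - {0}" for X
    unfolding g1_def using that
    by (intro continuous_on_divide continuous_on_mult holomorphic_on_imp_continuous_on holomorphic_on_subset[OF fhol] EKhol continuous_on_id) auto
  have cont2: "continuous_on X g2" if "X \<subseteq> - {0}" for X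
    unfolding g2_def using that
    by (intro continuous_on_divide continuous_on_mult holomorphic_on_imp_continuous_on Shol EKhol continuous_on_id) auto
  have seg: "closed_segment (Complex x y) (Complex x' y) = {z. Im z = y \<and> Re z \<in> closed_segment x x'}"
     "closed_segment (Complex x y) (Complex x y') = {z. Re z = x \<and> Im z \<in> closed_segment y y'}" for x x' y y'
    by (simp_all add: closed_segment_same_Im closed_segment_same_Re)
  have nz: "1 / norm z \<le> 1 / R" if "\<bar>Re z\<bar> = R \<or> \<bar>Im z\<bar> = R" for z :: complex
    using that R abs_Re_le_cmod[of z] abs_Im_le_cmod[of z] by (intro frac_le) auto
  \<comment> \<open>The tail of the series is O(N^(-Re z) / Re z), and the weight N^z cancels the
    power of N.\<close>
  have right: "norm ((f z - S z) * E z) \<le> 1 / Re z" if z: "Re z > 0" for z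
  proof -
    have "(\<lambda>n. a n * of_nat (Suc n) powr (-(1 + z))) sums f z" unfolding f_def using z by (intro F) auto
    hence "(\<lambda>n. a (n + N) * of_nat (Suc (n + N)) powr (-(1 + z))) sums (f z - S z)"
      unfolding S_def by (subst sums_iff_shift) simp
    moreover have "norm (a (n + N) * of_nat (Suc (n + N)) powr (-(1 + z))) \<le> real (Suc (n + N)) powr (-1 - Re z)" for n
    proof -
      have "norm (of_nat (Suc (n + N)) powr (-(1 + z)) :: complex) = real (Suc (n + N)) powr (-1 - Re z)"
        by (subst norm_of_nat_powr) auto
      thus ?thesis using mult_right_mono[OF a[of "n + N"], of "real (Suc (n + N)) powr (-1 - Re z)"]
        unfolding norm_mult by simp
    qed
    ultimately have "norm (f z - S z) \<le> (\<Sum>n. real (Suc (n + N)) powr (-1 - Re z))"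
      using norm_suminf_le[OF _ tail_powr_bound(1)[OF z N]] by (metis (no_types, lifting) sums_unique)
    also have "\<dots> \<le> real N powr (-Re z) / Re z" by (rule tail_powr_bound(2)[OF z N])
    finally have "norm (f z - S z) * real N powr Re z \<le> real N powr (-Re z) / Re z * real N powr Re z"
      by (rule mult_right_mono) auto
    also have "\<dots> = 1 / Re z" using N by (simp add: powr_minus)
    finally show ?thesis by (simp add: norm_mult nE)
  qed
  have left: "norm (S z * E z) \<le> 1 / \<bar>Re z\<bar> + 1 / R" if z: "Re z < 0" for z
  proof -
    define x where "x = -Re z"
    have x: "x > 0" using z by (simp add: x_def)
    have "norm (S z) \<le> (\<Sum>n<N. real (Suc n) powr (x - 1))"
      unfolding S_def
    proof (rule sum_norm_le)
      fix n
      have "norm (of_nat (Suc n) powr (-(1 + z)) :: complex) = real (Suc n) powr Re (-(1 + z))"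
        by (rule norm_of_nat_powr) simp
      also have "Re (-(1 + z)) = x - 1" by (simp add: x_def)
      finally have "norm (of_nat (Suc n) powr (-(1 + z)) :: complex) = real (Suc n) powr (x - 1)" .
      thus "norm (a n * of_nat (Suc n) powr (-(1 + z))) \<le> real (Suc n) powr (x - 1)"
        using mult_right_mono[OF a[of n], of "real (Suc n) powr (x - 1)"] unfolding norm_mult by simp
    qed
    also have "\<dots> \<le> real N powr x * (1 / x + 1 / real N)" by (rule partial_powr_bound[OF x N])
    finally have "norm (S z) * real N powr (-x) \<le> real N powr x * (1 / x + 1 / real N) * real N powr (-x)"
      by (rule mult_right_mono) auto
    also have "\<dots> = 1 / x + 1 / real N" using N by (simp add: powr_minus)
    also have "1 / real N \<le> 1 / R" using RN R by (intro divide_left_mono) auto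
    finally show ?thesis using x by (simp add: norm_mult nE x_def)
  qed
  have hyp1: "norm (f z) \<le> 16 * M * R ^ 2" if "-1/4 \<le> Re z" "Re z \<le> 0" "\<bar>Im z\<bar> \<le> R" for z
  proof -
    have "norm z \<le> \<bar>Re z\<bar> + \<bar>Im z\<bar>" by (rule cmod_le)
    hence "norm (1 + z) \<le> 1 + 1/4 + R" using that norm_triangle_ineq[of 1 z] by simp
    hence "1 + norm (1 + z) \<le> 4 * R" using R by simp
    hence "(1 + norm (1 + z)) ^ 2 \<le> (4 * R) ^ 2" by (intro power_mono) auto
    hence "M * (1 + norm (1 + z)) ^ 2 \<le> M * (4 * R) ^ 2" using M by (intro mult_left_mono) auto
    moreover have "norm (f z) \<le> M * (1 + norm (1 + z)) ^ 2" unfolding f_def using that by (intro bd) auto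
    ultimately show ?thesis by (simp add: power_mult_distrib)
  qed
  \<comment> \<open>The tail bound requires Re z > 0. At the corner on the imaginary axis the kernel
    vanishes, and with it both integrands.\<close>
  have horiz_right: "norm (g1 z - g2 z) \<le> 9 / R ^ 2" if z: "\<bar>Im z\<bar> = R" "0 \<le> Re z" "Re z \<le> R" for z
  proof (cases "Re z = 0")
    case True
    have "K z = 0" using norm_kernel_edge[of z R] z R True unfolding K_def by simp
    thus ?thesis by (simp add: g1_def g2_def)
  next
    case False
    hence pos: "Re z > 0" using z by simp
    have "norm (g1 z - g2 z) = norm ((f z - S z) * E z) * norm (K z) * (1 / norm z)"
      unfolding g1_def g2_def by (simp add: norm_mult[symmetric] norm_divide[symmetric] algebra_simps diff_divide_distrib)
    also have "\<dots> \<le> (1 / Re z) * (3 * \<bar>Re z\<bar> / R) ^ 2 * (1 / R)"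
      using right[OF pos] norm_kernel_edge[of z R] z R nz[of z] unfolding K_def
      by (intro mult_mono) auto
    also have "\<dots> = 9 * Re z / R ^ 3" using pos R by (simp add: power2_eq_square power3_eq_cube field_simps)
    also have "\<dots> \<le> 9 * R / R ^ 3" using z R by (intro divide_right_mono) auto
    also have "\<dots> = 9 / R ^ 2" using R by (simp add: power2_eq_square power3_eq_cube)
    finally show ?thesis .
  qed
  have vert_right: "norm (g1 z - g2 z) \<le> 9 / R ^ 2" if z: "\<bar>Im z\<bar> \<le> R" "Re z = R" for z
  proof -
    have pos: "Re z > 0" using z R by simp
    have "norm (g1 z - g2 z) = norm ((f z - S z) * E z) * norm (K z) * (1 / norm z)"
      unfolding g1_def g2_def by (simp add: norm_mult[symmetric] norm_divide[symmetric] algebra_simps diff_divide_distrib)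
    also have "\<dots> \<le> (1 / Re z) * 9 * (1 / R)"
      using right[OF pos] norm_kernel_le[of z R] z R nz[of z] unfolding K_def
      by (intro mult_mono) auto
    also have "\<dots> = 9 / R ^ 2" using z by (simp add: power2_eq_square)
    finally show ?thesis .
  qed
  have horiz_left: "norm (g2 z) \<le> 18 / R ^ 2" if z: "\<bar>Im z\<bar> = R" "-R \<le> Re z" "Re z \<le> 0" for z
  proof (cases "Re z = 0")
    case True
    have "K z = 0" using norm_kernel_edge[of z R] z R True unfolding K_def by simp
    thus ?thesis by (simp add: g2_def)
  next
    case False
    hence neg: "Re z < 0" using z by simp
    define x where "x = \<bar>Re z\<bar>"
    have x: "0 < x" "x \<le> R" using neg z by (auto simp: x_def)
    have "norm (g2 z) = norm (S z * E z) * norm (K z) * (1 / norm z)"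
      unfolding g2_def by (simp add: norm_mult norm_divide)
    also have "\<dots> \<le> (1 / x + 1 / R) * (3 * x / R) ^ 2 * (1 / R)"
    proof (intro mult_mono)
      show "norm (S z * E z) \<le> 1 / x + 1 / R" using left[OF neg] by (simp add: x_def)
      show "norm (K z) \<le> (3 * x / R) ^ 2"
        unfolding K_def x_def by (rule norm_kernel_edge) (use z R in auto)
      show "1 / norm z \<le> 1 / R" using nz z by auto
    qed (use x R in auto)
    also have "(1 / x + 1 / R) * (3 * x / R) ^ 2 * (1 / R) = 9 * x * (x + R) / R ^ 4"
      using x R by (simp add: field_simps eval_nat_numeral)
    also have "\<dots> \<le> 9 * R * (R + R) / R ^ 4"
      using x R by (intro divide_right_mono mult_mono) auto
    also have "\<dots> = 18 / R ^ 2" using R by (simp add: field_simps eval_nat_numeral)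
    finally show ?thesis .
  qed
  have vert_left: "norm (g2 z) \<le> 18 / R ^ 2" if z: "\<bar>Im z\<bar> \<le> R" "Re z = -R" for z
  proof -
    have neg: "Re z < 0" using z R by simp
    have "norm (g2 z) = norm (S z * E z) * norm (K z) * (1 / norm z)"
      unfolding g2_def by (simp add: norm_mult norm_divide)
    also have "\<dots> \<le> (1 / \<bar>Re z\<bar> + 1 / R) * 9 * (1 / R)"
      using left[OF neg] norm_kernel_le[of z R] z R nz[of z] unfolding K_def
      by (intro mult_mono) auto
    also have "\<dots> = 18 / R ^ 2" using z R by (simp add: power2_eq_square field_simps)
    finally show ?thesis .
  qed
  have horiz_f: "norm (g1 z) \<le> 16 * M / R" if z: "\<bar>Im z\<bar> = R" "-1/4 \<le> Re z" "Re z \<le> 0" for z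
  proof -
    have "norm (K z) \<le> (3 * \<bar>Re z\<bar> / R) ^ 2" unfolding K_def using z R by (intro norm_kernel_edge) auto
    also have "\<dots> \<le> (1 / R) ^ 2" using z R by (intro power_mono divide_right_mono) auto
    finally have k: "norm (K z) \<le> (1 / R) ^ 2" .
    have e: "norm (E z) \<le> 1" unfolding nE using z N powr_mono[of "Re z" 0 "real N"] by simp
    have "norm (g1 z) = norm (f z) * (norm (E z) * norm (K z)) * (1 / norm z)"
      unfolding g1_def by (simp add: norm_mult norm_divide)
    also have "\<dots> \<le> (16 * M * R ^ 2) * (1 * (1 / R) ^ 2) * (1 / R)"
      using hyp1[of z] k e z M nz[of z] R by (intro mult_mono) auto
    also have "\<dots> = 16 * M / R" using R by (simp add: power2_eq_square)
    finally show ?thesis .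
  qed
  have vert_f: "norm (g1 z) \<le> 576 * M / R ^ 2" if z: "\<bar>Im z\<bar> \<le> R" "Re z = -1/4" for z
  proof -
    have k: "norm (K z) \<le> 9" unfolding K_def using z R by (intro norm_kernel_le) auto
    have e: "norm (E z) = 1 / R ^ 4" unfolding nE z R3[symmetric] by simp
    have "1 / norm z \<le> 1 / (1/4)" using abs_Re_le_cmod[of z] z by (intro frac_le) auto
    hence "1 / norm z \<le> 4" by simp
    hence "norm (f z) * (norm (E z) * norm (K z)) * (1 / norm z) \<le> (16 * M * R ^ 2) * (1 / R ^ 4 * 9) * 4"
      using hyp1[of z] k e z M R by (intro mult_mono) auto
    also have "\<dots> = 576 * M / R ^ 2" using R by (simp add: field_simps eval_nat_numeral)
    finally show ?thesis unfolding g1_def by (simp add: norm_mult norm_divide)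
  qed
  have dI: "I g1 x y - I g2 x y = I (\<lambda>z. g1 z - g2 z) x y" if "closed_segment x y \<subseteq> {z. Re z > -1/2} - {0}" for x y
  proof -
    have "closed_segment x y \<subseteq> - {0}" using that by auto
    thus ?thesis unfolding I_def
      using contour_integral_diff[OF contour_integrable_continuous_linepath[OF cont1[OF that]] contour_integrable_continuous_linepath[OF cont2]]
      by simp
  qed
  have cont12: "continuous_on (closed_segment x y) (\<lambda>z. g1 z - g2 z)" if "closed_segment x y \<subseteq> {z. Re z > -1/2} - {0}" for x y
    using that by (intro continuous_on_diff cont1 cont2) auto
  have sAB: "closed_segment ?A ?B \<subseteq> {z. Re z > -1/2} - {0}" and sBC: "closed_segment ?B ?C \<subseteq> {z. Re z > -1/2} - {0}"
    and sCD: "closed_segment ?C ?D \<subseteq> {z. Re z > -1/2} - {0}" and sDP: "closed_segment ?D ?P \<subseteq> {z. Re z > -1/2} - {0}"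
    and sPQ: "closed_segment ?P ?Q \<subseteq> {z. Re z > -1/2} - {0}" and sQA: "closed_segment ?Q ?A \<subseteq> {z. Re z > -1/2} - {0}"
    and sDP': "closed_segment ?D ?P' \<subseteq> - {0}" and sPQ': "closed_segment ?P' ?Q' \<subseteq> - {0}" and sQA': "closed_segment ?Q' ?A \<subseteq> - {0}"
    using R unfolding seg by (auto simp: closed_segment_eq_real_ivl)
  have lenh: "norm (Complex x y - Complex x' y) = \<bar>x - x'\<bar>" "norm (Complex x y - Complex x y') = \<bar>y - y'\<bar>" for x x' y y'
    by (auto simp: complex_norm complex_diff)
  have b1: "norm (I (\<lambda>z. g1 z - g2 z) ?A ?B) \<le> 9 / R ^ 2 * R" unfolding I_def
    by (rule linepath_integral_bound[OF cont12[OF sAB]])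
       (use R horiz_right in \<open>auto simp: seg lenh closed_segment_eq_real_ivl split: if_splits\<close>)
  have b2: "norm (I (\<lambda>z. g1 z - g2 z) ?B ?C) \<le> 9 / R ^ 2 * (2 * R)" unfolding I_def
    by (rule linepath_integral_bound[OF cont12[OF sBC]])
       (use R vert_right in \<open>auto simp: seg lenh closed_segment_eq_real_ivl split: if_splits\<close>)
  have b3: "norm (I (\<lambda>z. g1 z - g2 z) ?C ?D) \<le> 9 / R ^ 2 * R" unfolding I_def
    by (rule linepath_integral_bound[OF cont12[OF sCD]])
       (use R horiz_right in \<open>auto simp: seg lenh closed_segment_eq_real_ivl split: if_splits\<close>)
  have b4: "norm (I g1 ?D ?P) \<le> 16 * M / R * 1" unfolding I_def
    by (rule linepath_integral_bound[OF cont1[OF sDP]])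
       (use R M horiz_f in \<open>auto simp: seg lenh closed_segment_eq_real_ivl split: if_splits\<close>)
  have b5: "norm (I g1 ?P ?Q) \<le> 576 * M / R ^ 2 * (2 * R)" unfolding I_def
    by (rule linepath_integral_bound[OF cont1[OF sPQ]])
       (use R M vert_f in \<open>auto simp: seg lenh closed_segment_eq_real_ivl split: if_splits\<close>)
  have b6: "norm (I g1 ?Q ?A) \<le> 16 * M / R * 1" unfolding I_def
    by (rule linepath_integral_bound[OF cont1[OF sQA]])
       (use R M horiz_f in \<open>auto simp: seg lenh closed_segment_eq_real_ivl split: if_splits\<close>)
  have b7: "norm (I g2 ?D ?P') \<le> 18 / R ^ 2 * R" unfolding I_def
    by (rule linepath_integral_bound[OF cont2[OF sDP']])
       (use R horiz_left in \<open>auto simp: seg lenh closed_segment_eq_real_ivl split: if_splits\<close>)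
  have b8: "norm (I g2 ?P' ?Q') \<le> 18 / R ^ 2 * (2 * R)" unfolding I_def
    by (rule linepath_integral_bound[OF cont2[OF sPQ']])
       (use R vert_left in \<open>auto simp: seg lenh closed_segment_eq_real_ivl split: if_splits\<close>)
  have b9: "norm (I g2 ?Q' ?A) \<le> 18 / R ^ 2 * R" unfolding I_def
    by (rule linepath_integral_bound[OF cont2[OF sQA']])
       (use R horiz_left in \<open>auto simp: seg lenh closed_segment_eq_real_ivl split: if_splits\<close>)
  have tri: "norm (x1 + x2 + x3 + (y1 + y2 + y3) - (z1 + z2 + z3)) \<le>
      (norm x1 + norm x2 + norm x3) + (norm y1 + norm y2 + norm y3) + (norm z1 + norm z2 + norm z3)"
    for x1 x2 x3 y1 y2 y3 z1 z2 z3 :: complex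
    using norm_triangle_ineq4[of "x1 + x2 + x3 + (y1 + y2 + y3)" "z1 + z2 + z3"]
      norm_triangle_ineq[of "x1 + x2 + x3" "y1 + y2 + y3"] norm_triangle_ineq[of "x1 + x2" x3]
      norm_triangle_ineq[of x1 x2] norm_triangle_ineq[of "y1 + y2" y3] norm_triangle_ineq[of y1 y2]
      norm_triangle_ineq[of "z1 + z2" z3] norm_triangle_ineq[of z1 z2] by linarith
  have eq: "2 * pi * \<i> * (f 0 - S 0) = I (\<lambda>z. g1 z - g2 z) ?A ?B + I (\<lambda>z. g1 z - g2 z) ?B ?C + I (\<lambda>z. g1 z - g2 z) ?C ?D
     + (I g1 ?D ?P + I g1 ?P ?Q + I g1 ?Q ?A) - (I g2 ?D ?P' + I g2 ?P' ?Q' + I g2 ?Q' ?A)"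
    unfolding right_diff_distrib 1[symmetric] 2[symmetric] dI[OF sAB, symmetric] dI[OF sBC, symmetric] dI[OF sCD, symmetric]
    by (simp add: algebra_simps)
  have "norm (2 * pi * \<i> * (f 0 - S 0)) \<le> (9 / R ^ 2 * R + 9 / R ^ 2 * (2 * R) + 9 / R ^ 2 * R)
      + (16 * M / R * 1 + 576 * M / R ^ 2 * (2 * R) + 16 * M / R * 1) + (18 / R ^ 2 * R + 18 / R ^ 2 * (2 * R) + 18 / R ^ 2 * R)"
    unfolding eq by (rule order_trans[OF tri[of "I (\<lambda>z. g1 z - g2 z) ?A ?B" "I (\<lambda>z. g1 z - g2 z) ?B ?C" "I (\<lambda>z. g1 z - g2 z) ?C ?D"
        "I g1 ?D ?P" "I g1 ?P ?Q" "I g1 ?Q ?A" "I g2 ?D ?P'" "I g2 ?P' ?Q'" "I g2 ?Q' ?A"]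
        add_mono[OF add_mono[OF add_mono[OF add_mono[OF b1 b2] b3] add_mono[OF add_mono[OF b4 b5] b6]] add_mono[OF add_mono[OF b7 b8] b9]]])
  also have "\<dots> = (108 + 1184 * M) / R"
  proof -
    have c: "c / R ^ 2 * R = c / R" "c / R ^ 2 * (2 * R) = 2 * c / R" for c
      using R by (simp_all add: power2_eq_square)
    show ?thesis unfolding c by (simp flip: add_divide_distrib)
  qed
  also have "\<dots> \<le> 1300 * M / R" using M R by (intro divide_right_mono) auto
  finally have "norm (2 * pi * \<i> * (f 0 - S 0)) \<le> 1300 * M / R" .
  moreover have "norm (f 0 - S 0) \<le> norm (2 * pi * \<i> * (f 0 - S 0))"
  proof -
    have "1 * norm (f 0 - S 0) \<le> (2 * pi) * norm (f 0 - S 0)"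
      using pi_gt3 by (intro mult_right_mono) auto
    thus ?thesis by (simp add: norm_mult)
  qed
  ultimately have "norm (f 0 - S 0) \<le> 1300 * M / R" by simp
  moreover have "S 0 = (\<Sum>n<N. a n / of_nat (Suc n))"
    unfolding S_def by (intro sum.cong) (auto simp: powr_minus field_simps simp del: of_nat_Suc)
  ultimately show ?thesis unfolding R1 by (simp add: f_def norm_minus_commute)
qed

subsection \<open>Quadratic characters over primes\<close>

lemma abel_weighted_sum:
  fixes T :: "nat \<Rightarrow> 'a :: comm_ring_1"
  shows "(\<Sum>n<N. of_nat (Suc n) * (T (Suc n) - T n)) = of_nat N * T N - (\<Sum>n<N. T n)"
  by (induction N) (auto simp: algebra_simps)

text \<open>Partial summation in terms of T, the distance of the weighted partial sums from their
  limit F 1: a bound N^(-1/16) for T becomes N^(15/16) for the unweighted sums.\<close>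

lemma newman_summatory:
  fixes a :: "nat \<Rightarrow> complex"
  assumes a: "\<And>n. norm (a n) \<le> 1"
    and F: "\<And>s. Re s > 1 \<Longrightarrow> (\<lambda>n. a n * of_nat (Suc n) powr (-s)) sums F s"
    and hol: "F holomorphic_on {s. Re s > 1/2}"
    and bd: "\<And>s. 3/4 \<le> Re s \<Longrightarrow> Re s \<le> 1 \<Longrightarrow> norm (F s) \<le> M * (1 + norm s) ^ 2" and M: "M \<ge> 1"
  shows "norm (\<Sum>n<N. a n) \<le> 10000 * M * real N powr (15/16)"
proof (cases "N = 0")
  case False
  define T where "T = (\<lambda>n. (\<Sum>m<n. a m / of_nat (Suc m)) - F 1)"
  define E where "E = 1300 * M"
  have E: "E \<ge> 1" using M by (simp add: E_def)
  have T: "norm (T n) \<le> E * real n powr (-1/16)" if "n \<ge> 1" for n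
    unfolding T_def E_def using newman_quantitative[OF a F hol bd M that] by simp
  have T0: "norm (T 0) \<le> 1 + E"
  proof -
    have "T 0 = T 1 - a 0" by (simp add: T_def)
    hence "norm (T 0) \<le> norm (T 1) + norm (a 0)" by (simp only: norm_triangle_ineq4)
    thus ?thesis using T[of 1] a[of 0] by simp
  qed
  have N: "N \<ge> 1" using False by simp
  define P where "P = real N powr (15/16)"
  have P1: "P \<ge> 1" unfolding P_def using N by (intro ge_one_powr_ge_zero) auto
  obtain K where K: "N = Suc K" using False by (cases N) auto
  have "(\<Sum>n<N. a n) = (\<Sum>n<N. of_nat (Suc n) * (T (Suc n) - T n))"
    by (intro sum.cong) (auto simp: T_def field_simps simp del: of_nat_Suc)
  also have "\<dots> = of_nat N * T N - (\<Sum>n<N. T n)" by (rule abel_weighted_sum)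
  also have "norm \<dots> \<le> norm (of_nat N * T N) + norm (\<Sum>n<N. T n)" by (rule norm_triangle_ineq4)
  also have "norm (of_nat N * T N) \<le> E * P"
  proof -
    have "norm (of_nat N * T N) \<le> real N * (E * real N powr (-1/16))"
      unfolding norm_mult using T[OF N] by (intro mult_mono) auto
    also have "\<dots> = E * (real N powr 1 * real N powr (-1/16))" using N by simp
    also have "real N powr 1 * real N powr (-1/16) = P" unfolding P_def powr_add[symmetric] by simp
    finally show ?thesis .
  qed
  also have "norm (\<Sum>n<N. T n) \<le> (1 + E) + 3 * E * P"
  proof -
    have "(\<Sum>n<N. T n) = T 0 + (\<Sum>n<K. T (Suc n))" unfolding K by (rule sum.lessThan_Suc_shift)
    also have "norm \<dots> \<le> norm (T 0) + norm (\<Sum>n<K. T (Suc n))" by (rule norm_triangle_ineq)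
    also have "norm (\<Sum>n<K. T (Suc n)) \<le> (\<Sum>n<K. E * real (Suc n) powr (-1/16))"
      by (rule sum_norm_le) (rule T, simp)
    also have "\<dots> \<le> (\<Sum>n<N. E * real (Suc n) powr (-1/16))"
      unfolding K using E by (intro sum_mono2) auto
    also have "\<dots> = E * (\<Sum>n<N. real (Suc n) powr (15/16 - 1))" by (simp add: sum_distrib_left)
    also have "\<dots> \<le> E * (P * (1 / (15/16) + 1 / real N))" unfolding P_def
      using E by (intro mult_left_mono partial_powr_bound N) auto
    also have "\<dots> \<le> E * (P * 3)"
    proof -
      have "1 / real N \<le> 1" using N by simp
      thus ?thesis using E P1 by (intro mult_left_mono) auto
    qed
    finally show ?thesis using T0 by simp
  qed
  also have "E * P + ((1 + E) + 3 * E * P) \<le> 6 * E * P"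
  proof -
    have "1 * 1 \<le> E * P" "E * 1 \<le> E * P" using E P1 by (intro mult_mono; simp)+
    thus ?thesis by simp
  qed
  also have "\<dots> \<le> 10000 * M * P" using M P1 by (simp add: E_def)
  finally show ?thesis unfolding P_def by simp
qed simp

lemma zeta32_ge_1: "zeta32 \<ge> 1"
proof -
  have "(\<Sum>n<1. real (Suc n) powr (-3/2)) \<le> zeta32"
    unfolding zeta32_def by (intro sum_le_suminf summable_Suc_powr) auto
  thus ?thesis by simp
qed

lemma quadratic_completely_multiplicative:
  assumes "quadratic_character d \<psi>"
  shows "completely_multiplicative \<psi>"
proof -
  have dc: "dirichlet_character d \<psi>" using assms by (simp add: quadratic_character_def primitive_character_def)
  show ?thesis
    by unfold_locales (use dc dirichlet_character_norm_le[OF dc] in \<open>auto simp: dirichlet_character_def\<close>)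
qed

lemma quadratic_character_cases:
  assumes "quadratic_character d \<psi>" shows "\<psi> n = 0 \<or> \<psi> n = 1 \<or> \<psi> n = -1"
  using quadratic_character_values[OF assms, of n] by (auto split: if_splits)

lemma quadratic_L:
  assumes "quadratic_character d \<psi>"
  shows "dirichlet_L \<psi> holomorphic_on A"
    and "\<And>s. Re s > 1 \<Longrightarrow> completely_multiplicative.h \<psi> s sums dirichlet_L \<psi> s"
    and "\<And>s. Re s \<ge> 1/2 \<Longrightarrow> norm (dirichlet_L \<psi> s) \<le> zeta32 * real d * norm s"
proof -
  interpret completely_multiplicative \<psi> by (rule quadratic_completely_multiplicative[OF assms])
  have dc: "dirichlet_character d \<psi>" "\<psi> \<noteq> principal_character d"
    using assms by (auto simp: quadratic_character_def primitive_character_def)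
  note L = nonprincipal_L[OF dc]
  show "dirichlet_L \<psi> holomorphic_on A" using L(1) by (rule holomorphic_on_subset) auto
  show "\<And>s. Re s \<ge> 1/2 \<Longrightarrow> norm (dirichlet_L \<psi> s) \<le> zeta32 * real d * norm s" by (rule L(3))
  show "h s sums dirichlet_L \<psi> s" if "Re s > 1" for s
    using L(2)[of s] sums_Suc_iff[of "h s" "dirichlet_L \<psi> s"] that by (simp add: h_def)
qed

text \<open>The hypothesis covers Re s < 1. To the right of 1 the Euler product excludes zeros, at s
  = 1 the value is 1, and on the rest of that line \<open>nonzero_on_line_1\<close> applies.\<close>

lemma zeta_reg_nonzero:
  assumes "generalised_riemann_hypothesis" "Re s > 1/2"
  shows "zeta_reg s \<noteq> 0"
proof -
  consider "Re s < 1" | "Re s > 1" | "s = 1" | "Re s = 1" "Im s \<noteq> 0"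
    by (metis complex_eqI linorder_neqE_linordered_idom one_complex.sel)
  thus ?thesis
  proof cases
    case 1 thus ?thesis using grh_zeta_nonzero assms by blast
  next
    case 2
    have "exp (trivial.prime_log s) = zeta_reg s / (s - 1)"
      by (rule trivial.exp_prime_log[OF 2 trivial_h_sums[OF 2]])
    thus ?thesis by (metis div_0 exp_not_eq_zero)
  next
    case 3 thus ?thesis by (simp add: zeta_reg_1)
  next
    case 4
    have s: "s = Complex 1 (Im s)" using 4 by (simp add: complex_eq_iff)
    have s1: "s \<noteq> 1" using 4 by auto
    have "zeta_reg field_differentiable at s"
      using holomorphic_on_imp_differentiable_at[OF holomorphic_zeta_reg open_halfspace_Re_gt] assms by auto
    hence "(\<lambda>s. zeta_reg s / (s - 1)) field_differentiable at s"
      using s1 by (intro field_differentiable_divide field_differentiable_diff) auto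
    hence "zeta_reg (Complex 1 (Im s)) / (Complex 1 (Im s) - 1) \<noteq> 0"
      using s by (intro trivial.nonzero_on_line_1[where Lf = "\<lambda>s. zeta_reg s / (s - 1)"] trivial_h_sums) (use 4 in auto)
    thus ?thesis using s by auto
  qed
qed

text \<open>A zero of L at 1 would cancel the pole of zeta, so that P, the product of zeta and L, is
  holomorphic for Re s > 0 and has no zeros right of 1/2. Its logarithm then exists there with real
  part bounded above on (1/2, 1), which \<open>landau\<close> excludes.\<close>

lemma L_at_1_nonzero:
  assumes grh: "generalised_riemann_hypothesis" and \<psi>: "quadratic_character d \<psi>"
  shows "dirichlet_L \<psi> 1 \<noteq> 0"
proof
  assume zero: "dirichlet_L \<psi> 1 = 0"
  interpret completely_multiplicative \<psi> by (rule quadratic_completely_multiplicative[OF \<psi>])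
  note real = quadratic_character_cases[OF \<psi>]
  have dc: "dirichlet_character d \<psi>" using \<psi> by (simp add: quadratic_character_def primitive_character_def)
  define Q where "Q = (\<lambda>s. if s = 1 then deriv (dirichlet_L \<psi>) 1 else dirichlet_L \<psi> s / (s - 1))"
  have Qhol: "Q holomorphic_on UNIV"
    by (rule pole_theorem_open_0[of "dirichlet_L \<psi>" UNIV 1]) (use zero quadratic_L(1)[OF \<psi>] in \<open>auto simp: Q_def\<close>)
  define P where "P = (\<lambda>s. zeta_reg s * Q s)"
  have Phol: "P holomorphic_on {s. Re s > 0}" unfolding P_def
    by (intro holomorphic_intros holomorphic_zeta_reg holomorphic_on_subset[OF Qhol]) auto
  have P_exp: "exp (trivial.prime_log s + prime_log s) = P s" if s: "Re s > 1" for s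
  proof -
    have "exp (trivial.prime_log s) = zeta_reg s / (s - 1)"
      by (rule trivial.exp_prime_log[OF s trivial_h_sums[OF s]])
    moreover have "exp (prime_log s) = dirichlet_L \<psi> s"
      by (rule exp_prime_log[OF s quadratic_L(2)[OF \<psi> s]])
    moreover have "s \<noteq> 1" using s by auto
    ultimately show ?thesis by (simp add: exp_add P_def Q_def)
  qed
  \<comment> \<open>At a real point every Euler factor of the product is at least 1; the least
    favourable value -1 of the character still gives 1 / (1 - z^2). By continuity P does not vanish
    at 1.\<close>
  have P_ge: "norm (P (of_real x)) \<ge> 1" if x: "x > 1" for x :: real
  proof -
    let ?s = "of_real x :: complex"
    have s: "Re ?s > 1" using x by simp
    have "(\<lambda>n. (if prime n then -Ln (1 - trivial.h ?s n) else 0) + (if prime n then -Ln (1 - h ?s n) else 0))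
        sums (trivial.prime_log ?s + prime_log ?s)"
      by (intro sums_add trivial.prime_log_sums prime_log_sums s)
    from sums_Re[OF this] have S: "(\<lambda>n. Re ((if prime n then -Ln (1 - trivial.h ?s n) else 0) + (if prime n then -Ln (1 - h ?s n) else 0)))
        sums Re (trivial.prime_log ?s + prime_log ?s)" .
    have "Re ((if prime n then -Ln (1 - trivial.h ?s n) else 0) + (if prime n then -Ln (1 - h ?s n) else 0)) \<ge> 0" for n
    proof (cases "prime n")
      case True
      define z where "z = real n powr (-x)"
      have n: "real n > 1" using prime_gt_1_nat[OF True] by simp
      have z: "0 < z" "z < 1" using n x by (auto simp: z_def powr_less_one)
      have hz: "of_nat n powr (-?s) = (of_real z :: complex)"
        using powr_of_real[of "real n" "-x"] n by (simp add: z_def)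
      have Ln: "Re (Ln (of_real y)) = ln y" if "y > 0" for y :: real
        using that by (simp add: Ln_of_real)
      have l1: "Re (Ln (1 - of_real z)) = ln (1 - z)" using Ln[of "1 - z"] z by simp
      have l2: "Re (Ln (1 + of_real z)) = ln (1 + z)" using Ln[of "1 + z"] z by simp
      have n1: "ln (1 - z) \<le> 0" using z by simp
      have "ln (1 - z) + ln (1 + z) = ln ((1 - z) * (1 + z))" using z by (simp add: ln_mult_pos)
      also have "\<dots> \<le> 0"
      proof -
        have "0 < (1 - z) * (1 + z)" "(1 - z) * (1 + z) \<le> 1" using z by (simp, simp add: algebra_simps)
        thus ?thesis by (subst ln_le_zero_iff)
      qed
      finally have n2: "ln (1 - z) + ln (1 + z) \<le> 0" .
      show ?thesis using True real[of n] n1 n2 by (auto simp: trivial.h_def h_def hz l1 l2)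
    qed auto
    from suminf_nonneg[OF sums_summable[OF S] this] S
    have "Re (trivial.prime_log ?s + prime_log ?s) \<ge> 0" by (simp only: sums_iff)
    hence "norm (exp (trivial.prime_log ?s + prime_log ?s)) \<ge> 1" by simp
    thus ?thesis using P_exp[OF s] by simp
  qed
  have contP: "isCont P s" if "Re s > 0" for s
    using Phol that holomorphic_on_imp_continuous_on continuous_on_eq_continuous_at open_halfspace_Re_gt[of 0] by blast
  have "((\<lambda>x. norm (P (of_real x))) \<longlongrightarrow> norm (P (of_real 1))) (at_right 1)"
    by (intro tendsto_norm isCont_tendsto_compose[OF contP] tendsto_of_real tendsto_ident_at) auto
  moreover have "eventually (\<lambda>x. norm (P (of_real x)) \<ge> 1) (at_right (1::real))"
    using P_ge by (intro eventually_mono[OF eventually_at_right_less])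
  ultimately have "norm (P (of_real 1)) \<ge> 1" by (intro tendsto_lowerbound) auto
  hence P1: "P 1 \<noteq> 0" by auto
  have Pnz: "P s \<noteq> 0" if s: "Re s > 1/2" for s
  proof -
    consider "Re s < 1" | "Re s > 1" | "s = 1" | "Re s = 1" "Im s \<noteq> 0"
      by (metis complex_eqI linorder_neqE_linordered_idom one_complex.sel)
    thus ?thesis
    proof cases
      case 1
      hence "dirichlet_L \<psi> s \<noteq> 0" using grh_L_nonzero[OF grh dc s] by simp
      moreover have "s \<noteq> 1" using 1 by auto
      ultimately show ?thesis using zeta_reg_nonzero[OF grh s] by (simp add: P_def Q_def)
    next
      case 2 thus ?thesis using P_exp[OF 2] by (metis exp_not_eq_zero)
    next
      case 3 thus ?thesis using P1 by simp
    next
      case 4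
      have s': "s = Complex 1 (Im s)" using 4 by (simp add: complex_eq_iff)
      have "dirichlet_L \<psi> (Complex 1 (Im s)) \<noteq> 0"
        by (rule nonzero_on_line_1[OF real 4(2) quadratic_L(2)[OF \<psi>]])
           (use quadratic_L(1)[OF \<psi>, of UNIV] in \<open>auto intro: holomorphic_on_imp_differentiable_at\<close>)
      moreover have "s \<noteq> 1" using 4 by auto
      ultimately show ?thesis using zeta_reg_nonzero[OF grh s] s' by (simp add: P_def Q_def)
    qed
  qed
  have lhol: "(\<lambda>s. trivial.prime_log s + prime_log s) holomorphic_on {s. Re s > 1}"
    by (intro holomorphic_intros trivial.holomorphic_prime_log holomorphic_prime_log)
  have P12: "P holomorphic_on {s. Re s > 1/2}" by (rule holomorphic_on_subset[OF Phol]) auto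
  obtain H where H: "H holomorphic_on {s. Re s > 1/2}" "\<And>s. Re s > 1/2 \<Longrightarrow> exp (H s) = P s"
    "\<And>s. Re s > 1 \<Longrightarrow> H s = trivial.prime_log s + prime_log s"
    using normalized_log[OF P12 Pnz lhol P_exp] by blast
  \<comment> \<open>P is continuous on the closed segment, including 1/2. Only an upper bound for Re
    H is wanted, so a zero of P at 1/2 itself does no harm.\<close>
  have "compact (of_real ` {1/2..1} :: complex set)"
    by (intro compact_continuous_image continuous_intros) auto
  moreover have "continuous_on (of_real ` {1/2..1}) P"
    by (intro continuous_at_imp_continuous_on ballI contP) auto
  ultimately have "bounded (P ` of_real ` {1/2..1})" by (blast intro: compact_imp_bounded compact_continuous_image)
  then obtain B where B: "B > 0" "\<And>x. 1/2 \<le> x \<Longrightarrow> x \<le> 1 \<Longrightarrow> norm (P (of_real x)) \<le> B"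
    unfolding bounded_pos by auto
  show False
  proof (rule landau[OF real H(1,3)])
    fix x :: real assume x: "1/2 < x" "x < 1"
    have "exp (Re (H (of_real x))) = norm (P (of_real x))" using H(2)[of "of_real x"] x by (simp flip: norm_exp_eq_Re)
    also have "\<dots> \<le> exp (ln B)" using B x by simp
    finally show "Re (H (of_real x)) \<le> ln B" by simp
  qed
qed

lemma L_nonzero:
  assumes grh: "generalised_riemann_hypothesis" and \<psi>: "quadratic_character d \<psi>" and s: "Re s > 1/2"
  shows "dirichlet_L \<psi> s \<noteq> 0"
proof -
  interpret completely_multiplicative \<psi> by (rule quadratic_completely_multiplicative[OF \<psi>])
  have dc: "dirichlet_character d \<psi>" using \<psi> by (simp add: quadratic_character_def primitive_character_def)
  consider "Re s < 1" | "Re s > 1" | "s = 1" | "Re s = 1" "Im s \<noteq> 0"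
    by (metis complex_eqI linorder_neqE_linordered_idom one_complex.sel)
  thus ?thesis
  proof cases
    case 1 thus ?thesis by (rule grh_L_nonzero[OF grh dc s])
  next
    case 2
    show ?thesis using exp_prime_log[OF 2 quadratic_L(2)[OF \<psi> 2]] by (metis exp_not_eq_zero)
  next
    case 3 thus ?thesis using L_at_1_nonzero[OF grh \<psi>] by simp
  next
    case 4
    have "s = Complex 1 (Im s)" using 4 by (simp add: complex_eq_iff)
    moreover have "dirichlet_L \<psi> (Complex 1 (Im s)) \<noteq> 0"
      by (rule nonzero_on_line_1[OF quadratic_character_cases[OF \<psi>] 4(2) quadratic_L(2)[OF \<psi>]])
         (use quadratic_L(1)[OF \<psi>, of UNIV] in \<open>auto intro: holomorphic_on_imp_differentiable_at\<close>)
    ultimately show ?thesis by simp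
  qed
qed

lemma sum_lessThan_Suc_primes:
  "(\<Sum>n<N. if prime (Suc n) then g (Suc n) else 0) = (\<Sum>p | prime p \<and> p \<le> N. g p)"
  for g :: "nat \<Rightarrow> 'a :: comm_monoid_add"
proof -
  have "(\<Sum>n<N. if prime (Suc n) then g (Suc n) else 0) = (\<Sum>p\<in>Suc ` {..<N}. if prime p then g p else 0)"
    by (subst sum.reindex) auto
  also have "Suc ` {..<N} = {1..N}" by (auto simp: image_iff gr0_conv_Suc Suc_le_eq)
  also have "(\<Sum>p\<in>{1..N}. if prime p then g p else 0) = (\<Sum>p\<in>{p\<in>{1..N}. prime p}. g p)"
    by (rule sum.inter_filter[symmetric]) simp
  also have "{p\<in>{1..N}. prime p} = {p. prime p \<and> p \<le> N}" using prime_ge_1_nat by auto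
  finally show ?thesis .
qed

text \<open>The factor 10000 comes from \<open>newman_summatory\<close>. The bracket times 1 + ln d
  dominates the constant in the growth of log L minus its prime square part.\<close>

definition quadratic_const :: real where
  "quadratic_const = 10000 * (100 + 200 * zeta32 + 10 * ln zeta32)"

text \<open>Newman's argument applied to H minus the prime square part. The conductor enters through
  the bound \<open>B * norm s\<close> for L with \<open>B = zeta32 * d\<close>, and
  \<open>log_growth\<close> turns B into ln B.\<close>

lemma quadratic_prime_sum:
  assumes grh: "generalised_riemann_hypothesis" and \<psi>: "quadratic_character d \<psi>"
  shows "norm (\<Sum>p | prime p \<and> p \<le> N. \<psi> p) \<le> quadratic_const * (1 + ln (real d)) * real N powr (15/16)"
proof -
  interpret completely_multiplicative \<psi> by (rule quadratic_completely_multiplicative[OF \<psi>])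
  have d: "d \<ge> 1" using \<psi> by (auto simp: quadratic_character_def primitive_character_def dirichlet_character_def)
  define B where "B = zeta32 * real d"
  have B: "B \<ge> 1" unfolding B_def using zeta32_ge_1 d mult_mono[of 1 zeta32 1 "real d"] by simp
  have lnB: "ln B = ln zeta32 + ln (real d)" unfolding B_def using zeta32_ge_1 d by (subst ln_mult_pos) auto
  obtain H where H: "H holomorphic_on {s. Re s > 1/2}" "\<And>s. Re s > 1/2 \<Longrightarrow> exp (H s) = dirichlet_L \<psi> s"
    "\<And>s. Re s > 1 \<Longrightarrow> H s = prime_log s"
    using normalized_log[OF quadratic_L(1)[OF \<psi>] L_nonzero[OF grh \<psi>] holomorphic_prime_log exp_prime_log[OF _ quadratic_L(2)[OF \<psi>]]]
    by blast
  define M where "M = 100 + 44 * (4 * zeta32) + 10 * ln B + 4 * zeta32"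
  have lnB0: "ln B \<ge> 0" using B by simp
  have M1: "M \<ge> 1" using zeta32_ge_1 lnB0 by (simp add: M_def)
  define a where "a = (\<lambda>n. if prime (Suc n) then \<psi> (Suc n) else 0)"
  have "norm (\<Sum>n<N. a n) \<le> 10000 * M * real N powr (15/16)"
  proof (rule newman_summatory[where F = "\<lambda>s. H s - prime_square_part s"])
    show "norm (a n) \<le> 1" for n using le1 by (auto simp: a_def)
    show "(\<lambda>s. H s - prime_square_part s) holomorphic_on {s. Re s > 1/2}"
      by (intro holomorphic_intros H holomorphic_prime_square_part)
    show "(\<lambda>n. a n * of_nat (Suc n) powr (-s)) sums (H s - prime_square_part s)" if "Re s > 1" for s
    proof -
      have "(\<lambda>n. if prime n then h s n else 0) sums (H s - prime_square_part s)"
        using prime_series[OF that] H(3)[OF that] by simp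
      hence "(\<lambda>n. if prime (Suc n) then h s (Suc n) else 0) sums (H s - prime_square_part s)"
        using sums_Suc_iff[of "\<lambda>n. if prime n then h s n else 0" "H s - prime_square_part s"] by simp
      thus ?thesis by (rule sums_cong[THEN iffD1, rotated]) (simp add: a_def h_def)
    qed
    show "norm (H s - prime_square_part s) \<le> M * (1 + norm s) ^ 2" if s: "3/4 \<le> Re s" "Re s \<le> 1" for s
    proof -
      have "norm (H s) \<le> (100 + 44 * (4 * zeta32) + 10 * ln B) * (1 + norm s)"
      proof (rule log_growth[OF H(1) _ B _ s])
        show "norm (exp (H s)) \<le> B * (1 + norm s) ^ 2" if "Re s > 1/2" for s
        proof -
          have "norm (exp (H s)) \<le> B * norm s" using H(2)[OF that] quadratic_L(3)[OF \<psi>, of s] that by (simp add: B_def)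
          also have "norm s \<le> (1 + norm s) ^ 2" by (simp add: power2_eq_square algebra_simps)
          finally show ?thesis using B by (simp add: mult_left_mono)
        qed
        show "norm (H s) \<le> 4 * zeta32 * (1 + norm s)" if "Re s = 2" for s
        proof -
          have "norm (H s) \<le> 4 * zeta32 * 1" using H(3)[of s] norm_prime_log_le[of s] that by simp
          also have "\<dots> \<le> 4 * zeta32 * (1 + norm s)" using zeta32_ge_1 by (intro mult_left_mono) auto
          finally show ?thesis .
        qed
      qed
      moreover have "norm (prime_square_part s) \<le> 4 * zeta32 * (1 + norm s)"
      proof -
        have "4 * zeta32 * 1 \<le> 4 * zeta32 * (1 + norm s)" using zeta32_ge_1 by (intro mult_left_mono) auto
        thus ?thesis using norm_prime_square_part[OF s(1)] by simp
      qed
      ultimately have "norm (H s - prime_square_part s) \<le> M * (1 + norm s)"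
        using norm_triangle_ineq4[of "H s" "prime_square_part s"] by (simp add: M_def algebra_simps)
      also have "\<dots> \<le> M * (1 + norm s) ^ 2"
        using M1 by (intro mult_left_mono) (auto simp: power2_eq_square algebra_simps)
      finally show ?thesis .
    qed
  qed (rule M1)
  also have "(\<Sum>n<N. a n) = (\<Sum>p | prime p \<and> p \<le> N. \<psi> p)" unfolding a_def by (rule sum_lessThan_Suc_primes)
  also have "10000 * M * real N powr (15/16) \<le> quadratic_const * (1 + ln (real d)) * real N powr (15/16)"
  proof (rule mult_right_mono)
    have "10 * ln (real d) \<le> (100 + 200 * zeta32 + 10 * ln zeta32) * ln (real d)"
      using zeta32_ge_1 d by (intro mult_right_mono) auto
    hence "M \<le> (100 + 200 * zeta32 + 10 * ln zeta32) * (1 + ln (real d))"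
      using zeta32_ge_1 unfolding M_def lnB distrib_left by simp
    thus "10000 * M \<le> quadratic_const * (1 + ln (real d))" unfolding quadratic_const_def mult.assoc by simp
  qed auto
  finally show ?thesis .
qed

subsection \<open>Distribution of primes\<close>

text \<open>The index \<open>n\<close> stands for the integer \<open>n + 1\<close>. Subtracting \<open>1/ln\<close> from the indicator of the primes
  removes the logarithmic singularity of the Dirichlet series at 1 and keeps the coefficients bounded.\<close>

definition prime_density_error :: "nat \<Rightarrow> complex" where
  "prime_density_error n = (if prime (Suc n) then 1 else 0) - (if n = 0 then 0 else of_real (1 / ln (real (Suc n))))"

lemma ln_2_ge_half: "ln (2::real) \<ge> 1/2"
  using ln_add_one_self_le_self2[of "-1/2"] ln_le_minus_one[of "1/2"] by (simp add: ln_div)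

lemma ln_3_ge_1: "ln (3::real) \<ge> 1"
  using exp_le by (subst ln_ge_iff) auto

text \<open>The prime 2 is a separate case because 1 / ln 2 exceeds 1; from 3 on 1 / ln lies between
  0 and 1.\<close>

lemma norm_prime_density_error: "norm (prime_density_error n) \<le> 1"
proof -
  consider "n = 0" | "n = 1" | "n \<ge> 2" by linarith
  thus ?thesis
  proof cases
    case 1 thus ?thesis by (simp add: prime_density_error_def)
  next
    case 2
    have "1 / ln (2::real) \<le> 2" "1 / ln (2::real) > 0" using ln_2_ge_half by (auto simp: field_simps)
    hence "\<bar>1 - 1 / ln (2::real)\<bar> \<le> 1" by linarith
    moreover have "prime_density_error n = of_real (1 - 1 / ln 2)"
      using 2 by (simp add: prime_density_error_def numeral_2_eq_2[symmetric])
    ultimately show ?thesis by (simp only: norm_of_real)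
  next
    case 3
    have "ln (real (Suc n)) \<ge> ln 3" using 3 by (subst ln_le_cancel_iff) auto
    hence l: "ln (real (Suc n)) \<ge> 1" using ln_3_ge_1 by linarith
    hence "1 / ln (real (Suc n)) \<le> 1 / 1" by (intro frac_le) auto
    moreover have "1 / ln (real (Suc n)) \<ge> 0" using l by simp
    ultimately have "\<bar>(if prime (Suc n) then 1 else 0) - 1 / ln (real (Suc n))\<bar> \<le> 1" by auto
    moreover have "prime_density_error n = of_real ((if prime (Suc n) then 1 else 0) - 1 / ln (real (Suc n)))"
      using 3 by (simp add: prime_density_error_def)
    ultimately show ?thesis by (simp only: norm_of_real)
  qed
qed

text \<open>Termwise differentiation removes the logarithm and gives 1 - \<zeta>(s), the 1 making up
  for the missing first term. So the continuation of Z is a matter of primitives.\<close>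

lemma inverse_log_series:
  obtains Z where
    "\<And>s. Re s > 1 \<Longrightarrow> (\<lambda>n. (if n = 0 then 0 else of_real (1 / ln (real (Suc n)))) * of_nat (Suc n) powr (-s)) sums Z s"
    "\<And>s. Re s > 1 \<Longrightarrow> (Z has_field_derivative (1 - zeta_reg s / (s - 1))) (at s)"
proof -
  let ?S = "{s. Re s > 1}"
  let ?f = "\<lambda>n s. (if n = 0 then 0 else of_real (1 / ln (real (Suc n)))) * of_nat (Suc n) powr (-s) :: complex"
  let ?f' = "\<lambda>n s. if n = 0 then 0 else - (of_nat (Suc n) powr (-s)) :: complex"
  have "\<exists>g g'. \<forall>x \<in> ?S. ((\<lambda>n. ?f n x) sums g x) \<and> ((\<lambda>n. ?f' n x) sums g' x) \<and> (g has_field_derivative g' x) (at x)"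
  proof (rule series_and_derivative_comparison_complex)
    show "open ?S" by (rule open_halfspace_Re_gt)
    fix n and x :: complex assume "x \<in> ?S"
    show "(?f n has_field_derivative ?f' n x) (at x)"
    proof (cases "n = 0")
      case False
      have n: "of_nat (Suc n) \<noteq> (0::complex)" by (rule of_nat_neq_0)
      have ln: "Ln (of_nat (Suc n)) = of_real (ln (real (Suc n)))"
        using Ln_of_real[of "real (Suc n)"] by simp
      have lnz: "ln (real (Suc n)) \<noteq> 0" using False by simp
      have "((\<lambda>s. of_nat (Suc n) powr (-s)) has_field_derivative (Ln (of_nat (Suc n)) * of_nat (Suc n) powr (-x)) * (-1 :: complex)) (at x)"
        by (rule DERIV_chain2[OF has_field_derivative_powr_right[OF n]]) (auto intro!: derivative_eq_intros)
      from DERIV_cmult[OF this, of "of_real (1 / ln (real (Suc n)))"]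
      show ?thesis using False lnz unfolding ln by (simp del: of_nat_Suc)
    qed simp
  next
    fix x :: complex assume x: "x \<in> ?S"
    define d where "d = (Re x - 1) / 2"
    define hh where "hh = (\<lambda>n. complex_of_real (2 * real (Suc n) powr (-(1 + d))))"
    have d: "d > 0" using x by (simp add: d_def)
    have "summable (\<lambda>n. 2 * real (Suc n) powr (-(1 + d)))"
      using d by (intro summable_mult summable_Suc_powr) auto
    hence "summable hh" unfolding hh_def by (simp only: summable_of_real)
    moreover have "range hh \<subseteq> \<real>\<^sub>\<ge>\<^sub>0" by (auto simp: hh_def simp del: of_real_mult)
    moreover have "norm (?f n y) \<le> norm (hh n)" if y: "y \<in> ball x d \<inter> ?S" for n y
    proof (cases "n = 0")
      case False
      have "Re y \<ge> 1 + d" using y abs_Re_le_cmod[of "x - y"] by (auto simp: dist_norm d_def field_simps abs_if split: if_splits)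
      hence p: "real (Suc n) powr (-Re y) \<le> real (Suc n) powr (-(1 + d))" by (intro powr_mono) auto
      have "ln (real (Suc n)) \<ge> ln 2" using False by (subst ln_le_cancel_iff) auto
      hence l: "ln (real (Suc n)) \<ge> 1/2" using ln_2_ge_half by linarith
      hence "1 / ln (real (Suc n)) \<le> 1 / (1/2)" by (intro frac_le) auto
      hence l2: "1 / ln (real (Suc n)) \<le> 2" "1 / ln (real (Suc n)) \<ge> 0" using l by simp_all
      have "norm (?f n y) = 1 / ln (real (Suc n)) * real (Suc n) powr (-Re y)"
        using False l norm_of_nat_powr[of "Suc n" "-y"] by (simp add: norm_mult norm_divide del: of_nat_Suc)
      also have "\<dots> \<le> 2 * real (Suc n) powr (-(1 + d))"
        using l2 p by (intro mult_mono) auto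
      also have "\<dots> = norm (hh n)" unfolding hh_def norm_of_real by simp
      finally show ?thesis .
    qed simp
    ultimately show "\<exists>d (h :: nat \<Rightarrow> complex). 0 < d \<and> summable h \<and> range h \<subseteq> \<real>\<^sub>\<ge>\<^sub>0 \<and>
       (\<forall>\<^sub>F n in sequentially. \<forall>y\<in>ball x d \<inter> ?S. norm (?f n y) \<le> norm (h n))"
      using d by (intro exI[of _ d] exI[of _ hh] conjI always_eventually allI ballI)
  qed
  then obtain g g' where g: "\<And>x. Re x > 1 \<Longrightarrow> (\<lambda>n. ?f n x) sums g x"
    "\<And>x. Re x > 1 \<Longrightarrow> (\<lambda>n. ?f' n x) sums g' x" "\<And>x. Re x > 1 \<Longrightarrow> (g has_field_derivative g' x) (at x)" by blast
  have "g' s = 1 - zeta_reg s / (s - 1)" if s: "Re s > 1" for s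
  proof -
    have "(\<lambda>n. (if n = 0 then 1 else 0) - of_nat (Suc n) powr (-s)) sums (1 - zeta_reg s / (s - 1))"
      by (intro sums_diff zeta_series s) (rule sums_single[of 0 "\<lambda>_. 1"])
    hence "(\<lambda>n. ?f' n s) sums (1 - zeta_reg s / (s - 1))"
      by (rule sums_cong[THEN iffD1, rotated]) auto
    thus ?thesis using g(2)[OF s] sums_unique2 by blast
  qed
  with g show ?thesis by (intro that[of g]) auto
qed

text \<open>The regular part \<zeta>(s) - 1 / (s - 1), with the removable singularity at 1 filled
  in.\<close>

definition zeta_holo :: "complex \<Rightarrow> complex" where
  "zeta_holo s = (if s = 1 then deriv zeta_reg 1 else (zeta_reg s - 1) / (s - 1))"

lemma holomorphic_zeta_holo: "zeta_holo holomorphic_on {s. Re s > 0}"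
proof (rule pole_theorem_open_0[of "\<lambda>s. zeta_reg s - 1" _ 1])
  show "(\<lambda>s. zeta_reg s - 1) holomorphic_on {s. 0 < Re s}"
    by (intro holomorphic_intros holomorphic_zeta_reg)
  show "open {s. 0 < Re s}" by (rule open_halfspace_Re_gt)
  have "zeta_reg field_differentiable at 1"
    using holomorphic_on_imp_differentiable_at[OF holomorphic_zeta_reg open_halfspace_Re_gt] by auto
  hence "deriv (\<lambda>s. zeta_reg s - 1) 1 = deriv zeta_reg 1" by (subst deriv_diff) auto
  thus "zeta_holo 1 = deriv (\<lambda>s. zeta_reg s - 1) 1" by (simp add: zeta_holo_def)
qed (auto simp: zeta_holo_def zeta_reg_1)

lemma zeta_holo_bound:
  assumes "Re s \<ge> 1/2"
  shows "norm (zeta_holo s) \<le> norm (zeta_holo 1) + zeta32 * norm s"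
proof (cases "s = 1")
  case True thus ?thesis using zeta32_ge_1 by simp
next
  case False
  hence "norm (zeta_holo s) \<le> zeta32 * norm s"
    using zeta_reg_bound[OF assms] by (simp add: zeta_holo_def norm_divide field_simps)
  thus ?thesis using norm_ge_zero[of "zeta_holo 1"] by linarith
qed

lemma norm_Ln_le_linear:
  assumes "norm z \<ge> 1" shows "norm (Ln z) \<le> norm z + 4"
proof -
  have z: "z \<noteq> 0" using assms by auto
  have "norm (Ln z) \<le> \<bar>Re (Ln z)\<bar> + \<bar>Im (Ln z)\<bar>" by (rule cmod_le)
  also have "\<bar>Im (Ln z)\<bar> \<le> pi" using mpi_less_Im_Ln[OF z] Im_Ln_le_pi[OF z] by linarith
  also have "\<bar>Re (Ln z)\<bar> = ln (norm z)" using assms z by simp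
  also have "ln (norm z) \<le> norm z" using ln_bound[of "norm z"] z by simp
  finally show ?thesis using pi_less_4 by linarith
qed

text \<open>The Dirichlet series of the error is log \<zeta> = H - Ln(s - 1), minus its prime square
  part, minus Z. Both Ln(s - 1) and Z are singular at 1, but their sum has derivative 1 -
  \<open>zeta_holo\<close>, which is holomorphic there; W is a primitive of the negative of this
  derivative.\<close>

theorem prime_density:
  assumes grh: "generalised_riemann_hypothesis"
  obtains C c where "C > 0"
    "\<And>N. norm (\<Sum>n<N. prime_density_error n) \<le> C * real N powr (15/16)"
    "\<And>N. N \<ge> 1 \<Longrightarrow> norm ((\<Sum>n<N. prime_density_error n / of_nat (Suc n)) - c) \<le> C * real N powr (-1/16)"
proof -
  have lhol: "(\<lambda>s. trivial.prime_log s + Ln (s - 1)) holomorphic_on {s. Re s > 1}"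
    by (intro holomorphic_intros trivial.holomorphic_prime_log) (auto simp: complex_nonpos_Reals_iff)
  have lexp: "exp (trivial.prime_log s + Ln (s - 1)) = zeta_reg s" if s: "Re s > 1" for s
  proof -
    have "s - 1 \<noteq> 0" using s by auto
    thus ?thesis using trivial.exp_prime_log[OF s trivial_h_sums[OF s]] by (simp add: exp_add)
  qed
  have zhol: "zeta_reg holomorphic_on {s. Re s > 1/2}" by (rule holomorphic_on_subset[OF holomorphic_zeta_reg]) auto
  obtain H where H: "H holomorphic_on {s. Re s > 1/2}" "\<And>s. Re s > 1/2 \<Longrightarrow> exp (H s) = zeta_reg s"
    "\<And>s. Re s > 1 \<Longrightarrow> H s = trivial.prime_log s + Ln (s - 1)"
    using normalized_log[OF zhol zeta_reg_nonzero[OF grh] lhol lexp] by blast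
  obtain Z where Z: "\<And>s. Re s > 1 \<Longrightarrow> (\<lambda>n. (if n = 0 then 0 else of_real (1 / ln (real (Suc n)))) * of_nat (Suc n) powr (-s)) sums Z s"
    "\<And>s. Re s > 1 \<Longrightarrow> (Z has_field_derivative (1 - zeta_reg s / (s - 1))) (at s)"
    by (rule inverse_log_series) blast
  have op: "open {s. Re s > 1/2}" and cv: "convex {s. Re s > 1/2}"
    by (rule open_halfspace_Re_gt convex_halfspace_Re_gt)+
  have Vhol: "(\<lambda>s. zeta_holo s - 1) holomorphic_on {s. Re s > 1/2}"
    by (intro holomorphic_intros holomorphic_on_subset[OF holomorphic_zeta_holo]) auto
  obtain W where W: "\<And>s. s \<in> {s. Re s > 1/2} \<Longrightarrow> (W has_field_derivative (zeta_holo s - 1)) (at s within {s. Re s > 1/2})"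
    using holomorphic_convex_primitive'[OF cv op Vhol] by blast
  have W': "(W has_field_derivative (zeta_holo s - 1)) (at s)" if "Re s > 1/2" for s
  proof -
    have "s \<in> {s. Re s > 1/2}" using that by simp
    from W[OF this] show ?thesis unfolding at_within_open[OF \<open>s \<in> {s. Re s > 1/2}\<close> op] .
  qed
  define k where "k = - (Ln (2 - 1) + Z 2) - W 2"
  have Weq: "- (Ln (s - 1) + Z s) = W s + k" if s: "Re s > 1" for s
  proof -
    have "\<exists>c. \<forall>s\<in>{s. Re s > 1}. - (Ln (s - 1) + Z s) - W s = c"
    proof (rule has_field_derivative_zero_constant)
      show "convex {s. Re s > 1}" by (rule convex_halfspace_Re_gt)
      fix s assume "s \<in> {s. Re s > 1}"
      hence s: "Re s > 1" by simp
      have s1: "s - 1 \<noteq> 0" using s by auto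
      have "((\<lambda>s. Ln (s - 1)) has_field_derivative inverse (s - 1) * 1) (at s)"
        by (rule DERIV_chain2[OF has_field_derivative_Ln]) (use s in \<open>auto simp: complex_nonpos_Reals_iff intro!: derivative_eq_intros\<close>)
      from DERIV_diff[OF DERIV_minus[OF DERIV_add[OF this Z(2)[OF s]]] W'[of s]] s
      have "((\<lambda>s. - (Ln (s - 1) + Z s) - W s) has_field_derivative - (inverse (s - 1) * 1 + (1 - zeta_reg s / (s - 1))) - (zeta_holo s - 1)) (at s)"
        by simp
      moreover have "- (inverse (s - 1) * 1 + (1 - zeta_reg s / (s - 1))) - (zeta_holo s - 1) = 0"
        using s1 by (auto simp: zeta_holo_def field_simps)
      ultimately show "((\<lambda>s. - (Ln (s - 1) + Z s) - W s) has_field_derivative 0) (at s within {s. Re s > 1})"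
        by (auto intro: has_field_derivative_at_within)
    qed
    then obtain c where c: "\<And>s. Re s > 1 \<Longrightarrow> - (Ln (s - 1) + Z s) - W s = c" by blast
    have "k = c" using c[of 2] by (simp add: k_def)
    with c[OF s] show ?thesis by (simp add: algebra_simps)
  qed
  define F where "F = (\<lambda>s. H s - trivial.prime_square_part s + (W s + k))"
  have Whol: "W holomorphic_on {s. Re s > 1/2}" by (rule holomorphic_onI) (use W' in \<open>auto simp: field_differentiable_def intro: has_field_derivative_at_within\<close>)
  have Fhol: "F holomorphic_on {s. Re s > 1/2}" unfolding F_def
    by (intro holomorphic_intros H trivial.holomorphic_prime_square_part Whol)
  have Fsums: "(\<lambda>n. prime_density_error n * of_nat (Suc n) powr (-s)) sums F s" if s: "Re s > 1" for s
  proof -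
    have "(\<lambda>n. if prime n then trivial.h s n else 0) sums (trivial.prime_log s - trivial.prime_square_part s)"
      by (rule trivial.prime_series[OF s])
    hence "(\<lambda>n. if prime (Suc n) then trivial.h s (Suc n) else 0) sums (trivial.prime_log s - trivial.prime_square_part s)"
      using sums_Suc_iff[of "\<lambda>n. if prime n then trivial.h s n else 0" "trivial.prime_log s - trivial.prime_square_part s"] by simp
    from sums_diff[OF this Z(1)[OF s]]
    have "(\<lambda>n. (if prime (Suc n) then trivial.h s (Suc n) else 0) - (if n = 0 then 0 else of_real (1 / ln (real (Suc n)))) * of_nat (Suc n) powr (-s))
        sums (trivial.prime_log s - trivial.prime_square_part s - Z s)" .
    moreover have "trivial.prime_log s - trivial.prime_square_part s - Z s = F s"
      unfolding F_def Weq[OF s, symmetric] H(3)[OF s] by simp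
    ultimately have "(\<lambda>n. (if prime (Suc n) then trivial.h s (Suc n) else 0) - (if n = 0 then 0 else of_real (1 / ln (real (Suc n)))) * of_nat (Suc n) powr (-s)) sums F s" by simp
    thus ?thesis by (rule sums_cong[THEN iffD1, rotated]) (auto simp: prime_density_error_def trivial.h_def left_diff_distrib simp del: of_nat_Suc)
  qed
  define B where "B = 1 + zeta32"
  define D where "D = 4 * zeta32 + 5"
  define w where "w = norm (zeta_holo 1) + 1"
  have w1: "w \<ge> 1" by (simp add: w_def)
  define M where "M = (100 + 44 * D + 10 * ln B) + 4 * zeta32 + (norm (W 2 + k) + 4 * (w + zeta32))"
  have lnB0: "ln B \<ge> 0" using zeta32_ge_1 by (simp add: B_def)
  have M1: "M \<ge> 1"
  proof -
    have "0 \<le> 44 * D" "0 \<le> 10 * ln B" "0 \<le> 4 * zeta32" "0 \<le> norm (W 2 + k)" "0 \<le> 4 * (w + zeta32)"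
      using zeta32_ge_1 lnB0 w1 by (auto simp: D_def)
    thus ?thesis unfolding M_def by linarith
  qed
  have Fbd: "norm (F s) \<le> M * (1 + norm s) ^ 2" if s: "3/4 \<le> Re s" "Re s \<le> 1" for s
  proof -
    have sq: "1 + norm s \<le> (1 + norm s) ^ 2" "1 \<le> (1 + norm s) ^ 2" by (auto simp: power2_eq_square algebra_simps)
    have 1: "norm (H s) \<le> (100 + 44 * D + 10 * ln B) * (1 + norm s)"
    proof (rule log_growth[OF H(1) _ _ _ s])
      show "B \<ge> 1" using zeta32_ge_1 by (simp add: B_def)
      show "norm (exp (H s)) \<le> B * (1 + norm s) ^ 2" if "Re s > 1/2" for s
      proof -
        have "norm (zeta_reg s) \<le> 1 + norm (zeta_reg s - 1)" using norm_triangle_ineq[of 1 "zeta_reg s - 1"] by simp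
        also have "norm (zeta_reg s - 1) \<le> zeta32 * norm (s - 1) * norm s" by (rule zeta_reg_bound) (use that in simp)
        also have "\<dots> \<le> zeta32 * (1 + norm s) * (1 + norm s)"
          using zeta32_ge_1 norm_triangle_ineq4[of s 1] by (intro mult_mono) auto
        also have "1 + zeta32 * (1 + norm s) * (1 + norm s) \<le> (1 + norm s) ^ 2 + zeta32 * (1 + norm s) * (1 + norm s)"
          by (intro add_right_mono) (auto simp: power2_eq_square algebra_simps)
        also have "\<dots> = B * (1 + norm s) ^ 2" by (simp add: B_def power2_eq_square algebra_simps)
        finally show ?thesis using H(2)[OF that] by simp
      qed
      show "norm (H s) \<le> D * (1 + norm s)" if "Re s = 2" for s
      proof -
        have "norm (s - 1) \<ge> 1" using complex_Re_le_cmod[of "s - 1"] that by simp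
        hence "norm (Ln (s - 1)) \<le> norm (s - 1) + 4" by (rule norm_Ln_le_linear)
        also have "\<dots> \<le> 5 + norm s" using norm_triangle_ineq4[of s 1] by simp
        finally have "norm (H s) \<le> 4 * zeta32 + (5 + norm s)"
          using H(3)[of s] trivial.norm_prime_log_le[of s] norm_triangle_ineq[of "trivial.prime_log s" "Ln (s - 1)"] that by simp
        also have "\<dots> \<le> D * (1 + norm s)"
          using zeta32_ge_1 mult_nonneg_nonneg[of zeta32 "norm s"] by (simp add: D_def algebra_simps)
        finally show ?thesis .
      qed
    qed
    have K0: "100 + 44 * D + 10 * ln B \<ge> 0" using lnB0 zeta32_ge_1 by (simp add: D_def)
    have 1: "norm (H s) \<le> (100 + 44 * D + 10 * ln B) * (1 + norm s) ^ 2"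
      using 1 mult_left_mono[OF sq(1) K0] by linarith
    have 2: "norm (trivial.prime_square_part s) \<le> 4 * zeta32 * (1 + norm s) ^ 2"
    proof -
      have "4 * zeta32 * 1 \<le> 4 * zeta32 * (1 + norm s) ^ 2" using sq zeta32_ge_1 by (intro mult_left_mono) auto
      thus ?thesis using trivial.norm_prime_square_part[OF s(1)] by simp
    qed
    \<comment> \<open>Integrating the linear bound for \<open>zeta_holo\<close> along the segment to
      2 gives quadratic growth, which accounts for the square in the hypothesis of Newman's
      argument.\<close>
    have 3: "norm (W s + k) \<le> (norm (W 2 + k) + 4 * (w + zeta32)) * (1 + norm s) ^ 2"
    proof -
      let ?c = "w + zeta32 * (2 + norm s)"
      have re: "Re z > 1/2" "norm z \<le> 2 + norm s" if "z \<in> closed_segment s 2" for z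
      proof -
        from that obtain u where u: "0 \<le> u" "u \<le> 1" "z = (1 - u) *\<^sub>R s + u *\<^sub>R 2" by (auto simp: closed_segment_def)
        have "(1 - u) * Re s \<ge> (1 - u) * (3/4)" using s u by (intro mult_left_mono) auto
        moreover have "Re z = (1 - u) * Re s + u * 2" unfolding u(3) by simp
        moreover have "(1 - u) * (3/4) + u * 2 \<ge> 3/4" using u by (simp add: field_simps)
        ultimately show "Re z > 1/2" by linarith
        have "norm z \<le> (1 - u) * norm s + u * 2" unfolding u(3) using u norm_triangle_ineq[of "(1 - u) *\<^sub>R s" "u *\<^sub>R 2"] by simp
        also have "\<dots> \<le> 1 * norm s + 1 * 2" using u by (intro add_mono mult_right_mono) auto
        finally show "norm z \<le> 2 + norm s" by simp
      qed
      have "norm (W s - W 2) \<le> ?c * norm (s - 2)"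
      proof (rule field_differentiable_bound[where S = "closed_segment s 2" and f' = "\<lambda>z. zeta_holo z - 1"])
        fix z assume z: "z \<in> closed_segment s 2"
        show "(W has_field_derivative (zeta_holo z - 1)) (at z within closed_segment s 2)"
          by (rule has_field_derivative_at_within[OF W'[OF re(1)[OF z]]])
        have "norm (zeta_holo z - 1) \<le> norm (zeta_holo 1) + zeta32 * norm z + 1"
          using zeta_holo_bound[of z] re(1)[OF z] norm_triangle_ineq4[of "zeta_holo z" 1] by simp
        also have "zeta32 * norm z \<le> zeta32 * (2 + norm s)" using re(2)[OF z] zeta32_ge_1 by (intro mult_left_mono) auto
        finally show "norm (zeta_holo z - 1) \<le> ?c" by (simp add: w_def)
      qed auto
      also have "norm (s - 2) \<le> 2 * (1 + norm s)"
        by (rule order_trans[OF norm_triangle_ineq4]) simp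
      also have "?c * (2 * (1 + norm s)) \<le> (2 * (w + zeta32) * (1 + norm s)) * (2 * (1 + norm s))"
      proof (rule mult_right_mono)
        show "?c \<le> 2 * (w + zeta32) * (1 + norm s)"
          using w1 zeta32_ge_1 mult_nonneg_nonneg[of w "norm s"] mult_nonneg_nonneg[of zeta32 "norm s"] by (simp add: algebra_simps)
      qed auto
      also have "\<dots> = 4 * (w + zeta32) * (1 + norm s) ^ 2" by (simp add: power2_eq_square algebra_simps)
      finally have "norm (W s - W 2) \<le> 4 * (w + zeta32) * (1 + norm s) ^ 2"
        using w1 zeta32_ge_1 by (simp add: mult_left_mono)
      moreover have "norm (W s + k) \<le> norm (W s - W 2) + norm (W 2 + k)"
        using norm_triangle_ineq[of "W s - W 2" "W 2 + k"] by simp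
      moreover have "norm (W 2 + k) * 1 \<le> norm (W 2 + k) * (1 + norm s) ^ 2" using sq by (intro mult_left_mono) auto
      ultimately show ?thesis by (simp add: distrib_right)
    qed
    have "norm (F s) \<le> norm (H s) + norm (trivial.prime_square_part s) + norm (W s + k)"
      unfolding F_def using norm_triangle_ineq[of "H s - trivial.prime_square_part s" "W s + k"]
        norm_triangle_ineq4[of "H s" "trivial.prime_square_part s"] by linarith
    also have "\<dots> \<le> M * (1 + norm s) ^ 2" unfolding M_def using 1 2 3 by (simp only: distrib_right)
    finally show ?thesis .
  qed
  show thesis
  proof (rule that[of "10000 * M" "F 1"])
    show "10000 * M > 0" using M1 by simp
    show "norm (\<Sum>n<N. prime_density_error n) \<le> 10000 * M * real N powr (15/16)" for N
      by (rule newman_summatory[OF norm_prime_density_error Fsums Fhol Fbd M1])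
    show "norm ((\<Sum>n<N. prime_density_error n / of_nat (Suc n)) - F 1) \<le> 10000 * M * real N powr (-1/16)" if "N \<ge> 1" for N
    proof -
      have "norm ((\<Sum>n<N. prime_density_error n / of_nat (Suc n)) - F 1) \<le> 1300 * M * real N powr (-1/16)"
        by (rule newman_quantitative[OF norm_prime_density_error Fsums Fhol Fbd M1 that])
      also have "\<dots> \<le> 10000 * M * real N powr (-1/16)" using M1 by (intro mult_right_mono) auto
      finally show ?thesis .
    qed
  qed
qed

section \<open>The prime number theorem and Mertens' theorem\<close>

definition prime_count :: "real \<Rightarrow> real" where
  "prime_count y = real (card {p. prime p \<and> real p \<le> y})"

definition log_sum :: "nat \<Rightarrow> real" where
  "log_sum N = (\<Sum>n<N. if n = 0 then 0 else 1 / ln (real (Suc n)))"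

definition log_recip_sum :: "nat \<Rightarrow> real" where
  "log_recip_sum N = (\<Sum>n<N. if n = 0 then 0 else 1 / (real (Suc n) * ln (real (Suc n))))"

lemma finite_primes_le: "finite {p. prime p \<and> real p \<le> y}"
proof (rule finite_subset)
  show "{p. prime p \<and> real p \<le> y} \<subseteq> {..nat \<lfloor>y\<rfloor>}" by (auto simp: le_nat_floor)
qed simp

lemma primes_le_floor:
  assumes "y \<ge> 0" shows "{p. prime p \<and> real p \<le> y} = {p. prime p \<and> p \<le> nat \<lfloor>y\<rfloor>}"
  using assms by (auto simp: le_nat_iff le_floor_iff)

lemma prime_count_nonneg: "prime_count y \<ge> 0"
  by (simp add: prime_count_def)

lemma prime_count_le:
  assumes "y \<ge> 0" shows "prime_count y \<le> y"
proof -
  have "card {p. prime p \<and> p \<le> nat \<lfloor>y\<rfloor>} \<le> card {1..nat \<lfloor>y\<rfloor>}"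
    by (intro card_mono) (auto dest: prime_ge_1_nat)
  hence "prime_count y \<le> real (nat \<lfloor>y\<rfloor>)"
    unfolding prime_count_def primes_le_floor[OF assms] by (intro of_nat_mono) simp
  also have "\<dots> \<le> y" using assms by linarith
  finally show ?thesis .
qed

lemma sum_prime_density_error:
  "(\<Sum>n<N. prime_density_error n) = of_real (prime_count (real N) - log_sum N)"
proof -
  have "(\<Sum>n<N. prime_density_error n) = (\<Sum>n<N. if prime (Suc n) then 1 else 0) - of_real (log_sum N)"
    unfolding prime_density_error_def sum_subtractf log_sum_def of_real_sum by (simp add: if_distrib cong: if_cong)
  also have "(\<Sum>n<N. if prime (Suc n) then 1 else 0) = (\<Sum>p | prime p \<and> p \<le> N. 1 :: complex)"
    by (rule sum_lessThan_Suc_primes[of "\<lambda>_. 1"])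
  also have "\<dots> = of_real (prime_count (real N))" by (simp add: prime_count_def)
  finally show ?thesis by simp
qed

lemma sum_prime_density_error_weighted:
  "(\<Sum>n<N. prime_density_error n / of_nat (Suc n)) = of_real ((\<Sum>p | prime p \<and> p \<le> N. 1 / real p) - log_recip_sum N)"
proof -
  have "(\<Sum>n<N. prime_density_error n / of_nat (Suc n)) =
     (\<Sum>n<N. (if prime (Suc n) then 1 / of_nat (Suc n) else 0) - of_real (if n = 0 then 0 else 1 / (real (Suc n) * ln (real (Suc n)))))"
    by (intro sum.cong) (auto simp: prime_density_error_def diff_divide_distrib simp del: of_nat_Suc)
  also have "\<dots> = (\<Sum>n<N. if prime (Suc n) then 1 / of_nat (Suc n) else 0) - of_real (log_recip_sum N)"
    unfolding sum_subtractf log_recip_sum_def of_real_sum by simp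
  also have "(\<Sum>n<N. if prime (Suc n) then 1 / of_nat (Suc n) else 0) = (\<Sum>p | prime p \<and> p \<le> N. 1 / of_nat p :: complex)"
    by (rule sum_lessThan_Suc_primes[of "\<lambda>p. 1 / of_nat p"])
  finally show ?thesis by simp
qed

lemma log_sum_ge:
  assumes "N \<ge> 2" shows "log_sum N \<ge> (real N - 1) / ln (real N)"
proof -
  have "(real N - 1) / ln (real N) = (\<Sum>n\<in>{1..<N}. 1 / ln (real N))" using assms by (simp add: of_nat_diff)
  also have "\<dots> \<le> (\<Sum>n\<in>{1..<N}. 1 / ln (real (Suc n)))"
  proof (rule sum_mono)
    fix n assume n: "n \<in> {1..<N}"
    have "0 < ln (real (Suc n))" "ln (real (Suc n)) \<le> ln (real N)" using n by auto
    thus "1 / ln (real N) \<le> 1 / ln (real (Suc n))" by (intro frac_le) auto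
  qed
  also have "\<dots> = (\<Sum>n\<in>{1..<N}. if n = 0 then 0 else 1 / ln (real (Suc n)))" by (intro sum.cong) auto
  also have "\<dots> \<le> log_sum N" unfolding log_sum_def
    by (intro sum_mono2) auto
  finally show ?thesis .
qed

text \<open>Terms belonging to integers up to M are at most 1 / ln 2 \<le> 2, the others at most 1 /
  ln M.\<close>

lemma log_sum_le:
  assumes "M > 1" shows "log_sum N \<le> 2 * M + real N / ln M"
proof -
  have lnM: "ln M > 0" using assms by simp
  have "log_sum N \<le> (\<Sum>n<N. (if real (Suc n) \<le> M then 2 else 0) + 1 / ln M)"
    unfolding log_sum_def
  proof (rule sum_mono)
    fix n
    consider "n = 0" | "n > 0" "real (Suc n) \<le> M" | "n > 0" "real (Suc n) > M" by linarith
    thus "(if n = 0 then 0 else 1 / ln (real (Suc n))) \<le> (if real (Suc n) \<le> M then 2 else 0) + 1 / ln M"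
    proof cases
      case 1 thus ?thesis using lnM by simp
    next
      case 2
      have "ln (real (Suc n)) \<ge> ln 2" using 2 by (subst ln_le_cancel_iff) auto
      hence "ln (real (Suc n)) \<ge> 1/2" using ln_2_ge_half by linarith
      hence "1 / ln (real (Suc n)) \<le> 1 / (1/2)" by (intro frac_le) auto
      hence "1 / ln (real (Suc n)) \<le> 2" by simp
      moreover have "1 / ln M > 0" using lnM by simp
      ultimately have "1 / ln (real (Suc n)) \<le> 2 + 1 / ln M" by linarith
      thus ?thesis using 2 by simp
    next
      case 3
      hence "ln M \<le> ln (real (Suc n))" using assms by (subst ln_le_cancel_iff) auto
      hence "1 / ln (real (Suc n)) \<le> 1 / ln M" using lnM by (intro frac_le) auto
      thus ?thesis using 3 by simp
    qed
  qed
  also have "\<dots> = (\<Sum>n | n < N \<and> real (Suc n) \<le> M. 2) + real N * (1 / ln M)"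
    unfolding sum.distrib by (simp add: sum.If_cases Int_def)
  also have "(\<Sum>n | n < N \<and> real (Suc n) \<le> M. 2) \<le> 2 * M"
  proof -
    have "{n. n < N \<and> real (Suc n) \<le> M} \<subseteq> {..<nat \<lfloor>M\<rfloor>}"
    proof
      fix n assume "n \<in> {n. n < N \<and> real (Suc n) \<le> M}"
      hence "Suc n \<le> nat \<lfloor>M\<rfloor>" by (simp add: le_nat_floor del: of_nat_Suc)
      thus "n \<in> {..<nat \<lfloor>M\<rfloor>}" by simp
    qed
    hence "card {n. n < N \<and> real (Suc n) \<le> M} \<le> nat \<lfloor>M\<rfloor>" using card_mono by (metis card_lessThan finite_lessThan)
    hence "real (card {n. n < N \<and> real (Suc n) \<le> M}) \<le> M" using assms by linarith
    thus ?thesis by simp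
  qed
  finally show ?thesis by simp
qed

text \<open>The power saving compares \<open>prime_count\<close> with \<open>log_sum\<close>, and
  elementary bounds compare \<open>log_sum\<close> with y / ln y up to a relative error O(ln ln y /
  ln y). The exponent -1/2 leaves ample room and suffices for the limits taken later.\<close>

theorem prime_number_theorem:
  assumes "generalised_riemann_hypothesis"
  shows "eventually (\<lambda>y. \<bar>prime_count y - y / ln y\<bar> \<le> y / ln y * ln y powr (-1/2)) at_top"
proof -
  obtain C where C: "C > 0" "\<And>N. norm (\<Sum>n<N. prime_density_error n) \<le> C * real N powr (15/16)"
    using prime_density[OF assms] by metis
  have err: "\<bar>prime_count (real N) - log_sum N\<bar> \<le> C * real N powr (15/16)" for N
    using C(2)[of N] unfolding sum_prime_density_error norm_of_real .
  have floor: "prime_count y = prime_count (real (nat \<lfloor>y\<rfloor>))" if "y \<ge> 0" for y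
    using that unfolding prime_count_def by (subst (1 2) primes_le_floor) auto
  have low: "prime_count y \<ge> (y - 2) / ln y - C * y powr (15/16)" if y: "y \<ge> 3" for y
  proof -
    define N where "N = nat \<lfloor>y\<rfloor>"
    have N: "N \<ge> 2" "real N \<le> y" "y \<le> real N + 1" using y unfolding N_def by linarith+
    have "(y - 2) / ln y \<le> (real N - 1) / ln (real N)" using N by (intro frac_le) auto
    also have "\<dots> \<le> log_sum N" by (rule log_sum_ge[OF N(1)])
    also have "\<dots> \<le> prime_count (real N) + C * real N powr (15/16)" using err[of N] by linarith
    also have "real N powr (15/16) \<le> y powr (15/16)" using N by (intro powr_mono2) auto
    finally show ?thesis using floor[of y] y C(1) by (simp add: N_def)
  qed
  \<comment> \<open>With the split point y / (ln y)^2 the small integers contribute O(y / (ln y)^2),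
    while the logarithm of the split point is still ln y - 2 ln ln y.\<close>
  have up: "prime_count y \<le> 2 * (y / ln y ^ 2) + y / ln (y / ln y ^ 2) + C * y powr (15/16)"
    if y: "y \<ge> 1" "y / ln y ^ 2 > 1" for y
  proof -
    define N where "N = nat \<lfloor>y\<rfloor>"
    have N: "real N \<le> y" using y unfolding N_def by linarith
    have "prime_count y = prime_count (real N)" using floor[of y] y by (simp add: N_def)
    also have "\<dots> \<le> log_sum N + C * real N powr (15/16)" using err[of N] by linarith
    also have "log_sum N \<le> 2 * (y / ln y ^ 2) + real N / ln (y / ln y ^ 2)" by (rule log_sum_le[OF y(2)])
    also have "real N / ln (y / ln y ^ 2) \<le> y / ln (y / ln y ^ 2)" using N y(2) by (intro divide_right_mono) auto
    also have "real N powr (15/16) \<le> y powr (15/16)" using N by (intro powr_mono2) auto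
    finally show ?thesis using C(1) by simp
  qed
  have "eventually (\<lambda>y::real. y / ln y ^ 2 > 1) at_top" by real_asymp
  moreover have "eventually (\<lambda>y. y / ln y - y / ln y * ln y powr (-1/2) \<le> (y - 2) / ln y - C * y powr (15/16)) at_top"
    by real_asymp
  moreover have "eventually (\<lambda>y. 2 * (y / ln y ^ 2) + y / ln (y / ln y ^ 2) + C * y powr (15/16) \<le> y / ln y + y / ln y * ln y powr (-1/2)) at_top"
    by real_asymp
  ultimately show ?thesis using eventually_ge_at_top[of 3]
  proof eventually_elim
    case (elim y)
    thus ?case using low[of y] up[of y] by linarith
  qed
qed

lemma ln_ln_increment:
  fixes x :: real
  assumes "x > 1"
  shows "ln (ln (x + 1)) - ln (ln x) \<le> 1 / (x * ln x)"
    and "1 / ((x + 1) * ln (x + 1)) \<le> ln (ln (x + 1)) - ln (ln x)"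
proof -
  have "\<exists>\<xi>. x < \<xi> \<and> \<xi> < x + 1 \<and> ln (ln (x + 1)) - ln (ln x) = (x + 1 - x) * (1 / (\<xi> * ln \<xi>))"
  proof (rule MVT2)
    fix \<xi> assume "x \<le> \<xi>" "\<xi> \<le> x + 1"
    thus "((\<lambda>x. ln (ln x)) has_real_derivative 1 / (\<xi> * ln \<xi>)) (at \<xi>)"
      using assms by (auto intro!: derivative_eq_intros simp: field_simps)
  qed simp
  then obtain \<xi> where \<xi>: "x < \<xi>" "\<xi> < x + 1" "ln (ln (x + 1)) - ln (ln x) = 1 / (\<xi> * ln \<xi>)" by auto
  have "x * ln x \<le> \<xi> * ln \<xi>" "\<xi> * ln \<xi> \<le> (x + 1) * ln (x + 1)" "0 < x * ln x"
    using \<xi> assms by (auto intro!: mult_mono)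
  thus "ln (ln (x + 1)) - ln (ln x) \<le> 1 / (x * ln x)"
    "1 / ((x + 1) * ln (x + 1)) \<le> ln (ln (x + 1)) - ln (ln x)"
    unfolding \<xi>(3) by (auto intro!: frac_le)
qed

lemma log_recip_sum_bounds:
  assumes "N \<ge> 2"
  shows "ln (ln (real N + 1)) - ln (ln 2) \<le> log_recip_sum N"
    and "log_recip_sum N \<le> ln (ln (real N)) - ln (ln 2) + 1"
proof -
  have "ln (ln (real N + 1)) - ln (ln 2) \<le> log_recip_sum N \<and> log_recip_sum N \<le> ln (ln (real N)) - ln (ln 2) + 1"
    using assms
  proof (induction N rule: dec_induct)
    case base
    have s2: "{..<2::nat} = {0, 1}" by auto
    have "log_recip_sum 2 = 1 / (2 * ln 2)" by (simp add: log_recip_sum_def s2 numeral_2_eq_2[symmetric])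
    moreover have "1 / (2 * ln (2::real)) \<le> 1 / 1" using ln_2_ge_half by (intro frac_le) auto
    ultimately show ?case using ln_ln_increment(1)[of 2] by simp
  next
    case (step N)
    have "log_recip_sum (Suc N) = log_recip_sum N + 1 / ((real N + 1) * ln (real N + 1))"
      using step.hyps by (simp add: log_recip_sum_def add.commute)
    thus ?case using step ln_ln_increment(1)[of "real N + 1"] ln_ln_increment(2)[of "real N"] by (simp add: add.commute add.left_commute)
  qed
  thus "ln (ln (real N + 1)) - ln (ln 2) \<le> log_recip_sum N"
    "log_recip_sum N \<le> ln (ln (real N)) - ln (ln 2) + 1" by auto
qed

text \<open>The weighted sums of the density error are bounded because they converge, and
  \<open>log_recip_sum\<close> follows ln ln by telescoping.\<close>

theorem mertens:
  assumes "generalised_riemann_hypothesis"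
  obtains C where "\<And>x. x \<ge> 2 \<Longrightarrow> \<bar>(\<Sum>p | prime p \<and> real p \<le> x. 1 / real p) - ln (ln x)\<bar> \<le> C"
proof -
  obtain C c where C: "C > 0" "\<And>N. N \<ge> 1 \<Longrightarrow> norm ((\<Sum>n<N. prime_density_error n / of_nat (Suc n)) - c) \<le> C * real N powr (-1/16)"
    using prime_density[OF assms] by metis
  define l where "l = \<bar>ln (ln (2::real))\<bar>"
  show thesis
  proof (rule that[of "norm c + C + l + 1"])
    fix x :: real assume x: "x \<ge> 2"
    define N where "N = nat \<lfloor>x\<rfloor>"
    have N: "N \<ge> 2" "real N \<le> x" "x \<le> real N + 1" using x unfolding N_def by linarith+
    let ?P = "\<Sum>p | prime p \<and> p \<le> N. 1 / real p"
    have "\<bar>?P - log_recip_sum N\<bar> = norm (\<Sum>n<N. prime_density_error n / of_nat (Suc n))"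
      unfolding sum_prime_density_error_weighted norm_of_real ..
    also have "\<dots> \<le> norm ((\<Sum>n<N. prime_density_error n / of_nat (Suc n)) - c) + norm c" by (metis add.commute norm_triangle_sub)
    also have "norm ((\<Sum>n<N. prime_density_error n / of_nat (Suc n)) - c) \<le> C * real N powr (-1/16)"
      using N by (intro C(2)) auto
    also have "C * real N powr (-1/16) \<le> C * 1"
      using C(1) N powr_mono[of "-1/16" 0 "real N"] by (intro mult_left_mono) auto
    finally have 1: "\<bar>?P - log_recip_sum N\<bar> \<le> norm c + C" by simp
    have 2: "ln (ln x) \<le> ln (ln (real N + 1))" "ln (ln (real N)) \<le> ln (ln x)"
      using N x by (auto simp: ln_gt_zero intro!: ln_mono)
    have "\<bar>log_recip_sum N - ln (ln x)\<bar> \<le> l + 1"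
      using log_recip_sum_bounds[OF N(1)] 2 unfolding l_def by linarith
    hence "\<bar>?P - ln (ln x)\<bar> \<le> norm c + C + l + 1" using 1 by linarith
    thus "\<bar>(\<Sum>p | prime p \<and> real p \<le> x. 1 / real p) - ln (ln x)\<bar> \<le> norm c + C + l + 1"
      using x by (simp add: primes_le_floor N_def)
  qed
qed

subsection \<open>Products of two primes\<close>

definition prime_pairs :: "real \<Rightarrow> (nat \<times> nat) set" where
  "prime_pairs x = {(p, q). prime p \<and> prime q \<and> real (p * q) \<le> x}"

definition pair_sum :: "real \<Rightarrow> (nat \<Rightarrow> real) \<Rightarrow> (nat \<Rightarrow> real) \<Rightarrow> real" where
  "pair_sum x a b = (\<Sum>(p, q)\<in>prime_pairs x. a p * b q)"

definition psum :: "(nat \<Rightarrow> real) \<Rightarrow> real \<Rightarrow> real" where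
  "psum a y = (\<Sum>p | prime p \<and> real p \<le> y. a p)"

lemma prime_pairs_bound:
  assumes "(p, q) \<in> prime_pairs x"
  shows "real p \<le> x" "real q \<le> x" "real p \<le> x / real q" "real q \<le> x / real p"
proof -
  have pq: "p \<ge> 1" "q \<ge> 1" "real p * real q \<le> x" using assms by (auto simp: prime_pairs_def dest: prime_ge_1_nat)
  show "real p \<le> x / real q" "real q \<le> x / real p" using pq by (auto simp: field_simps)
  have "real p * 1 \<le> real p * real q" "1 * real q \<le> real p * real q" using pq by (intro mult_mono; simp)+
  thus "real p \<le> x" "real q \<le> x" using pq by linarith+
qed

lemma finite_prime_pairs: "finite (prime_pairs x)"
proof (rule finite_subset)
  show "prime_pairs x \<subseteq> {p. prime p \<and> real p \<le> x} \<times> {p. prime p \<and> real p \<le> x}"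
    using prime_pairs_bound by (fastforce simp: prime_pairs_def)
qed (simp add: finite_primes_le)

lemma pair_sum_commute: "pair_sum x a b = pair_sum x b a"
proof -
  have "pair_sum x a b = (\<Sum>(p, q)\<in>prod.swap ` prime_pairs x. b p * a q)"
    unfolding pair_sum_def by (subst sum.reindex) (auto intro!: sum.cong simp: case_prod_beta)
  also have "prod.swap ` prime_pairs x = prime_pairs x"
    by (auto simp: prime_pairs_def image_iff mult.commute)
  finally show ?thesis by (simp add: pair_sum_def)
qed

lemma prime_pair_unique:
  fixes p q p' q' :: nat
  assumes "prime p" "prime q" "prime p'" "prime q'" "p \<le> q" "p' \<le> q'" "p * q = p' * q'"
  shows "p = p' \<and> q = q'"
proof -
  have "p dvd p' * q'" using assms by (metis dvd_triv_left)
  hence "p = p' \<or> p = q'" using assms by (metis prime_dvd_mult_iff primes_dvd_imp_eq)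
  thus ?thesis
  proof
    assume "p = p'"
    thus ?thesis using assms by (auto dest: prime_gt_0_nat)
  next
    assume pq': "p = q'"
    hence "q = p'" using assms by (auto dest: prime_gt_0_nat simp: mult.commute)
    thus ?thesis using pq' assms by simp
  qed
qed

text \<open>Unique factorisation gives a bijection with the pairs p \<le> q. The predicate A is a
  parameter so that prescribed character values and coprimality to d are counted by the same
  lemma.\<close>

lemma card_semiprimes:
  assumes "\<And>n. n \<in> X \<longleftrightarrow> real n \<le> x \<and> (\<exists>p q. prime p \<and> prime q \<and> n = p * q \<and> A p \<and> A q)"
  shows "card X = card {(p, q) \<in> prime_pairs x. p \<le> q \<and> A p \<and> A q}"
proof -
  let ?T = "{(p, q) \<in> prime_pairs x. p \<le> q \<and> A p \<and> A q}"
  have inj: "inj_on (\<lambda>(p, q). p * q) ?T"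
  proof (rule inj_onI, clarify)
    fix p q p' q' assume "(p, q) \<in> prime_pairs x" "p \<le> q" "(p', q') \<in> prime_pairs x" "p' \<le> q'" "p * q = p' * q'"
    thus "p = p' \<and> q = q'" by (intro prime_pair_unique) (auto simp: prime_pairs_def)
  qed
  have img: "(\<lambda>(p, q). p * q) ` ?T = X"
  proof (intro equalityI subsetI)
    fix n assume "n \<in> (\<lambda>(p, q). p * q) ` ?T"
    thus "n \<in> X" unfolding assms by (auto simp: prime_pairs_def)
  next
    fix n assume "n \<in> X"
    then obtain p q where pq: "real n \<le> x" "prime p" "prime q" "n = p * q" "A p" "A q" unfolding assms by blast
    show "n \<in> (\<lambda>(p, q). p * q) ` ?T"
    proof (cases "p \<le> q")
      case True
      hence "(p, q) \<in> ?T" using pq by (simp add: prime_pairs_def)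
      thus ?thesis using pq(4) by force
    next
      case False
      hence "(q, p) \<in> ?T" using pq by (simp add: prime_pairs_def mult.commute)
      hence "(\<lambda>(p, q). p * q) (q, p) \<in> (\<lambda>(p, q). p * q) ` ?T" by (rule imageI)
      thus ?thesis by (simp only: prod.case pq(4) mult.commute[of p q])
    qed
  qed
  show ?thesis unfolding img[symmetric] by (rule card_image[OF inj])
qed

text \<open>Swapping maps the pairs p \<le> q onto the pairs q \<le> p, and the two sets overlap in
  the diagonal, which stands for the squares of primes.\<close>

lemma card_ordered_pairs:
  "2 * real (card {(p, q) \<in> prime_pairs x. p \<le> q \<and> A p \<and> A q}) =
     pair_sum x (\<lambda>p. of_bool (A p)) (\<lambda>q. of_bool (A q)) + real (card {p. (p, p) \<in> prime_pairs x \<and> A p})"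
proof -
  let ?L = "{(p, q) \<in> prime_pairs x. p \<le> q \<and> A p \<and> A q}"
  let ?G = "{(p, q) \<in> prime_pairs x. q \<le> p \<and> A p \<and> A q}"
  let ?T = "{(p, q) \<in> prime_pairs x. A p \<and> A q}"
  have fin: "finite ?L" "finite ?G" by (rule finite_subset[OF _ finite_prime_pairs[of x]], auto)+
  have "?G = prod.swap ` ?L" by (auto simp: prime_pairs_def image_iff mult.commute)
  hence "card ?G = card ?L" by (simp add: card_image)
  moreover have "card ?L + card ?G = card (?L \<union> ?G) + card (?L \<inter> ?G)" by (rule card_Un_Int[OF fin])
  moreover have "?L \<union> ?G = ?T" by auto
  moreover have "?L \<inter> ?G = (\<lambda>p. (p, p)) ` {p. (p, p) \<in> prime_pairs x \<and> A p}" by auto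
  hence "card (?L \<inter> ?G) = card {p. (p, p) \<in> prime_pairs x \<and> A p}" by (simp add: card_image inj_on_def)
  moreover have "pair_sum x (\<lambda>p. of_bool (A p)) (\<lambda>q. of_bool (A q)) = real (card ?T)"
  proof -
    have "pair_sum x (\<lambda>p. of_bool (A p)) (\<lambda>q. of_bool (A q)) = (\<Sum>z\<in>prime_pairs x. if z \<in> ?T then 1 else 0)"
      unfolding pair_sum_def by (intro sum.cong) auto
    also have "\<dots> = real (card (prime_pairs x \<inter> ?T))"
      by (simp add: sum.If_cases[OF finite_prime_pairs] Collect_conj_eq)
    also have "prime_pairs x \<inter> ?T = ?T" by auto
    finally show ?thesis .
  qed
  ultimately show ?thesis by simp
qed

lemma card_diagonal_le:
  assumes "x \<ge> 0" shows "real (card {p. (p, p) \<in> prime_pairs x \<and> A p}) \<le> sqrt x"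
proof -
  have "{p. (p, p) \<in> prime_pairs x \<and> A p} \<subseteq> {p. prime p \<and> real p \<le> sqrt x}"
    by (auto simp: prime_pairs_def real_le_rsqrt power2_eq_square)
  hence "card {p. (p, p) \<in> prime_pairs x \<and> A p} \<le> card {p. prime p \<and> real p \<le> sqrt x}"
    by (intro card_mono finite_primes_le)
  hence "real (card {p. (p, p) \<in> prime_pairs x \<and> A p}) \<le> prime_count (sqrt x)"
    unfolding prime_count_def by simp
  also have "\<dots> \<le> sqrt x" using assms by (intro prime_count_le) auto
  finally show ?thesis .
qed

lemma pair_sum_iterated:
  "pair_sum x a b = (\<Sum>p | prime p \<and> real p \<le> x. a p * psum b (x / real p))"
proof -
  have eq: "prime_pairs x = (SIGMA p:{p. prime p \<and> real p \<le> x}. {q. prime q \<and> real q \<le> x / real p})"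
  proof (intro equalityI subsetI)
    fix z assume "z \<in> prime_pairs x"
    thus "z \<in> (SIGMA p:{p. prime p \<and> real p \<le> x}. {q. prime q \<and> real q \<le> x / real p})"
      using prime_pairs_bound by (cases z) (auto simp: prime_pairs_def)
  next
    fix z assume "z \<in> (SIGMA p:{p. prime p \<and> real p \<le> x}. {q. prime q \<and> real q \<le> x / real p})"
    thus "z \<in> prime_pairs x" by (cases z) (auto simp: prime_pairs_def field_simps dest: prime_gt_0_nat)
  qed
  show ?thesis unfolding pair_sum_def eq psum_def
    by (subst sum.Sigma[symmetric]) (auto simp: finite_primes_le sum_distrib_left)
qed

text \<open>Only pairs with a small first prime matter when the sums of \<open>a\<close> over primes are small:
  for the other pairs one sums over the first prime first.\<close>

lemma pair_sum_truncate:
  assumes A: "\<And>y. y \<ge> 0 \<Longrightarrow> y \<le> x \<Longrightarrow> \<bar>psum a y\<bar> \<le> E * y powr (15/16)" and E: "E \<ge> 0"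
    and b: "\<And>q. prime q \<Longrightarrow> \<bar>b q\<bar> \<le> 1" and z: "1 \<le> z" "z \<le> x"
  shows "\<bar>pair_sum x a b - (\<Sum>p | prime p \<and> real p \<le> z. a p * psum b (x / real p))\<bar> \<le> 34 * E * x * z powr (-1/16)"
proof -
  define a' where "a' = (\<lambda>p. if real p \<le> z then a p else 0)"
  define a'' where "a'' = (\<lambda>p. if real p \<le> z then 0 else a p)"
  have split: "pair_sum x a b = pair_sum x a' b + pair_sum x a'' b"
    unfolding pair_sum_def by (subst sum.distrib[symmetric]) (auto intro!: sum.cong simp: a'_def a''_def)
  have fst: "pair_sum x a' b = (\<Sum>p | prime p \<and> real p \<le> z. a p * psum b (x / real p))"
    unfolding pair_sum_iterated using z
    by (intro sum.mono_neutral_cong_right finite_primes_le) (auto simp: a'_def)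
  \<comment> \<open>The primes in (z, x / q] form a difference of two initial segments, hence the
    factor 2. The range is empty unless q \<le> x / z.\<close>
  have inner: "\<bar>psum a'' (x / real q)\<bar> \<le> (if real q \<le> x / z then 2 * E * (x / real q) powr (15/16) else 0)"
    if q: "prime q" for q
  proof (cases "real q \<le> x / z")
    case True
    have q1: "real q \<ge> 1" using prime_ge_1_nat[OF q] by simp
    have zx: "z \<le> x / real q" using True q1 z by (simp add: field_simps)
    have xq: "x / real q \<le> x" using q1 z by (simp add: field_simps mult_le_cancel_left1)
    have "psum a (x / real q) = psum a'' (x / real q) + psum a z"
    proof -
      have "psum a (x / real q) = psum a'' (x / real q) + psum a' (x / real q)"
        unfolding psum_def by (subst sum.distrib[symmetric]) (auto intro!: sum.cong simp: a'_def a''_def)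
      also have "psum a' (x / real q) = psum a z"
        unfolding psum_def using zx by (intro sum.mono_neutral_cong_right finite_primes_le) (auto simp: a'_def)
      finally show ?thesis .
    qed
    moreover have "\<bar>psum a (x / real q)\<bar> \<le> E * (x / real q) powr (15/16)" using z xq by (intro A) auto
    moreover have "\<bar>psum a z\<bar> \<le> E * (x / real q) powr (15/16)"
    proof -
      have "\<bar>psum a z\<bar> \<le> E * z powr (15/16)" using z by (intro A) auto
      also have "\<dots> \<le> E * (x / real q) powr (15/16)" using zx z E by (intro mult_left_mono powr_mono2) auto
      finally show ?thesis .
    qed
    ultimately show ?thesis using True by simp
  next
    case False
    have "x / real q < z" using False z prime_gt_0_nat[OF q] by (simp add: field_simps)
    hence "psum a'' (x / real q) = 0" unfolding psum_def by (intro sum.neutral) (auto simp: a''_def)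
    thus ?thesis using False by simp
  qed
  \<comment> \<open>Now the large p are summed innermost, so the hypothesis on \<open>psum a\<close>
    applies to them and b is estimated trivially.\<close>
  have "\<bar>pair_sum x a'' b\<bar> = \<bar>\<Sum>q | prime q \<and> real q \<le> x. b q * psum a'' (x / real q)\<bar>"
    by (subst pair_sum_commute, subst pair_sum_iterated) (rule refl)
  also have "\<dots> \<le> (\<Sum>q | prime q \<and> real q \<le> x. \<bar>b q * psum a'' (x / real q)\<bar>)" by (rule sum_abs)
  also have "\<dots> \<le> (\<Sum>q | prime q \<and> real q \<le> x. if real q \<le> x / z then 2 * E * (x / real q) powr (15/16) else 0)"
  proof (rule sum_mono)
    fix q assume "q \<in> {q. prime q \<and> real q \<le> x}"
    hence q: "prime q" by simp
    have "\<bar>b q * psum a'' (x / real q)\<bar> \<le> 1 * \<bar>psum a'' (x / real q)\<bar>"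
      unfolding abs_mult by (intro mult_right_mono b q) auto
    thus "\<bar>b q * psum a'' (x / real q)\<bar> \<le> (if real q \<le> x / z then 2 * E * (x / real q) powr (15/16) else 0)"
      using inner[OF q] by linarith
  qed
  also have "\<dots> = (\<Sum>q | prime q \<and> real q \<le> x / z. 2 * E * (x / real q) powr (15/16))"
  proof -
    have "x / z \<le> x" using z by (simp add: field_simps mult_le_cancel_left1)
    thus ?thesis by (intro sum.mono_neutral_cong_right finite_primes_le) auto
  qed
  also have "\<dots> = 2 * E * x powr (15/16) * (\<Sum>q | prime q \<and> real q \<le> x / z. real q powr (-15/16))"
    unfolding sum_distrib_left using z by (intro sum.cong) (auto simp: powr_divide powr_minus field_simps)
  \<comment> \<open>17 = 16 + 1 comes from \<open>partial_powr_bound\<close> with exponent 1/16;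
    together with the factor 2 it gives the 34.\<close>
  also have "(\<Sum>q | prime q \<and> real q \<le> x / z. real q powr (-15/16)) \<le> 17 * (x / z) powr (1/16)"
  proof -
    define N where "N = nat \<lfloor>x / z\<rfloor>"
    have N: "N \<ge> 1" "real N \<le> x / z"
    proof -
      have "1 \<le> x / z" using z by simp
      thus "N \<ge> 1" "real N \<le> x / z" unfolding N_def by linarith+
    qed
    have "(\<Sum>q | prime q \<and> real q \<le> x / z. real q powr (-15/16)) = (\<Sum>q | prime q \<and> q \<le> N. real q powr (-15/16))"
      using z by (simp add: primes_le_floor N_def)
    also have "\<dots> = (\<Sum>n<N. if prime (Suc n) then real (Suc n) powr (-15/16) else 0)"
      by (rule sum_lessThan_Suc_primes[symmetric])
    also have "\<dots> \<le> (\<Sum>n<N. real (Suc n) powr (1/16 - 1))" by (intro sum_mono) auto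
    also have "\<dots> \<le> real N powr (1/16) * (1 / (1/16) + 1 / real N)" by (rule partial_powr_bound) (use N in auto)
    also have "\<dots> \<le> real N powr (1/16) * 17"
    proof -
      have "1 / real N \<le> 1" using N by simp
      thus ?thesis by (intro mult_left_mono) auto
    qed
    also have "real N powr (1/16) \<le> (x / z) powr (1/16)" using N by (intro powr_mono2) auto
    finally show ?thesis by simp
  qed
  also have "2 * E * x powr (15/16) * (17 * (x / z) powr (1/16)) = 34 * E * (x powr (15/16) * x powr (1/16)) * z powr (-1/16)"
    using z by (simp add: powr_divide powr_minus field_simps)
  also have "x powr (15/16) * x powr (1/16) = x" using z by (simp add: powr_add[symmetric])
  finally have "\<bar>pair_sum x a'' b\<bar> \<le> 34 * E * x * z powr (-1/16)" using E z by (simp add: mult_left_mono)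
  thus ?thesis using split fst by simp
qed

text \<open>An integer with k distinct prime factors is at least 2^k; the factor 2 is 1 / ln 2
  rounded up.\<close>

lemma card_prime_divisors_le:
  assumes "d > 0" shows "real (card {p. prime p \<and> p dvd d}) \<le> 2 * ln (real d)"
proof -
  have eq: "{p. prime p \<and> p dvd d} = prime_factors d" using assms by (auto simp: in_prime_factors_iff)
  have "2 ^ card (prime_factors d) = (\<Prod>p\<in>prime_factors d. 2::nat)" by simp
  also have "\<dots> \<le> (\<Prod>p\<in>prime_factors d. p ^ multiplicity p d)"
  proof (rule prod_mono, safe)
    fix p assume p: "p \<in> prime_factors d"
    have "2 \<le> p ^ 1" using prime_ge_2_nat[OF in_prime_factors_imp_prime[OF p]] by simp
    also have "\<dots> \<le> p ^ multiplicity p d"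
      using p by (intro power_increasing) (auto simp: prime_factors_multiplicity dest: prime_ge_1_nat)
    finally show "2 \<le> p ^ multiplicity p d" .
  qed
  also have "\<dots> = d" using prod_prime_factors[of d] assms by simp
  finally have "real (2 ^ card (prime_factors d)) \<le> real d" by (rule of_nat_mono)
  hence "ln (2 ^ card (prime_factors d)) \<le> ln (real d)" using assms by (subst ln_le_cancel_iff) auto
  hence "real (card (prime_factors d)) * ln 2 \<le> ln (real d)" by (simp add: ln_realpow)
  moreover have "real (card (prime_factors d)) * (1/2) \<le> real (card (prime_factors d)) * ln 2"
    using ln_2_ge_half by (intro mult_left_mono) auto
  ultimately show ?thesis unfolding eq by linarith
qed

lemma quadratic_character_real:
  assumes "quadratic_character d \<psi>"
  shows "\<psi> n = of_real (Re (\<psi> n))" "Re (\<psi> n) = 0 \<or> Re (\<psi> n) = 1 \<or> Re (\<psi> n) = -1"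
    "\<bar>Re (\<psi> n)\<bar> = of_bool (coprime n d)" "\<bar>Re (\<psi> n)\<bar> \<le> 1"
proof -
  consider "coprime n d" "\<psi> n = 1" | "coprime n d" "\<psi> n = -1" | "\<not> coprime n d" "\<psi> n = 0"
    using quadratic_character_values[OF assms, of n] by (auto split: if_splits)
  hence "\<psi> n = of_real (Re (\<psi> n)) \<and> (Re (\<psi> n) = 0 \<or> Re (\<psi> n) = 1 \<or> Re (\<psi> n) = -1) \<and>
    \<bar>Re (\<psi> n)\<bar> \<le> 1 \<and> \<bar>Re (\<psi> n)\<bar> = of_bool (coprime n d)"
    by cases simp_all
  thus "\<psi> n = of_real (Re (\<psi> n))" "Re (\<psi> n) = 0 \<or> Re (\<psi> n) = 1 \<or> Re (\<psi> n) = -1" "\<bar>Re (\<psi> n)\<bar> \<le> 1"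
    "\<bar>Re (\<psi> n)\<bar> = of_bool (coprime n d)" by blast+
qed

text \<open>Here \<open>\<bar>r n\<bar>\<close> is the principal character modulo d. Twice each
  unordered count is an ordered sum plus the diagonal, and the diagonal is the source of
  \<open>sqrt x\<close>.\<close>

lemma semiprime_counts:
  assumes \<psi>: "quadratic_character d \<psi>" and \<eta>: "\<eta> \<in> {-1, 1}" and x: "x \<ge> 0"
  defines "r \<equiv> (\<lambda>n. Re (\<psi> n))"
  shows "\<bar>4 * real (card (semiprimes_with_values \<psi> \<eta> x)) - real (card (semiprimes_coprime_to d x))
           - Re \<eta> * pair_sum x r (\<lambda>n. \<bar>r n\<bar>)\<bar> \<le> \<bar>pair_sum x r r\<bar> + 4 * sqrt x"
proof -
  note real = quadratic_character_real[OF \<psi>]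
  define e where "e = Re \<eta>"
  have e: "\<eta> = of_real e" "e = 1 \<or> e = -1" using \<eta> by (auto simp: e_def)
  define A where "A = (\<lambda>n. \<psi> n = \<eta>)"
  have A: "of_bool (A n) = (\<bar>r n\<bar> + e * r n) / 2" for n
  proof -
    have "A n \<longleftrightarrow> r n = e" unfolding A_def r_def using real(1)[of n] e(1) by (metis of_real_eq_iff)
    thus ?thesis using real(2)[of n] e(2) unfolding r_def by auto
  qed
  have B: "of_bool (coprime n d) = \<bar>r n\<bar>" for n using real(3)[of n] by (simp add: r_def)
  have card_A: "card (semiprimes_with_values \<psi> \<eta> x) = card {(p, q) \<in> prime_pairs x. p \<le> q \<and> A p \<and> A q}"
    by (rule card_semiprimes) (auto simp: semiprimes_with_values_def A_def)
  have card_B: "card (semiprimes_coprime_to d x) = card {(p, q) \<in> prime_pairs x. p \<le> q \<and> coprime p d \<and> coprime q d}"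
    by (rule card_semiprimes) (auto simp: semiprimes_coprime_to_def)
  note cA = card_ordered_pairs[of x A, folded card_A]
  note cB = card_ordered_pairs[of x "\<lambda>n. coprime n d", folded card_B]
  define DA where "DA = real (card {p. (p, p) \<in> prime_pairs x \<and> A p})"
  define DB where "DB = real (card {p. (p, p) \<in> prime_pairs x \<and> coprime p d})"
  have DA: "0 \<le> DA" "DA \<le> sqrt x" using card_diagonal_le[OF x, of A] by (auto simp: DA_def)
  have DB: "0 \<le> DB" "DB \<le> sqrt x" using card_diagonal_le[OF x, of "\<lambda>n. coprime n d"] by (auto simp: DB_def)
  have ee: "e * e = 1" using e(2) by auto
  have "pair_sum x (\<lambda>p. of_bool (A p)) (\<lambda>q. of_bool (A q)) =
     (pair_sum x (\<lambda>n. \<bar>r n\<bar>) (\<lambda>n. \<bar>r n\<bar>) + e * pair_sum x r (\<lambda>n. \<bar>r n\<bar>) + e * pair_sum x (\<lambda>n. \<bar>r n\<bar>) r + pair_sum x r r) / 4"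
  proof -
    have "of_bool (A p) * of_bool (A q) = (\<bar>r p\<bar> * \<bar>r q\<bar> + e * (r p * \<bar>r q\<bar>) + e * (\<bar>r p\<bar> * r q) + (e * e) * (r p * r q)) / 4" for p q
      unfolding A by (simp add: algebra_simps)
    thus ?thesis unfolding pair_sum_def ee sum_distrib_left sum.distrib[symmetric] sum_divide_distrib
      by (intro sum.cong) (auto simp: case_prod_beta)
  qed
  also have "pair_sum x (\<lambda>n. \<bar>r n\<bar>) r = pair_sum x r (\<lambda>n. \<bar>r n\<bar>)" by (rule pair_sum_commute)
  finally have PA: "pair_sum x (\<lambda>p. of_bool (A p)) (\<lambda>q. of_bool (A q)) =
     (pair_sum x (\<lambda>n. \<bar>r n\<bar>) (\<lambda>n. \<bar>r n\<bar>) + 2 * (e * pair_sum x r (\<lambda>n. \<bar>r n\<bar>)) + pair_sum x r r) / 4" by simp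
  have cA': "2 * real (card (semiprimes_with_values \<psi> \<eta> x)) = (pair_sum x (\<lambda>n. \<bar>r n\<bar>) (\<lambda>n. \<bar>r n\<bar>) + 2 * (e * pair_sum x r (\<lambda>n. \<bar>r n\<bar>)) + pair_sum x r r) / 4 + DA"
    unfolding cA PA DA_def ..
  have cB': "2 * real (card (semiprimes_coprime_to d x)) = pair_sum x (\<lambda>n. \<bar>r n\<bar>) (\<lambda>n. \<bar>r n\<bar>) + DB"
    unfolding cB B DB_def ..
  define X where "X = e * pair_sum x r (\<lambda>n. \<bar>r n\<bar>)"
  have "4 * real (card (semiprimes_with_values \<psi> \<eta> x)) - real (card (semiprimes_coprime_to d x)) - X
     = pair_sum x r r / 2 + 2 * DA - DB / 2"
  proof -
    define S0 where "S0 = pair_sum x (\<lambda>n. \<bar>r n\<bar>) (\<lambda>n. \<bar>r n\<bar>)"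
    show ?thesis using cA' cB' unfolding X_def[symmetric] S0_def[symmetric] by (simp add: field_simps)
  qed
  hence "\<bar>4 * real (card (semiprimes_with_values \<psi> \<eta> x)) - real (card (semiprimes_coprime_to d x)) - X\<bar> \<le> \<bar>pair_sum x r r\<bar> + 4 * sqrt x"
    using DA DB by (simp add: abs_if)
  thus ?thesis by (simp add: X_def e_def)
qed

lemma psum_character_bound:
  assumes grh: "generalised_riemann_hypothesis" and \<psi>: "quadratic_character d \<psi>" and d: "real d \<le> x" and y: "y \<ge> 0"
  shows "\<bar>psum (\<lambda>n. Re (\<psi> n)) y\<bar> \<le> quadratic_const * (1 + ln x) * y powr (15/16)"
proof -
  have d1: "d \<ge> 1" using \<psi> by (auto simp: quadratic_character_def primitive_character_def dirichlet_character_def)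
  have Q: "quadratic_const \<ge> 0" using zeta32_ge_1 by (simp add: quadratic_const_def)
  define N where "N = nat \<lfloor>y\<rfloor>"
  have N: "real N \<le> y" using y unfolding N_def by linarith
  have "of_real (psum (\<lambda>n. Re (\<psi> n)) y) = (\<Sum>p | prime p \<and> p \<le> N. \<psi> p)"
    unfolding psum_def primes_le_floor[OF y] N_def of_real_sum quadratic_character_real(1)[OF \<psi>, symmetric] ..
  hence "\<bar>psum (\<lambda>n. Re (\<psi> n)) y\<bar> = norm (\<Sum>p | prime p \<and> p \<le> N. \<psi> p)" by (metis norm_of_real)
  also have "\<dots> \<le> quadratic_const * (1 + ln (real d)) * real N powr (15/16)" by (rule quadratic_prime_sum[OF grh \<psi>])
  also have "\<dots> \<le> quadratic_const * (1 + ln x) * y powr (15/16)"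
  proof (intro mult_mono powr_mono2)
    have l: "ln (real d) \<le> ln x" using d d1 by (subst ln_le_cancel_iff) auto
    thus "1 + ln (real d) \<le> 1 + ln x" by simp
    have l0: "0 \<le> ln (real d)" using d1 by simp
    thus "0 \<le> 1 + ln (real d)" by simp
    show "0 \<le> quadratic_const * (1 + ln x)" using Q l l0 by simp
  qed (use Q N in auto)
  finally show ?thesis .
qed

text \<open>The truncation at \<open>(ln x)\<^sup>3\<^sup>2\<close> makes the factor \<open>z powr (-1/16)\<close> of the truncation error equal to
  \<open>(ln x)\<^sup>-\<^sup>2\<close>.\<close>

definition bias_main :: "(nat \<Rightarrow> complex) \<Rightarrow> real \<Rightarrow> real" where
  "bias_main \<psi> x = (\<Sum>p | prime p \<and> real p \<le> ln x ^ 32. Re (\<psi> p) * prime_count (x / real p))"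

text \<open>Truncation followed by replacing \<open>psum b\<close> by an approximation u. It serves
  both double sums: u is \<open>prime_count\<close> when b is the principal character, and 0 when b
  is the character itself.\<close>

lemma pair_sum_character:
  assumes grh: "generalised_riemann_hypothesis" and \<psi>: "quadratic_character d \<psi>" and d: "real d \<le> x"
    and x: "1 \<le> ln x" "ln x ^ 32 \<le> x" and b: "\<And>q. prime q \<Longrightarrow> \<bar>b q\<bar> \<le> 1"
    and C: "\<And>y. 0 \<le> y \<Longrightarrow> y \<le> x \<Longrightarrow> \<bar>psum b y - u y\<bar> \<le> K"
  shows "\<bar>pair_sum x (\<lambda>n. Re (\<psi> n)) b - (\<Sum>p | prime p \<and> real p \<le> ln x ^ 32. Re (\<psi> p) * u (x / real p))\<bar>
      \<le> 34 * quadratic_const * (1 + ln x) * x / ln x ^ 2 + ln x ^ 32 * K"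
proof -
  let ?r = "\<lambda>n. Re (\<psi> n)" and ?z = "ln x ^ 32"
  have Q: "quadratic_const \<ge> 0" using zeta32_ge_1 by (simp add: quadratic_const_def)
  have z1: "1 \<le> ?z" using x by (simp add: one_le_power)
  have "\<bar>pair_sum x ?r b - (\<Sum>p | prime p \<and> real p \<le> ?z. ?r p * psum b (x / real p))\<bar>
      \<le> 34 * (quadratic_const * (1 + ln x)) * x * ?z powr (-1/16)"
    by (rule pair_sum_truncate) (use psum_character_bound[OF grh \<psi> d] Q x z1 b in auto)
  also have "?z powr (-1/16) = 1 / ln x ^ 2"
  proof -
    have "?z powr (-1/16) = (ln x powr 32) powr (-1/16)" using x powr_realpow[of "ln x" 32] by simp
    also have "\<dots> = ln x powr (-2)" by (simp add: powr_powr)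
    also have "\<dots> = 1 / ln x ^ 2" using x powr_realpow[of "ln x" 2] by (simp add: powr_minus field_simps)
    finally show ?thesis .
  qed
  finally have 1: "\<bar>pair_sum x ?r b - (\<Sum>p | prime p \<and> real p \<le> ?z. ?r p * psum b (x / real p))\<bar>
      \<le> 34 * quadratic_const * (1 + ln x) * x / ln x ^ 2" by (simp add: mult.assoc)
  have K: "K \<ge> 0" using C[of 0] x z1 by (smt (verit) abs_ge_zero)
  have "\<bar>(\<Sum>p | prime p \<and> real p \<le> ?z. ?r p * psum b (x / real p)) - (\<Sum>p | prime p \<and> real p \<le> ?z. ?r p * u (x / real p))\<bar>
     = \<bar>\<Sum>p | prime p \<and> real p \<le> ?z. ?r p * (psum b (x / real p) - u (x / real p))\<bar>"
    by (simp add: sum_subtractf right_diff_distrib)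
  also have "\<dots> \<le> (\<Sum>p | prime p \<and> real p \<le> ?z. \<bar>?r p * (psum b (x / real p) - u (x / real p))\<bar>)" by (rule sum_abs)
  also have "\<dots> \<le> (\<Sum>p | prime p \<and> real p \<le> ?z. 1 * K)"
  proof (rule sum_mono)
    fix p assume "p \<in> {p. prime p \<and> real p \<le> ?z}"
    hence p1: "p \<ge> 1" by (auto dest: prime_ge_1_nat)
    have "0 \<le> x" using x z1 by linarith
    hence "0 \<le> x / real p" "x / real p \<le> x" using p1 by (auto simp: field_simps mult_le_cancel_left1)
    thus "\<bar>?r p * (psum b (x / real p) - u (x / real p))\<bar> \<le> 1 * K"
      unfolding abs_mult using quadratic_character_real(4)[OF \<psi>, of p] by (intro mult_mono C) auto
  qed
  also have "\<dots> = prime_count ?z * K" by (simp add: prime_count_def)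
  also have "\<dots> \<le> ?z * K" using K z1 by (intro mult_right_mono prime_count_le) auto
  finally have 2: "\<bar>(\<Sum>p | prime p \<and> real p \<le> ?z. ?r p * psum b (x / real p)) - (\<Sum>p | prime p \<and> real p \<le> ?z. ?r p * u (x / real p))\<bar> \<le> ?z * K" .
  show ?thesis using 1 2 by linarith
qed

text \<open>The first term collects two truncations with constant 34 each. It has size x / ln x,
  below the main term only by the factor ln ln ln x. The others come from primes dividing d, from
  the character sums paired with small primes, and from squares of primes; they save a power of
  x.\<close>

definition bias_error :: "real \<Rightarrow> real" where
  "bias_error x = 68 * quadratic_const * (1 + ln x) * x / ln x ^ 2
     + ln x ^ 32 * (2 * ln x) + ln x ^ 32 * (quadratic_const * (1 + ln x) * x powr (15/16)) + 4 * sqrt x"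

lemma bias_approximation:
  assumes grh: "generalised_riemann_hypothesis" and \<psi>: "quadratic_character d \<psi>" and d: "real d \<le> x"
    and x: "1 \<le> ln x" "ln x ^ 32 \<le> x" and \<eta>: "\<eta> \<in> {-1, 1}"
  shows "\<bar>4 * real (card (semiprimes_with_values \<psi> \<eta> x)) - real (card (semiprimes_coprime_to d x))
           - Re \<eta> * bias_main \<psi> x\<bar> \<le> bias_error x"
proof -
  let ?r = "\<lambda>n. Re (\<psi> n)"
  note real = quadratic_character_real[OF \<psi>]
  have Q: "quadratic_const \<ge> 0" using zeta32_ge_1 by (simp add: quadratic_const_def)
  have z1: "1 \<le> ln x ^ 32" using x by (simp add: one_le_power)
  have x0: "x \<ge> 1" using z1 x by linarith
  have d0: "d > 0" using \<psi> by (auto simp: quadratic_character_def primitive_character_def dirichlet_character_def)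
  have 1: "\<bar>pair_sum x ?r (\<lambda>n. \<bar>?r n\<bar>) - bias_main \<psi> x\<bar> \<le> 34 * quadratic_const * (1 + ln x) * x / ln x ^ 2 + ln x ^ 32 * (2 * ln x)"
    unfolding bias_main_def
  proof (rule pair_sum_character[OF grh \<psi> d x])
    fix y :: real assume y: "0 \<le> y" "y \<le> x"
    have "psum (\<lambda>n. \<bar>?r n\<bar>) y - prime_count y = - real (card {p. (prime p \<and> real p \<le> y) \<and> \<not> coprime p d})"
    proof -
      have "psum (\<lambda>n. \<bar>?r n\<bar>) y = (\<Sum>p | prime p \<and> real p \<le> y. 1 - of_bool (\<not> coprime p d))"
        unfolding psum_def real(3) by (intro sum.cong) auto
      also have "\<dots> = prime_count y - real (card {p. (prime p \<and> real p \<le> y) \<and> \<not> coprime p d})"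
        unfolding sum_subtractf using finite_primes_le[of y]
        by (simp add: prime_count_def of_bool_def sum.If_cases Int_def)
      finally show ?thesis by simp
    qed
    moreover have "card {p. (prime p \<and> real p \<le> y) \<and> \<not> coprime p d} \<le> card {p. prime p \<and> p dvd d}"
      using d0 by (intro card_mono) (auto dest: prime_imp_coprime_nat intro: finite_subset[of _ "{..d}"] simp: dvd_imp_le)
    hence "real (card {p. (prime p \<and> real p \<le> y) \<and> \<not> coprime p d}) \<le> 2 * ln (real d)"
      using card_prime_divisors_le[OF d0] by linarith
    moreover have "ln (real d) \<le> ln x" using d d0 by (subst ln_le_cancel_iff) auto
    ultimately show "\<bar>psum (\<lambda>n. \<bar>?r n\<bar>) y - prime_count y\<bar> \<le> 2 * ln x" by simp
  qed (use real(4) in auto)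
  have "\<bar>pair_sum x ?r ?r - (\<Sum>p | prime p \<and> real p \<le> ln x ^ 32. ?r p * (\<lambda>_. 0) (x / real p))\<bar>
      \<le> 34 * quadratic_const * (1 + ln x) * x / ln x ^ 2 + ln x ^ 32 * (quadratic_const * (1 + ln x) * x powr (15/16))"
  proof (rule pair_sum_character[OF grh \<psi> d x])
    fix y :: real assume y: "0 \<le> y" "y \<le> x"
    have "\<bar>psum ?r y\<bar> \<le> quadratic_const * (1 + ln x) * y powr (15/16)" by (rule psum_character_bound[OF grh \<psi> d y(1)])
    also have "\<dots> \<le> quadratic_const * (1 + ln x) * x powr (15/16)"
      using Q x y by (intro mult_left_mono powr_mono2) auto
    finally show "\<bar>psum ?r y - 0\<bar> \<le> quadratic_const * (1 + ln x) * x powr (15/16)" by simp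
  qed (use real(4) in auto)
  hence 2: "\<bar>pair_sum x ?r ?r\<bar> \<le> 34 * quadratic_const * (1 + ln x) * x / ln x ^ 2 + ln x ^ 32 * (quadratic_const * (1 + ln x) * x powr (15/16))"
    by simp
  have 3: "\<bar>Re \<eta> * pair_sum x ?r (\<lambda>n. \<bar>?r n\<bar>) - Re \<eta> * bias_main \<psi> x\<bar> \<le> 34 * quadratic_const * (1 + ln x) * x / ln x ^ 2 + ln x ^ 32 * (2 * ln x)"
    using 1 \<eta> by (auto simp: right_diff_distrib[symmetric] abs_mult abs_minus_commute)
  have 4: "68 * quadratic_const * (1 + ln x) * x / ln x ^ 2 = 2 * (34 * quadratic_const * (1 + ln x) * x / ln x ^ 2)" by simp
  show ?thesis unfolding bias_error_def 4 using semiprime_counts[OF \<psi> \<eta>, of x] x0 2 3 by linarith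
qed

subsection \<open>Uniform asymptotics\<close>

definition recip_sum :: "real \<Rightarrow> real" where
  "recip_sum t = (\<Sum>p | prime p \<and> real p \<le> t. 1 / real p)"

text \<open>The relative error of the prime number theorem at sqrt x. It is applied to arguments x /
  p with p \<le> sqrt x, for all of which it is an upper bound.\<close>

definition pnt_err :: "real \<Rightarrow> real" where
  "pnt_err x = (ln x / 2) powr (-1/2)"

lemma prime_count_uniform:
  assumes "generalised_riemann_hypothesis"
  shows "eventually (\<lambda>x. \<forall>y\<ge>sqrt x. \<bar>prime_count y - y / ln y\<bar> \<le> y / ln y * pnt_err x) at_top"
proof -
  from prime_number_theorem[OF assms] obtain y0 where
    y0: "\<And>y. y \<ge> y0 \<Longrightarrow> \<bar>prime_count y - y / ln y\<bar> \<le> y / ln y * ln y powr (-1/2)"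
    by (auto simp: eventually_at_top_linorder)
  have "eventually (\<lambda>x. sqrt x \<ge> max y0 2) at_top" by real_asymp
  thus ?thesis using eventually_ge_at_top[of 4]
  proof eventually_elim
    case (elim x)
    show ?case
    proof (intro allI impI)
      fix y assume y: "sqrt x \<le> y"
      hence y2: "y \<ge> y0" "y \<ge> 2" using elim by auto
      have "ln x / 2 = ln (sqrt x)" using elim by (simp add: ln_sqrt)
      also have "\<dots> \<le> ln y" using y elim by (subst ln_le_cancel_iff) auto
      finally have "ln y powr (-1/2) \<le> pnt_err x" unfolding pnt_err_def using elim by (intro powr_mono2') auto
      hence "y / ln y * ln y powr (-1/2) \<le> y / ln y * pnt_err x" using y2 by (intro mult_left_mono) auto
      thus "\<bar>prime_count y - y / ln y\<bar> \<le> y / ln y * pnt_err x" using y0[OF y2(1)] by linarith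
    qed
  qed
qed

text \<open>For p \<le> (ln x)^32 the logarithm of x / p is at least ln x - 32 ln ln x, and Mertens'
  theorem at (ln x)^32 gives the last factor.\<close>

definition main_upper :: "real \<Rightarrow> real \<Rightarrow> real" where
  "main_upper x C = (1 + pnt_err x) * (x / (ln x - 32 * ln (ln x))) * (ln (32 * ln (ln x)) + C)"

text \<open>Primes up to sqrt(ln x) count with sign +1, those from there to (ln x)^32 with the worst
  sign. The last bracket is bounded: the two logarithms in it differ by ln 64.\<close>

definition main_lower :: "real \<Rightarrow> real \<Rightarrow> real" where
  "main_lower x C = (1 - pnt_err x) * (x / ln x) * (ln (ln (sqrt (ln x))) - C)
     - (1 + pnt_err x) * (x / (ln x - 32 * ln (ln x))) * (ln (32 * ln (ln x)) - ln (ln (sqrt (ln x))) + 2 * C)"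

text \<open>The sums over primes are split at \<open>x powr (1 / ln (ln x))\<close>: up to there \<open>ln (x / p)\<close> is asymptotic
  to \<open>ln x\<close>, and the primes from there to \<open>sqrt x\<close> contribute \<open>ln (ln (ln x)) + O(1)\<close> only.\<close>

definition count_upper :: "real \<Rightarrow> real \<Rightarrow> real" where
  "count_upper x C = (1 + pnt_err x) * (x / (ln x - ln x / ln (ln x))) * (ln (ln x / ln (ln x)) + C)
      + (1 + pnt_err x) * (x / (ln x - ln x / 2)) * (ln (ln x / 2) - ln (ln x / ln (ln x)) + 2 * C)"

text \<open>The second line discounts the primes p dividing d. The third discounts, for each p up to
  \<open>x powr (1 / ln (ln x))\<close>, the primes q that are at most sqrt x or divide d.\<close>

definition count_lower :: "real \<Rightarrow> real \<Rightarrow> real" where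
  "count_lower x C = (1 - pnt_err x) * (x / ln x) * (ln (ln x / ln (ln x)) - C)
      - (1 + pnt_err x) * (x / (ln x - ln x / ln (ln x))) * (ln (ln (ln x)) + C + 2)
      - x powr (1 / ln (ln x)) * (sqrt x + 2 * ln x)"

text \<open>Collects what is used about one sufficiently large x, so that the estimates below are
  plain inequalities at that x and limits are taken only of explicit functions.\<close>

locale large_x =
  fixes x C :: real
  assumes x_gt: "x > 1"
    and pnt: "\<And>y. y \<ge> sqrt x \<Longrightarrow> \<bar>prime_count y - y / ln y\<bar> \<le> y / ln y * pnt_err x"
    and mert: "\<And>t. t \<ge> 2 \<Longrightarrow> \<bar>recip_sum t - ln (ln t)\<bar> \<le> C"
    and ln_ge: "ln x \<ge> 4" and ln_pow: "ln x ^ 32 \<le> sqrt x" and err1: "pnt_err x \<le> 1"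
    and w2: "sqrt (ln x) \<ge> 2" and v: "2 \<le> x powr (1 / ln (ln x))" "x powr (1 / ln (ln x)) \<le> sqrt x"
    and den: "ln x - 32 * ln (ln x) > 0" and lnln: "ln (ln x) \<ge> 2"
begin

lemma err0: "pnt_err x \<ge> 0" by (simp add: pnt_err_def)

lemma upper_term:
  assumes p: "prime p" "real p \<le> t" and t: "1 \<le> t" "t \<le> sqrt x"
  shows "prime_count (x / real p) \<le> (1 + pnt_err x) * (x / (ln x - ln t)) * (1 / real p)"
proof -
  have p1: "real p \<ge> 1" using prime_ge_1_nat[OF p(1)] by simp
  have xs: "sqrt x * sqrt x = x" using x_gt by simp
  have y: "sqrt x \<le> x / real p"
  proof -
    have "real p * sqrt x \<le> sqrt x * sqrt x" using p t x_gt by (intro mult_right_mono) auto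
    thus ?thesis using p1 xs by (simp add: field_simps)
  qed
  have "1 < sqrt x" using x_gt by simp
  hence y1: "x / real p > 1" using y by linarith
  have lt: "ln t \<le> ln x / 2"
  proof -
    have "ln t \<le> ln (sqrt x)" using t x_gt by (subst ln_le_cancel_iff) auto
    thus ?thesis using x_gt by (simp add: ln_sqrt)
  qed
  have "ln (real p) \<le> ln t" using p p1 by (subst ln_le_cancel_iff) auto
  hence l: "ln (x / real p) \<ge> ln x - ln t" using x_gt p1 by (simp add: ln_div)
  have pos: "ln x - ln t > 0" using lt ln_ge by simp
  have "prime_count (x / real p) \<le> (1 + pnt_err x) * ((x / real p) / ln (x / real p))"
  proof -
    define Y where "Y = (x / real p) / ln (x / real p)"
    have "prime_count (x / real p) \<le> Y + Y * pnt_err x" using pnt[OF y] unfolding Y_def[symmetric] by (simp add: abs_le_iff)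
    thus ?thesis unfolding Y_def[symmetric] by (simp add: algebra_simps)
  qed
  also have "\<dots> \<le> (1 + pnt_err x) * ((x / real p) / (ln x - ln t))"
    using err0 by (intro mult_left_mono frac_le) (use l pos x_gt p1 in auto)
  finally show ?thesis by (simp add: field_simps)
qed

lemma lower_term:
  assumes p: "prime p" "real p \<le> sqrt x"
  shows "prime_count (x / real p) \<ge> (1 - pnt_err x) * (x / ln x) * (1 / real p)"
proof -
  have p1: "real p \<ge> 1" using prime_ge_1_nat[OF p(1)] by simp
  have xs: "sqrt x * sqrt x = x" using x_gt by simp
  have y: "sqrt x \<le> x / real p"
  proof -
    have "real p * sqrt x \<le> sqrt x * sqrt x" using p x_gt by (intro mult_right_mono) auto
    thus ?thesis using p1 xs by (simp add: field_simps)
  qed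
  have "1 < sqrt x" using x_gt by simp
  hence y1: "x / real p > 1" using y by linarith
  have l: "ln (x / real p) \<le> ln x" using x_gt p1 y1 by (subst ln_le_cancel_iff) (auto simp: field_simps mult_le_cancel_left1)
  have "(1 - pnt_err x) * ((x / real p) / ln x) \<le> (1 - pnt_err x) * ((x / real p) / ln (x / real p))"
    using l y1 x_gt p1 err1 by (intro mult_left_mono divide_left_mono mult_pos_pos) auto
  also have "\<dots> \<le> prime_count (x / real p)"
  proof -
    define Y where "Y = (x / real p) / ln (x / real p)"
    have "Y - Y * pnt_err x \<le> prime_count (x / real p)" using pnt[OF y] unfolding Y_def[symmetric] by (simp add: abs_le_iff)
    thus ?thesis unfolding Y_def[symmetric] by (simp add: algebra_simps)
  qed
  finally show ?thesis by (simp add: field_simps)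
qed

lemma upper_sum:
  assumes t: "1 \<le> t" "t \<le> sqrt x" and P: "P \<subseteq> {p. prime p \<and> real p \<le> t}"
  shows "(\<Sum>p\<in>P. prime_count (x / real p)) \<le> (1 + pnt_err x) * (x / (ln x - ln t)) * (\<Sum>p\<in>P. 1 / real p)"
  unfolding sum_distrib_left using P t by (intro sum_mono upper_term) auto

lemma lower_sum:
  assumes t: "t \<le> sqrt x"
  shows "(\<Sum>p | prime p \<and> real p \<le> t. prime_count (x / real p)) \<ge> (1 - pnt_err x) * (x / ln x) * recip_sum t"
  unfolding recip_sum_def sum_distrib_left using t by (intro sum_mono lower_term) auto

lemma recip_sum_diff:
  assumes "2 \<le> s" "s \<le> t"
  shows "(\<Sum>p | prime p \<and> s < real p \<and> real p \<le> t. 1 / real p) \<le> ln (ln t) - ln (ln s) + 2 * C"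
proof -
  have "recip_sum t = (\<Sum>p\<in>{p. prime p \<and> real p \<le> s} \<union> {p. prime p \<and> s < real p \<and> real p \<le> t}. 1 / real p)"
    unfolding recip_sum_def using assms by (intro sum.cong) auto
  also have "\<dots> = recip_sum s + (\<Sum>p | prime p \<and> s < real p \<and> real p \<le> t. 1 / real p)"
    unfolding recip_sum_def
    by (intro sum.union_disjoint finite_primes_le finite_subset[OF _ finite_primes_le[of t]]) auto
  finally show ?thesis using mert[of s] mert[of t] assms by (simp add: abs_le_iff)
qed

lemma ln_ln_pow: "ln (ln x ^ 32) = 32 * ln (ln x)"
  using ln_ge by (simp add: ln_realpow)

lemma pow_ge: "ln x ^ 32 \<ge> 2"
proof -
  have "2 \<le> ln x ^ 1" using ln_ge by simp
  also have "\<dots> \<le> ln x ^ 32" using ln_ge by (intro power_increasing) auto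
  finally show ?thesis .
qed

lemma bias_main_upper:
  assumes "quadratic_character d \<psi>"
  shows "\<bar>bias_main \<psi> x\<bar> \<le> main_upper x C"
proof -
  let ?z = "ln x ^ 32"
  have "\<bar>bias_main \<psi> x\<bar> \<le> (\<Sum>p | prime p \<and> real p \<le> ?z. \<bar>Re (\<psi> p) * prime_count (x / real p)\<bar>)"
    unfolding bias_main_def by (rule sum_abs)
  also have "\<dots> \<le> (\<Sum>p | prime p \<and> real p \<le> ?z. 1 * prime_count (x / real p))"
    unfolding abs_mult using quadratic_character_real(4)[OF assms] prime_count_nonneg
    by (intro sum_mono mult_mono) auto
  also have "\<dots> \<le> (1 + pnt_err x) * (x / (ln x - ln ?z)) * (\<Sum>p | prime p \<and> real p \<le> ?z. 1 / real p)"
    unfolding mult_1 by (rule upper_sum) (use pow_ge ln_pow in auto)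
  also have "\<dots> \<le> main_upper x C"
    unfolding main_upper_def ln_ln_pow recip_sum_def[symmetric]
    using mert[of ?z] pow_ge err0 den x_gt by (intro mult_left_mono) (auto simp: ln_ln_pow abs_le_iff)
  finally show ?thesis .
qed

lemma bias_main_lower:
  assumes \<psi>: "quadratic_character d \<psi>" and one: "\<And>p. prime p \<Longrightarrow> real p \<le> sqrt (ln x) \<Longrightarrow> \<psi> p = 1"
  shows "bias_main \<psi> x \<ge> main_lower x C"
proof -
  let ?z = "ln x ^ 32" and ?w = "sqrt (ln x)"
  have wz: "?w \<le> ?z"
  proof -
    have "?w \<le> ln x" using ln_ge by (intro real_le_lsqrt) (auto simp: power2_eq_square mult_le_cancel_left1)
    also have "\<dots> = ln x ^ 1" by simp
    also have "\<dots> \<le> ?z" using ln_ge by (intro power_increasing) auto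
    finally show ?thesis .
  qed
  let ?S = "{p. prime p \<and> real p \<le> ?w}" and ?T = "{p. prime p \<and> ?w < real p \<and> real p \<le> ?z}"
  have "bias_main \<psi> x = (\<Sum>p\<in>?S \<union> ?T. Re (\<psi> p) * prime_count (x / real p))"
    unfolding bias_main_def using wz by (intro sum.cong) auto
  also have "\<dots> = (\<Sum>p\<in>?S. Re (\<psi> p) * prime_count (x / real p)) + (\<Sum>p\<in>?T. Re (\<psi> p) * prime_count (x / real p))"
    by (intro sum.union_disjoint finite_primes_le finite_subset[OF _ finite_primes_le[of ?z]]) auto
  also have "(\<Sum>p\<in>?S. Re (\<psi> p) * prime_count (x / real p)) = (\<Sum>p\<in>?S. prime_count (x / real p))"
    using one by (intro sum.cong) auto
  finally have eq: "bias_main \<psi> x = (\<Sum>p\<in>?S. prime_count (x / real p)) + (\<Sum>p\<in>?T. Re (\<psi> p) * prime_count (x / real p))" .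
  have "(1 - pnt_err x) * (x / ln x) * (ln (ln ?w) - C) \<le> (1 - pnt_err x) * (x / ln x) * recip_sum ?w"
    using mert[OF w2] err1 x_gt by (intro mult_left_mono) (auto simp: abs_le_iff)
  also have "\<dots> \<le> (\<Sum>p\<in>?S. prime_count (x / real p))"
    by (rule lower_sum) (use wz ln_pow in linarith)
  finally have 1: "(1 - pnt_err x) * (x / ln x) * (ln (ln ?w) - C) \<le> (\<Sum>p\<in>?S. prime_count (x / real p))" .
  have "\<bar>\<Sum>p\<in>?T. Re (\<psi> p) * prime_count (x / real p)\<bar> \<le> (\<Sum>p\<in>?T. \<bar>Re (\<psi> p) * prime_count (x / real p)\<bar>)"
    by (rule sum_abs)
  also have "\<dots> \<le> (\<Sum>p\<in>?T. 1 * prime_count (x / real p))"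
    unfolding abs_mult using quadratic_character_real(4)[OF \<psi>] prime_count_nonneg
    by (intro sum_mono mult_mono) auto
  also have "\<dots> \<le> (1 + pnt_err x) * (x / (ln x - ln ?z)) * (\<Sum>p\<in>?T. 1 / real p)"
    unfolding mult_1 by (rule upper_sum) (use pow_ge ln_pow in auto)
  also have "\<dots> \<le> (1 + pnt_err x) * (x / (ln x - 32 * ln (ln x))) * (ln (32 * ln (ln x)) - ln (ln ?w) + 2 * C)"
    unfolding ln_ln_pow using recip_sum_diff[OF w2 wz] err0 den x_gt
    by (intro mult_left_mono) (auto simp: ln_ln_pow)
  finally show ?thesis unfolding main_lower_def eq using 1 by linarith
qed

lemma ln_v: "ln (x powr (1 / ln (ln x))) = ln x / ln (ln x)"
  using x_gt by (simp add: ln_powr)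

lemma ln_sqrt_x: "ln (sqrt x) = ln x / 2"
  using x_gt by (simp add: ln_sqrt)

lemma semiprime_card:
  "card (semiprimes_coprime_to d x) = card {(p, q) \<in> prime_pairs x. p \<le> q \<and> coprime p d \<and> coprime q d}"
  by (rule card_semiprimes) (auto simp: semiprimes_coprime_to_def)

text \<open>The smaller prime factor is at most sqrt x. Coprimality to d is dropped here, which
  makes the bound independent of d.\<close>

lemma semiprime_count_upper: "real (card (semiprimes_coprime_to d x)) \<le> count_upper x C"
proof -
  let ?v = "x powr (1 / ln (ln x))"
  let ?B = "SIGMA p:{p. prime p \<and> real p \<le> sqrt x}. {q. prime q \<and> real q \<le> x / real p}"
  have "{(p, q) \<in> prime_pairs x. p \<le> q \<and> coprime p d \<and> coprime q d} \<subseteq> ?B"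
  proof (rule subsetI)
    fix z assume z: "z \<in> {(p, q) \<in> prime_pairs x. p \<le> q \<and> coprime p d \<and> coprime q d}"
    obtain p q where zpq: "z = (p, q)" by (cases z)
    have pq: "(p, q) \<in> prime_pairs x" "p \<le> q" using z zpq by auto
    have "real p * real p \<le> real p * real q" using pq by (intro mult_left_mono) auto
    also have "\<dots> \<le> x" using pq by (simp add: prime_pairs_def)
    finally have "real p \<le> sqrt x" by (intro real_le_rsqrt) (simp add: power2_eq_square)
    thus "z \<in> ?B" unfolding zpq using pq prime_pairs_bound(4)[OF pq(1)] by (auto simp: prime_pairs_def)
  qed
  hence "card (semiprimes_coprime_to d x) \<le> card ?B"
    unfolding semiprime_card by (intro card_mono) (auto intro: finite_SigmaI finite_primes_le)
  also have "card ?B = (\<Sum>p | prime p \<and> real p \<le> sqrt x. card {q. prime q \<and> real q \<le> x / real p})"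
    by (intro card_SigmaI) (auto intro: finite_primes_le)
  finally have "real (card (semiprimes_coprime_to d x)) \<le> (\<Sum>p | prime p \<and> real p \<le> sqrt x. prime_count (x / real p))"
    unfolding prime_count_def by (simp flip: of_nat_sum)
  also have "\<dots> = (\<Sum>p\<in>{p. prime p \<and> real p \<le> ?v} \<union> {p. prime p \<and> ?v < real p \<and> real p \<le> sqrt x}. prime_count (x / real p))"
    using v by (intro sum.cong) auto
  also have "\<dots> = (\<Sum>p | prime p \<and> real p \<le> ?v. prime_count (x / real p)) + (\<Sum>p | prime p \<and> ?v < real p \<and> real p \<le> sqrt x. prime_count (x / real p))"
    by (intro sum.union_disjoint finite_primes_le finite_subset[OF _ finite_primes_le[of "sqrt x"]]) auto
  also have "\<dots> \<le> count_upper x C" unfolding count_upper_def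
  proof (rule add_mono)
    have d1: "ln x - ln x / ln (ln x) > 0" using lnln ln_ge by (simp add: field_simps)
    have "(\<Sum>p | prime p \<and> real p \<le> ?v. prime_count (x / real p)) \<le> (1 + pnt_err x) * (x / (ln x - ln ?v)) * (\<Sum>p | prime p \<and> real p \<le> ?v. 1 / real p)"
      by (rule upper_sum) (use v in auto)
    also have "\<dots> \<le> (1 + pnt_err x) * (x / (ln x - ln x / ln (ln x))) * (ln (ln x / ln (ln x)) + C)"
      unfolding ln_v recip_sum_def[symmetric] using mert[OF v(1)] err0 d1 x_gt
      by (intro mult_left_mono) (auto simp: ln_v abs_le_iff)
    finally show "(\<Sum>p | prime p \<and> real p \<le> ?v. prime_count (x / real p)) \<le> (1 + pnt_err x) * (x / (ln x - ln x / ln (ln x))) * (ln (ln x / ln (ln x)) + C)" .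
    have "(\<Sum>p | prime p \<and> ?v < real p \<and> real p \<le> sqrt x. prime_count (x / real p)) \<le>
        (1 + pnt_err x) * (x / (ln x - ln (sqrt x))) * (\<Sum>p | prime p \<and> ?v < real p \<and> real p \<le> sqrt x. 1 / real p)"
      by (rule upper_sum) (use x_gt in auto)
    also have "\<dots> \<le> (1 + pnt_err x) * (x / (ln x - ln x / 2)) * (ln (ln x / 2) - ln (ln x / ln (ln x)) + 2 * C)"
      unfolding ln_sqrt_x using recip_sum_diff[OF v] err0 x_gt
      by (intro mult_left_mono) (auto simp: ln_v ln_sqrt_x)
    finally show "(\<Sum>p | prime p \<and> ?v < real p \<and> real p \<le> sqrt x. prime_count (x / real p)) \<le>
        (1 + pnt_err x) * (x / (ln x - ln x / 2)) * (ln (ln x / 2) - ln (ln x / ln (ln x)) + 2 * C)" .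
  qed
  finally show ?thesis .
qed

text \<open>The primes dividing \<open>d\<close> beyond \<open>ln x\<close> are too few to contribute to the sum.\<close>

lemma recip_sum_divisors:
  assumes d: "d > 0" "real d \<le> x"
  shows "(\<Sum>p | prime p \<and> p dvd d. 1 / real p) \<le> ln (ln (ln x)) + C + 2"
proof -
  let ?D = "{p. prime p \<and> p dvd d}"
  have fin: "finite ?D" using d by (auto intro: finite_subset[of _ "{..d}"] simp: dvd_imp_le)
  have "(\<Sum>p\<in>?D. 1 / real p) \<le> (\<Sum>p\<in>?D. (if real p \<le> ln x then 1 / real p else 0) + 1 / ln x)"
  proof (rule sum_mono)
    fix p
    show "1 / real p \<le> (if real p \<le> ln x then 1 / real p else 0) + 1 / ln x"
    proof (cases "real p \<le> ln x")
      case False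
      hence "1 / real p \<le> 1 / ln x" using ln_ge by (intro frac_le) auto
      thus ?thesis using False by simp
    qed (use ln_ge in auto)
  qed
  also have "\<dots> = (\<Sum>p\<in>?D. if real p \<le> ln x then 1 / real p else 0) + real (card ?D) / ln x"
    by (simp add: sum.distrib)
  also have "(\<Sum>p\<in>?D. if real p \<le> ln x then 1 / real p else 0) = (\<Sum>p\<in>{p\<in>?D. real p \<le> ln x}. 1 / real p)"
    by (rule sum.inter_filter[OF fin, symmetric])
  also have "\<dots> \<le> recip_sum (ln x)"
    unfolding recip_sum_def by (intro sum_mono2 finite_primes_le) auto
  also have "recip_sum (ln x) \<le> ln (ln (ln x)) + C" using mert[of "ln x"] ln_ge by (simp add: abs_le_iff)
  also have "real (card ?D) / ln x \<le> 2"
  proof -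
    have "ln (real d) \<le> ln x" using d by (subst ln_le_cancel_iff) auto
    hence "real (card ?D) \<le> 2 * ln x" using card_prime_divisors_le[OF d(1)] by linarith
    thus ?thesis using ln_ge by (simp add: field_simps)
  qed
  finally show ?thesis by simp
qed

text \<open>Only pairs with p up to \<open>x powr (1 / ln (ln x))\<close> and q beyond sqrt x are
  counted, so p < q holds automatically. These p already carry ln ln x - ln ln ln x + O(1) of the
  sum of 1/p.\<close>

lemma semiprime_count_lower:
  assumes d: "d > 0" "real d \<le> x"
  shows "real (card (semiprimes_coprime_to d x)) \<ge> count_lower x C"
proof -
  let ?v = "x powr (1 / ln (ln x))"
  let ?P = "{p. prime p \<and> real p \<le> ?v}" and ?D = "{p. prime p \<and> p dvd d}"
  let ?Q = "\<lambda>p. {q. prime q \<and> sqrt x < real q \<and> real q \<le> x / real p \<and> coprime q d}"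
  let ?B = "SIGMA p:?P - ?D. ?Q p"
  have fin: "finite ?P" by (rule finite_primes_le)
  have finD: "finite ?D" using d by (auto intro: finite_subset[of _ "{..d}"] simp: dvd_imp_le)
  have finQ: "finite (?Q p)" for p by (rule finite_subset[OF _ finite_primes_le[of "x / real p"]]) auto
  have "?B \<subseteq> {(p, q) \<in> prime_pairs x. p \<le> q \<and> coprime p d \<and> coprime q d}"
  proof (rule subsetI)
    fix z assume z: "z \<in> ?B"
    obtain p q where zpq: "z = (p, q)" by (cases z)
    have p: "prime p" "real p \<le> ?v" "\<not> (prime p \<and> p dvd d)"
      and q: "prime q" "sqrt x < real q" "real q \<le> x / real p" "coprime q d" using z zpq by auto
    have "real p < real q" using p q v by linarith
    moreover have "real (p * q) \<le> x" using q(3) prime_gt_0_nat[OF p(1)] by (simp add: field_simps)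
    moreover have "coprime p d" using p by (simp add: prime_imp_coprime_nat)
    ultimately show "z \<in> {(p, q) \<in> prime_pairs x. p \<le> q \<and> coprime p d \<and> coprime q d}"
      unfolding zpq using p q by (simp add: prime_pairs_def)
  qed
  hence "card ?B \<le> card (semiprimes_coprime_to d x)"
    unfolding semiprime_card by (intro card_mono finite_subset[OF _ finite_prime_pairs[of x]]) auto
  also have "card ?B = (\<Sum>p\<in>?P - ?D. card (?Q p))" using fin finQ by (intro card_SigmaI) auto
  finally have 1: "(\<Sum>p\<in>?P - ?D. real (card (?Q p))) \<le> real (card (semiprimes_coprime_to d x))"
    by (simp flip: of_nat_sum)
  have Q: "real (card (?Q p)) \<ge> prime_count (x / real p) - (sqrt x + 2 * ln x)" for p
  proof -
    have "{q. prime q \<and> real q \<le> x / real p} \<subseteq> ?Q p \<union> {q. prime q \<and> real q \<le> sqrt x} \<union> ?D"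
      by (auto dest: prime_imp_coprime_nat)
    hence "card {q. prime q \<and> real q \<le> x / real p} \<le> card (?Q p \<union> {q. prime q \<and> real q \<le> sqrt x} \<union> ?D)"
      using finQ finD finite_primes_le by (intro card_mono) auto
    also have "\<dots> \<le> card (?Q p) + card {q. prime q \<and> real q \<le> sqrt x} + card ?D"
      by (meson add_right_mono card_Un_le order_trans)
    finally have "prime_count (x / real p) \<le> real (card (?Q p)) + prime_count (sqrt x) + real (card ?D)"
      unfolding prime_count_def by (simp flip: of_nat_add)
    moreover have "prime_count (sqrt x) \<le> sqrt x" using x_gt by (intro prime_count_le) auto
    moreover have "ln (real d) \<le> ln x" using d by (subst ln_le_cancel_iff) auto
    ultimately show ?thesis using card_prime_divisors_le[OF d(1)] by linarith
  qed
  have d1: "ln x - ln x / ln (ln x) > 0" using lnln ln_ge by (simp add: field_simps)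
  have "(\<Sum>p\<in>?P. prime_count (x / real p)) = (\<Sum>p\<in>?P - ?D. prime_count (x / real p)) + (\<Sum>p\<in>?P \<inter> ?D. prime_count (x / real p))"
    by (subst sum.Int_Diff[OF fin, of _ ?D]) (rule add.commute)
  moreover have "(\<Sum>p\<in>?P - ?D. prime_count (x / real p)) \<le> (\<Sum>p\<in>?P - ?D. real (card (?Q p)) + (sqrt x + 2 * ln x))"
    using Q by (intro sum_mono) (simp add: algebra_simps)
  moreover have "\<dots> = (\<Sum>p\<in>?P - ?D. real (card (?Q p))) + real (card (?P - ?D)) * (sqrt x + 2 * ln x)"
    by (simp add: sum.distrib)
  moreover have "real (card (?P - ?D)) * (sqrt x + 2 * ln x) \<le> ?v * (sqrt x + 2 * ln x)"
  proof (rule mult_right_mono)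
    have "card (?P - ?D) \<le> card ?P" using fin by (intro card_mono) auto
    hence "real (card (?P - ?D)) \<le> prime_count ?v" unfolding prime_count_def by simp
    also have "\<dots> \<le> ?v" by (rule prime_count_le) simp
    finally show "real (card (?P - ?D)) \<le> ?v" .
  qed (use x_gt ln_ge in auto)
  moreover have "(\<Sum>p\<in>?P \<inter> ?D. prime_count (x / real p)) \<le> (1 + pnt_err x) * (x / (ln x - ln x / ln (ln x))) * (ln (ln (ln x)) + C + 2)"
  proof -
    have "(\<Sum>p\<in>?P \<inter> ?D. prime_count (x / real p)) \<le> (1 + pnt_err x) * (x / (ln x - ln ?v)) * (\<Sum>p\<in>?P \<inter> ?D. 1 / real p)"
      by (rule upper_sum) (use v in auto)
    also have "\<dots> \<le> (1 + pnt_err x) * (x / (ln x - ln x / ln (ln x))) * (ln (ln (ln x)) + C + 2)"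
      unfolding ln_v
    proof (rule mult_left_mono)
      have "(\<Sum>p\<in>?P \<inter> ?D. 1 / real p) \<le> (\<Sum>p\<in>?D. 1 / real p)" using finD by (intro sum_mono2) auto
      also have "\<dots> \<le> ln (ln (ln x)) + C + 2" by (rule recip_sum_divisors[OF d])
      finally show "(\<Sum>p\<in>?P \<inter> ?D. 1 / real p) \<le> ln (ln (ln x)) + C + 2" .
    qed (use err0 d1 x_gt in auto)
    finally show ?thesis .
  qed
  moreover have "(1 - pnt_err x) * (x / ln x) * (ln (ln x / ln (ln x)) - C) \<le> (\<Sum>p\<in>?P. prime_count (x / real p))"
  proof -
    have "(1 - pnt_err x) * (x / ln x) * (ln (ln x / ln (ln x)) - C) \<le> (1 - pnt_err x) * (x / ln x) * recip_sum ?v"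
      using mert[OF v(1)] err1 x_gt by (intro mult_left_mono) (auto simp: ln_v abs_le_iff)
    also have "\<dots> \<le> (\<Sum>p\<in>?P. prime_count (x / real p))" by (rule lower_sum[OF v(2)])
    finally show ?thesis .
  qed
  ultimately show ?thesis using 1 unfolding count_lower_def by linarith
qed

end

lemma eventually_large_x:
  assumes "generalised_riemann_hypothesis"
  obtains C where "eventually (\<lambda>x. large_x x C) at_top"
proof -
  obtain C where C: "\<And>t. t \<ge> 2 \<Longrightarrow> \<bar>recip_sum t - ln (ln t)\<bar> \<le> C"
    using mertens[OF assms] unfolding recip_sum_def by metis
  have "eventually (\<lambda>x::real. ln x \<ge> 4) at_top" "eventually (\<lambda>x::real. ln x ^ 32 \<le> sqrt x) at_top"
    "eventually (\<lambda>x. pnt_err x \<le> 1) at_top" "eventually (\<lambda>x::real. sqrt (ln x) \<ge> 2) at_top"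
    "eventually (\<lambda>x::real. 2 \<le> x powr (1 / ln (ln x))) at_top" "eventually (\<lambda>x::real. x powr (1 / ln (ln x)) \<le> sqrt x) at_top"
    "eventually (\<lambda>x::real. ln x - 32 * ln (ln x) > 0) at_top" "eventually (\<lambda>x::real. ln (ln x) \<ge> 2) at_top"
    unfolding pnt_err_def by real_asymp+
  hence "eventually (\<lambda>x. large_x x C) at_top"
    using prime_count_uniform[OF assms] eventually_gt_at_top[of 1]
    by eventually_elim (unfold_locales, use C in auto)
  thus ?thesis by (rule that)
qed

text \<open>The numerator is asymptotic to x ln ln ln x / ln x and the denominator to x ln ln x / ln
  x; the constant C of Mertens' theorem and the error terms are of lower order in both.\<close>

lemma ratio_upper_limit:
  "((\<lambda>x. (main_upper x C + bias_error x) / count_lower x C / (ln (ln (ln x)) / ln (ln x))) \<longlongrightarrow> 1) at_top"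
  unfolding main_upper_def bias_error_def count_lower_def pnt_err_def by real_asymp

lemma ratio_lower_limit:
  "((\<lambda>x. (main_lower x C - bias_error x) / count_upper x C / (ln (ln (ln x)) / ln (ln x))) \<longlongrightarrow> 1) at_top"
  unfolding main_lower_def bias_error_def count_upper_def pnt_err_def by real_asymp

lemma eventually_count_lower_pos: "eventually (\<lambda>x. count_lower x C > 0) at_top"
  unfolding count_lower_def pnt_err_def by real_asymp

subsection \<open>Extremal characters\<close>

text \<open>By Euler's criterion the two sides are congruent modulo p, and they differ by at most 2,
  which is less than p.\<close>

lemma Legendre_mult:
  assumes p: "prime p" "2 < p"
  shows "Legendre (a * b) (int p) = Legendre a (int p) * Legendre b (int p)"
proof -
  have eu: "[Legendre c (int p) = c ^ ((p - 1) div 2)] (mod (int p))" for c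
    by (rule euler_criterion) (use p in auto)
  have "[Legendre (a * b) (int p) = (a * b) ^ ((p - 1) div 2)] (mod (int p))" by (rule eu)
  moreover have "[Legendre a (int p) * Legendre b (int p) = (a * b) ^ ((p - 1) div 2)] (mod (int p))"
    unfolding power_mult_distrib by (intro cong_mult eu)
  ultimately have "[Legendre (a * b) (int p) = Legendre a (int p) * Legendre b (int p)] (mod (int p))"
    by (meson cong_sym cong_trans)
  hence dvd: "int p dvd Legendre (a * b) (int p) - Legendre a (int p) * Legendre b (int p)"
    by (simp add: cong_iff_dvd_diff)
  have "\<bar>Legendre (a * b) (int p) - Legendre a (int p) * Legendre b (int p)\<bar> \<le> 2"
    by (auto simp: Legendre_def)
  hence "Legendre (a * b) (int p) - Legendre a (int p) * Legendre b (int p) = 0"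
    using dvd p(2) dvd_imp_le_int[OF _ dvd] by fastforce
  thus ?thesis by simp
qed

lemma Legendre_cong:
  assumes "[a = b] (mod p)" shows "Legendre a p = Legendre b p"
proof -
  have "[a = 0] (mod p) \<longleftrightarrow> [b = 0] (mod p)" using assms by (meson cong_sym cong_trans)
  moreover have "QuadRes p a \<longleftrightarrow> QuadRes p b" unfolding QuadRes_def using assms by (meson cong_sym cong_trans)
  ultimately show ?thesis by (simp add: Legendre_def)
qed

lemma Legendre_1: assumes "p > 1" shows "Legendre 1 p = 1"
proof -
  have "\<not> [1 = 0] (mod p)" using assms by (auto simp: cong_def)
  moreover have "QuadRes p 1" unfolding QuadRes_def by (rule exI[of _ 1]) simp
  ultimately show ?thesis by (simp add: Legendre_def)
qed

lemma Legendre_eq_0_iff: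
  assumes "prime p" shows "Legendre (int n) (int p) = 0 \<longleftrightarrow> \<not> coprime n p"
proof -
  have "Legendre (int n) (int p) = 0 \<longleftrightarrow> p dvd n"
    by (auto simp: Legendre_def cong_0_iff)
  also have "\<dots> \<longleftrightarrow> \<not> coprime n p" using assms by (metis coprime_commute coprime_absorb_left not_prime_unit prime_imp_coprime)
  finally show ?thesis .
qed

text \<open>z and p - z have the same square, so at most (p - 1) / 2 of the p - 1 nonzero classes
  are squares.\<close>

lemma exists_nonresidue:
  assumes p: "prime p" "2 < p"
  shows "\<exists>n. Legendre (int n) (int p) = -1"
proof (rule ccontr)
  assume *: "\<not> ?thesis"
  let ?f = "\<lambda>y::nat. (y * y) mod p"
  have "{1..<p} \<subseteq> ?f ` {1..(p - 1) div 2}"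
  proof
    fix n assume n: "n \<in> {1..<p}"
    hence "\<not> [int n = 0] (mod (int p))" by (auto simp: cong_0_iff dest: dvd_imp_le)
    hence "QuadRes (int p) (int n)" using * by (auto simp: Legendre_def split: if_splits)
    then obtain y where y: "[y ^ 2 = int n] (mod (int p))" by (auto simp: QuadRes_def)
    define z where "z = nat (y mod int p)"
    have z: "int z = y mod int p" using p by (simp add: z_def)
    have zp: "z < p" using p z by (metis of_nat_0_less_iff of_nat_less_iff pos_mod_bound prime_gt_0_nat)
    have "[int (z * z) = int n] (mod (int p))"
    proof -
      have "[y mod int p * (y mod int p) = y * y] (mod (int p))" by (intro cong_mult) (auto simp: cong_def)
      thus ?thesis using y z by (metis cong_trans of_nat_mult power2_eq_square)
    qed
    hence zz: "[z * z = n] (mod p)" by (simp only: cong_int_iff)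
    hence zn: "(z * z) mod p = n" using n by (simp add: cong_def)
    have z0: "z \<noteq> 0" using zn n by (cases "z = 0") auto
    show "n \<in> ?f ` {1..(p - 1) div 2}"
    proof (cases "z \<le> (p - 1) div 2")
      case True thus ?thesis using zn z0 by (intro image_eqI[of _ _ z]) auto
    next
      case False
      have "[int ((p - z) * (p - z)) = int (z * z)] (mod (int p))"
      proof -
        have "int ((p - z) * (p - z)) = (int p - int z) * (int p - int z)" using zp by (simp add: of_nat_diff)
        also have "\<dots> = int (z * z) + int p * (int p - 2 * int z)" by (simp add: algebra_simps)
        finally show ?thesis by (simp add: cong_def)
      qed
      hence "[(p - z) * (p - z) = z * z] (mod p)" by (simp only: cong_int_iff)
      hence "((p - z) * (p - z)) mod p = n" using zn by (simp add: cong_def)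
      moreover have "odd p" using prime_odd_nat[OF p] .
      hence "p - z \<in> {1..(p - 1) div 2}" using False zp by (auto elim!: oddE)
      ultimately show ?thesis by (intro image_eqI[of _ _ "p - z"]) auto
    qed
  qed
  hence "card {1..<p} \<le> card (?f ` {1..(p - 1) div 2})" by (intro card_mono) auto
  also have "\<dots> \<le> (p - 1) div 2" using card_image_le[of "{1..(p - 1) div 2}" ?f] by simp
  finally show False using p by simp
qed

definition legendre_product :: "nat \<Rightarrow> nat \<Rightarrow> nat \<Rightarrow> complex" where
  "legendre_product p q n = of_int (Legendre (int n) (int p) * Legendre (int n) (int q))"

lemma legendre_product_commute: "legendre_product p q = legendre_product q p"
  by (auto simp: legendre_product_def mult.commute)

lemma legendre_product_character:
  assumes p: "prime p" "2 < p" and q: "prime q" "2 < q"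
  shows "dirichlet_character (p * q) (legendre_product p q)"
  unfolding dirichlet_character_def
proof (intro conjI allI)
  show "p * q > 0" using p q by simp
  show "legendre_product p q 1 = 1" using p q by (simp add: legendre_product_def Legendre_1)
  show "legendre_product p q (m * n) = legendre_product p q m * legendre_product p q n" for m n
    using Legendre_mult[OF p] Legendre_mult[OF q] by (simp add: legendre_product_def mult_ac)
  show "legendre_product p q (n + p * q) = legendre_product p q n" for n
  proof -
    have "[int (n + p * q) = int n] (mod (int p))" "[int (n + p * q) = int n] (mod (int q))" by (auto simp: cong_def)
    thus ?thesis using Legendre_cong by (simp only: legendre_product_def)
  qed
  show "legendre_product p q n = 0 \<longleftrightarrow> \<not> coprime n (p * q)" for n
    using Legendre_eq_0_iff[OF p(1), of n] Legendre_eq_0_iff[OF q(1), of n] by (simp add: legendre_product_def)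
qed

text \<open>An argument that is 1 modulo \<open>q\<close> and a nonresidue modulo \<open>p\<close> separates the product from
  every character whose modulus is not divisible by \<open>p\<close>.\<close>

lemma legendre_product_separating:
  assumes p: "prime p" "2 < p" and q: "prime q" "2 < q" and pq: "p \<noteq> q"
  obtains n where "[n = 1] (mod q)" "coprime n (p * q)" "legendre_product p q n = -1"
proof -
  from exists_nonresidue[OF p] obtain m where m: "Legendre (int m) (int p) = -1" by blast
  have "coprime p q" using p q pq by (simp add: primes_coprime)
  from binary_chinese_remainder_nat[OF this, of m 1] obtain n where n: "[n = m] (mod p)" "[n = 1] (mod q)" by blast
  have 1: "Legendre (int n) (int p) = -1" using m n(1) Legendre_cong[of "int n" "int m" "int p"] by (simp add: cong_int_iff)
  have 2: "Legendre (int n) (int q) = 1"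
    using n(2) Legendre_cong[of "int n" "int 1" "int q"] Legendre_1[of "int q"] q by (simp only: cong_int_iff) simp
  have "legendre_product p q n = -1" by (simp add: legendre_product_def 1 2)
  moreover have "coprime n (p * q)"
    using Legendre_eq_0_iff[OF p(1), of n] Legendre_eq_0_iff[OF q(1), of n] 1 2 by simp
  ultimately show ?thesis using that n(2) by blast
qed

lemma legendre_product_not_induced:
  assumes p: "prime p" "2 < p" and q: "prime q" "2 < q" and pq: "p \<noteq> q"
    and c: "c dvd q" "dirichlet_character c \<phi>"
  shows "\<exists>n. coprime n (p * q) \<and> legendre_product p q n \<noteq> \<phi> n"
proof -
  obtain n where n: "[n = 1] (mod q)" "coprime n (p * q)" "legendre_product p q n = -1"
    by (rule legendre_product_separating[OF p q pq])
  have "[n = 1] (mod c)" by (rule cong_dvd_modulus_nat[OF n(1) c(1)])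
  hence "\<phi> n = \<phi> 1" using dirichlet_character_mod[OF c(2)] by (metis cong_def)
  hence "\<phi> n = 1" using c(2) by (simp add: dirichlet_character_def)
  thus ?thesis using n by auto
qed

text \<open>For primitivity, a proper divisor of pq divides p or q. In either case
  \<open>legendre_product_not_induced\<close> applies, with the two primes exchanged in the
  second.\<close>

lemma quadratic_legendre_product:
  assumes p: "prime p" "2 < p" and q: "prime q" "2 < q" and pq: "p \<noteq> q"
  shows "quadratic_character (p * q) (legendre_product p q)"
  unfolding quadratic_character_def primitive_character_def
proof (intro conjI allI notI)
  show "dirichlet_character (p * q) (legendre_product p q)" by (rule legendre_product_character[OF p q])
  show "legendre_product p q n \<in> \<real>" for n by (simp add: legendre_product_def)
next
  assume "\<exists>q' \<phi>. q' dvd p * q \<and> q' < p * q \<and> dirichlet_character q' \<phi> \<and> (\<forall>n. coprime n (p * q) \<longrightarrow> legendre_product p q n = \<phi> n)"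
  then obtain c \<phi> where c: "c dvd p * q" "c < p * q" "dirichlet_character c \<phi>"
    and eq: "\<And>n. coprime n (p * q) \<Longrightarrow> legendre_product p q n = \<phi> n" by blast
  have "c dvd p \<or> c dvd q"
  proof (rule ccontr)
    assume *: "\<not> ?thesis"
    from division_decomp[OF c(1)] obtain b1 b2 where b: "c = b1 * b2" "b1 dvd p" "b2 dvd q" by blast
    have "b1 = p" "b2 = q" using b * p(1) q(1) by (auto simp: prime_nat_iff)
    thus False using b c(2) by simp
  qed
  thus False
  proof
    assume "c dvd q"
    thus False using legendre_product_not_induced[OF p q pq _ c(3)] eq by blast
  next
    assume "c dvd p"
    from legendre_product_not_induced[OF q p pq[symmetric] this c(3)] show False
      using eq by (auto simp: legendre_product_commute[of q p] mult.commute[of q p])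
  qed
next
  assume "legendre_product p q = principal_character (p * q)"
  moreover obtain n where "coprime n (p * q)" "legendre_product p q n = -1"
    by (rule legendre_product_separating[OF p q pq])
  ultimately show False by (simp add: principal_character_def)
qed

text \<open>Pigeonhole principle: there are more primes up to \<open>\<surd>x\<close> than sign patterns of the Legendre symbol on
  the primes up to \<open>\<surd>(ln x)\<close>, so two primes share their pattern.\<close>

lemma exists_extremal_character:
  assumes w: "w \<ge> 2" and x: "x \<ge> 0" and big: "prime_count (sqrt x) > w + 2 powr w"
  shows "\<exists>d \<psi>. quadratic_character d \<psi> \<and> real d \<le> x \<and> (\<forall>p. prime p \<longrightarrow> real p \<le> w \<longrightarrow> \<psi> p = 1)"
proof -
  let ?Q = "{q. prime q \<and> w < real q \<and> real q \<le> sqrt x}"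
  let ?P = "{p. prime p \<and> real p \<le> w}"
  \<comment> \<open>The set where the symbol is 1 determines it on all primes p \<le> w: since q > w
    it does not vanish there, so it is -1 elsewhere.\<close>
  define pat where "pat = (\<lambda>q. {p \<in> ?P. Legendre (int p) (int q) = 1})"
  have finP: "finite ?P" by (rule finite_primes_le)
  have finQ: "finite ?Q" by (rule finite_subset[OF _ finite_primes_le[of "sqrt x"]]) auto
  have "card (pat ` ?Q) \<le> card (Pow ?P)" using finP by (intro card_mono) (auto simp: pat_def)
  also have "\<dots> = 2 ^ card ?P" using finP by (rule card_Pow)
  finally have "real (card (pat ` ?Q)) \<le> real (2 ^ card ?P)" by (rule of_nat_mono)
  also have "\<dots> = 2 powr prime_count w" by (simp add: powr_realpow prime_count_def)
  also have "\<dots> \<le> 2 powr w" using w by (intro powr_mono prime_count_le) auto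
  finally have 1: "real (card (pat ` ?Q)) \<le> 2 powr w" .
  have "{p. prime p \<and> real p \<le> sqrt x} \<subseteq> ?Q \<union> ?P" by auto
  hence "card {p. prime p \<and> real p \<le> sqrt x} \<le> card (?Q \<union> ?P)" using finP finQ by (intro card_mono) auto
  also have "\<dots> \<le> card ?Q + card ?P" by (rule card_Un_le)
  finally have "prime_count (sqrt x) \<le> real (card ?Q) + prime_count w"
    unfolding prime_count_def by (simp flip: of_nat_add)
  moreover have "prime_count w \<le> w" using w by (intro prime_count_le) auto
  ultimately have "card (pat ` ?Q) < card ?Q" using 1 big by simp
  hence "\<not> inj_on pat ?Q" using card_image by force
  then obtain q1 q2 where q: "q1 \<in> ?Q" "q2 \<in> ?Q" "pat q1 = pat q2" "q1 \<noteq> q2" by (auto simp: inj_on_def)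
  have q1: "prime q1" "2 < q1" "w < real q1" "real q1 \<le> sqrt x" using q w by auto
  have q2: "prime q2" "2 < q2" "w < real q2" "real q2 \<le> sqrt x" using q w by auto
  have "legendre_product q1 q2 p = 1" if p: "prime p" "real p \<le> w" for p
  proof -
    have "p \<noteq> q1" "p \<noteq> q2" using p q1 q2 by auto
    hence "Legendre (int p) (int q1) \<noteq> 0" "Legendre (int p) (int q2) \<noteq> 0"
      using p q1 q2 by (auto simp: Legendre_eq_0_iff primes_coprime)
    moreover have "Legendre (int p) (int q1) = 1 \<longleftrightarrow> Legendre (int p) (int q2) = 1"
      using q(3) p unfolding pat_def by blast
    ultimately show ?thesis by (auto simp: legendre_product_def Legendre_def split: if_splits)
  qed
  moreover have "real (q1 * q2) \<le> sqrt x * sqrt x" unfolding of_nat_mult using q1 q2 x by (intro mult_mono) auto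
  hence "real (q1 * q2) \<le> x" using x by simp
  ultimately show ?thesis using quadratic_legendre_product[OF q1(1,2) q2(1,2) q(4)] by blast
qed

section \<open>The maximum over all characters\<close>

text \<open>Makes \<open>Max\<close> meaningful. By periodicity a character modulo d is determined
  by its values below d, and these lie in {0, 1, -1}.\<close>

lemma finite_quadratic_characters:
  "finite {(d, \<psi>). quadratic_character d \<psi> \<and> real d \<le> x}"
proof -
  let ?F = "\<lambda>d. {\<psi>. quadratic_character d \<psi>}"
  have "finite (?F d)" for d
  proof (rule finite_imageD)
    show "finite ((\<lambda>\<psi>. restrict \<psi> {..<d}) ` ?F d)"
    proof (rule finite_subset)
      show "(\<lambda>\<psi>. restrict \<psi> {..<d}) ` ?F d \<subseteq> PiE {..<d} (\<lambda>_. {0, 1, -1})"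
      proof (rule image_subsetI)
        fix \<psi> assume "\<psi> \<in> ?F d"
        hence "\<psi> n \<in> {0, 1, -1}" for n using quadratic_character_cases[of d \<psi> n] by simp
        thus "restrict \<psi> {..<d} \<in> PiE {..<d} (\<lambda>_. {0, 1, -1})" unfolding restrict_PiE_iff by blast
      qed
    qed (intro finite_PiE, auto)
    show "inj_on (\<lambda>\<psi>. restrict \<psi> {..<d}) (?F d)"
    proof (rule inj_onI, rule ext)
      fix \<psi> \<psi>' n assume *: "\<psi> \<in> ?F d" "\<psi>' \<in> ?F d" "restrict \<psi> {..<d} = restrict \<psi>' {..<d}"
      hence dc: "dirichlet_character d \<psi>" "dirichlet_character d \<psi>'"
        by (auto simp: quadratic_character_def primitive_character_def)
      hence "n mod d \<in> {..<d}" by (simp add: dirichlet_character_def)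
      hence "\<psi> (n mod d) = \<psi>' (n mod d)" using fun_cong[OF *(3), of "n mod d"] by simp
      thus "\<psi> n = \<psi>' n" using dirichlet_character_mod[OF dc(1)] dirichlet_character_mod[OF dc(2)] by simp
    qed
  qed
  hence "finite (SIGMA d:{..nat \<lfloor>x\<rfloor>}. ?F d)" by (intro finite_SigmaI) auto
  moreover have "{(d, \<psi>). quadratic_character d \<psi> \<and> real d \<le> x} \<subseteq> (SIGMA d:{..nat \<lfloor>x\<rfloor>}. ?F d)"
    by (auto simp: le_nat_floor)
  ultimately show ?thesis by (rule finite_subset[rotated])
qed

text \<open>\<open>Max\<close> of the empty set is unspecified; the witness of the lower bound also
  shows that the set is nonempty.\<close>

lemma max_semiprime_bias_bounds:
  assumes ex: "\<exists>d \<psi>. quadratic_character d \<psi> \<and> real d \<le> x \<and> l \<le> semiprime_bias d \<psi> \<eta> x"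
    and all: "\<And>d \<psi>. quadratic_character d \<psi> \<Longrightarrow> real d \<le> x \<Longrightarrow> semiprime_bias d \<psi> \<eta> x \<le> u"
  shows "l \<le> max_semiprime_bias \<eta> x \<and> max_semiprime_bias \<eta> x \<le> u"
proof -
  let ?B = "{semiprime_bias d \<psi> \<eta> x | d \<psi>. quadratic_character d \<psi> \<and> real d \<le> x}"
  have "?B = (\<lambda>(d, \<psi>). semiprime_bias d \<psi> \<eta> x) ` {(d, \<psi>). quadratic_character d \<psi> \<and> real d \<le> x}" by auto
  hence fin: "finite ?B" using finite_quadratic_characters[of x] by simp
  obtain d \<psi> where d: "quadratic_character d \<psi>" "real d \<le> x" "l \<le> semiprime_bias d \<psi> \<eta> x" using ex by blast
  have mem: "semiprime_bias d \<psi> \<eta> x \<in> ?B" using d by blast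
  have "l \<le> Max ?B" using d(3) Max_ge[OF fin mem] by linarith
  moreover have "Max ?B \<le> u" using mem fin all by (subst Max_le_iff) auto
  ultimately show ?thesis unfolding max_semiprime_bias_def by blast
qed

text \<open>\<eta> enters only as a sign in front of the main term, so after taking absolute values
  both choices of \<eta> obey the same bounds.\<close>

lemma (in large_x) semiprime_bias_bounds:
  assumes grh: "generalised_riemann_hypothesis" and \<psi>: "quadratic_character d \<psi>" and d: "real d \<le> x"
    and \<eta>: "\<eta> \<in> {-1, 1}" and pos: "count_lower x C > 0"
  shows "semiprime_bias d \<psi> \<eta> x \<le> (main_upper x C + bias_error x) / count_lower x C"
    and "\<lbrakk>\<And>p. prime p \<Longrightarrow> real p \<le> sqrt (ln x) \<Longrightarrow> \<psi> p = 1; main_lower x C - bias_error x \<ge> 0\<rbrakk>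
       \<Longrightarrow> (main_lower x C - bias_error x) / count_upper x C \<le> semiprime_bias d \<psi> \<eta> x"
proof -
  have d0: "d > 0" using \<psi> by (auto simp: quadratic_character_def primitive_character_def dirichlet_character_def)
  define N where "N = real (card (semiprimes_coprime_to d x))"
  define T where "T = 4 * real (card (semiprimes_with_values \<psi> \<eta> x)) - N"
  have Nlow: "count_lower x C \<le> N" unfolding N_def by (rule semiprime_count_lower[OF d0 d])
  have Nup: "N \<le> count_upper x C" unfolding N_def by (rule semiprime_count_upper)
  have N0: "N > 0" using pos Nlow by linarith
  have bias: "semiprime_bias d \<psi> \<eta> x = \<bar>T\<bar> / N"
  proof -
    have "real (card (semiprimes_with_values \<psi> \<eta> x)) / (1 / 4 * N) - 1 = T / N"
      using N0 by (simp add: T_def field_simps)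
    thus ?thesis using N0 by (simp add: semiprime_bias_def N_def[symmetric])
  qed
  have "sqrt x \<le> x" using x_gt by (intro real_le_lsqrt) (auto simp: power2_eq_square)
  hence app: "\<bar>T - Re \<eta> * bias_main \<psi> x\<bar> \<le> bias_error x"
    unfolding T_def N_def using bias_approximation[OF grh \<psi> d _ _ \<eta>] ln_ge ln_pow by simp
  have abs: "\<bar>Re \<eta> * bias_main \<psi> x\<bar> = \<bar>bias_main \<psi> x\<bar>" using \<eta> by (auto simp: abs_mult)
  have "\<bar>T\<bar> \<le> main_upper x C + bias_error x" using app abs bias_main_upper[OF \<psi>] by linarith
  thus "semiprime_bias d \<psi> \<eta> x \<le> (main_upper x C + bias_error x) / count_lower x C"
    unfolding bias using pos Nlow by (intro frac_le) auto
  show "(main_lower x C - bias_error x) / count_upper x C \<le> semiprime_bias d \<psi> \<eta> x"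
    if "\<And>p. prime p \<Longrightarrow> real p \<le> sqrt (ln x) \<Longrightarrow> \<psi> p = 1" "main_lower x C - bias_error x \<ge> 0"
  proof -
    have "main_lower x C \<le> bias_main \<psi> x" by (rule bias_main_lower[OF \<psi> that(1)])
    hence "main_lower x C - bias_error x \<le> \<bar>T\<bar>" using app abs by linarith
    \<comment> \<open>A nonnegative numerator allows the denominator N to be enlarged to
      \<open>count_upper\<close>.\<close>
    thus ?thesis unfolding bias using that(2) N0 Nup by (intro frac_le) auto
  qed
qed

lemma max_semiprime_bias_sandwich:
  assumes grh: "generalised_riemann_hypothesis" and \<eta>: "\<eta> \<in> {-1, 1}"
    and C: "eventually (\<lambda>x. large_x x C) at_top"
  shows "eventually (\<lambda>x. (main_lower x C - bias_error x) / count_upper x C \<le> max_semiprime_bias \<eta> x \<and>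
    max_semiprime_bias \<eta> x \<le> (main_upper x C + bias_error x) / count_lower x C) at_top"
proof -
  \<comment> \<open>About 2 sqrt x / ln x primes up to sqrt x stand against at most 2^sqrt(ln x)
    sign patterns and the primes up to sqrt(ln x) themselves.\<close>
  have "eventually (\<lambda>x. sqrt x / ln (sqrt x) * (1 - pnt_err x) > sqrt (ln x) + 2 powr sqrt (ln x)) at_top"
    unfolding pnt_err_def by real_asymp
  moreover have "eventually (\<lambda>x. main_lower x C - bias_error x \<ge> 0) at_top"
    unfolding main_lower_def bias_error_def pnt_err_def by real_asymp
  moreover note eventually_count_lower_pos[of C] C
  ultimately show ?thesis
  proof eventually_elim
    case (elim x)
    interpret large_x x C by fact
    have "\<bar>prime_count (sqrt x) - sqrt x / ln (sqrt x)\<bar> \<le> sqrt x / ln (sqrt x) * pnt_err x" by (rule pnt) simp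
    hence "prime_count (sqrt x) > sqrt (ln x) + 2 powr sqrt (ln x)" using elim(1) by (simp add: right_diff_distrib abs_le_iff)
    from exists_extremal_character[OF w2 _ this] x_gt obtain d \<psi> where
      d: "quadratic_character d \<psi>" "real d \<le> x" "\<And>p. prime p \<Longrightarrow> real p \<le> sqrt (ln x) \<Longrightarrow> \<psi> p = 1" by auto
    show ?case
    proof (rule max_semiprime_bias_bounds)
      show "\<exists>d \<psi>. quadratic_character d \<psi> \<and> real d \<le> x \<and> (main_lower x C - bias_error x) / count_upper x C \<le> semiprime_bias d \<psi> \<eta> x"
        using d semiprime_bias_bounds(2)[OF grh d(1,2) \<eta> elim(3) d(3) elim(2)] by blast
    qed (rule semiprime_bias_bounds(1)[OF grh _ _ \<eta> elim(3)])
  qed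
qed

theorem theorem1p4:
  fixes \<eta> :: complex
  assumes "generalised_riemann_hypothesis"
    and "\<eta> \<in> {-1, 1}"
  shows "(\<lambda>x::real. max_semiprime_bias \<eta> x) \<sim>[at_top] (\<lambda>x. ln (ln (ln x)) / ln (ln x))"
proof (rule asymp_equivI')
  obtain C where C: "eventually (\<lambda>x. large_x x C) at_top"
    by (rule eventually_large_x[OF assms(1)])
  have "eventually (\<lambda>x::real. ln (ln (ln x)) / ln (ln x) > 0) at_top" by real_asymp
  with max_semiprime_bias_sandwich[OF assms C]
  have sandwich: "eventually (\<lambda>x.
      (main_lower x C - bias_error x) / count_upper x C / (ln (ln (ln x)) / ln (ln x))
        \<le> max_semiprime_bias \<eta> x / (ln (ln (ln x)) / ln (ln x)) \<and>
      max_semiprime_bias \<eta> x / (ln (ln (ln x)) / ln (ln x))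
        \<le> (main_upper x C + bias_error x) / count_lower x C / (ln (ln (ln x)) / ln (ln x))) at_top"
    by eventually_elim (intro conjI divide_right_mono; simp)
  show "((\<lambda>x. max_semiprime_bias \<eta> x / (ln (ln (ln x)) / ln (ln x))) \<longlongrightarrow> 1) at_top"
  proof (rule tendsto_sandwich[OF _ _ ratio_lower_limit ratio_upper_limit])
  qed (use sandwich in \<open>auto elim: eventually_mono\<close>)
qed

end
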